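(* Assume that a symmetric matrix $A=(a_{ij})_{1\le i,j\le n}$ has exactly one positive eigenvalue and satisfies $a_{ij}\ge0$ for any $1\le i,j\le n$ and $\sum_{j=1}^na_{ij}>0$ for each $i=1,\dots,n$. Then any positive vector solution $\vec u=(u_1,\dots,u_n)$ of $$-\Delta u_i+\lambda u_i=\sum_{j=1}^na_{ij}u_iu_j^2\ \text{ in }\Omega,\quad u_i\in H,\quad 1\le i\le n,$$ is synchronized.
   Context: $\Omega\subset\mathbb{R}^N$ is a domain, $N\le 3$, $\lambda>0$. $H=H^1_0(\Omega)$, except that if $\Omega=\mathbb{R}^N$ then $H$ is the subspace of radially symmetric functions in $H^1(\mathbb{R}^N)$. A positive vector solution is a solution with $u_i>0$ in $\Omega$ for every $i$. It is synchronized if $\vec u\in\mathbb{R}^nU=\{\vec cU\mid\vec c\in\mathbb{R}^n\}$ for some positive solution $U\in H$ of $\Delta u-\lambda u+u^3=0$ in $\Omega$, $u=0$ on $\partial\Omega$ (so the components are mutually proportional by positive constants). Eigenvalues are counted with multiplicity. *)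

theory Defs
  imports "HOL-Analysis.Analysis"
begin

definition domain :: "'a::euclidean_space set \<Rightarrow> bool" where
  "domain \<Omega> \<longleftrightarrow> open \<Omega> \<and> connected \<Omega> \<and> \<Omega> \<noteq> {}"

(* The functions that are k times continuously differentiable on the whole space:
   all partial derivatives of order at most k exist and are continuous. *)
primrec C_class :: "nat \<Rightarrow> ('a::euclidean_space \<Rightarrow> real) set" where
  "C_class 0 = {f. continuous_on UNIV f}"
| "C_class (Suc k) = {f. (\<forall>x. f differentiable (at x)) \<and>
      (\<forall>b\<in>Basis. (\<lambda>x. frechet_derivative f (at x) b) \<in> C_class k)}"

definition grad :: "('a::euclidean_space \<Rightarrow> real) \<Rightarrow> 'a \<Rightarrow> 'a" where
  "grad f x = (\<Sum>b\<in>Basis. frechet_derivative f (at x) b *\<^sub>R b)"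

(* Smooth functions compactly supported in the open set \<Omega>, extended by 0 to the whole space. *)
definition test_functions :: "'a::euclidean_space set \<Rightarrow> ('a \<Rightarrow> real) set" where
  "test_functions \<Omega> = {\<phi>. (\<forall>k. \<phi> \<in> C_class k) \<and>
      compact (closure {x. \<phi> x \<noteq> 0}) \<and> closure {x. \<phi> x \<noteq> 0} \<subseteq> \<Omega>}"

(* Elements of the function spaces below are representatives: nothing depends on their
   values on a null set or outside \<Omega>. *)
definition L2 :: "'a::euclidean_space set \<Rightarrow> ('a \<Rightarrow> 'b::euclidean_space) set" where
  "L2 \<Omega> = {f \<in> borel_measurable (lebesgue_on \<Omega>).
      integrable (lebesgue_on \<Omega>) (\<lambda>x. (norm (f x))\<^sup>2)}"

(* u belongs to H^1(\<Omega>) and g is its distributional gradient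
   (determined by u up to null sets). *)
definition has_H1_gradient ::
  "'a::euclidean_space set \<Rightarrow> ('a \<Rightarrow> real) \<Rightarrow> ('a \<Rightarrow> 'a) \<Rightarrow> bool" where
  "has_H1_gradient \<Omega> u g \<longleftrightarrow> u \<in> L2 \<Omega> \<and> g \<in> L2 \<Omega> \<and>
      (\<forall>\<phi>\<in>test_functions \<Omega>. \<forall>b\<in>Basis.
         (LINT x|lebesgue_on \<Omega>. u x * (grad \<phi> x \<bullet> b)) =
         - (LINT x|lebesgue_on \<Omega>. (g x \<bullet> b) * \<phi> x))"

definition H1 :: "'a::euclidean_space set \<Rightarrow> ('a \<Rightarrow> real) set" where
  "H1 \<Omega> = {u. \<exists>g. has_H1_gradient \<Omega> u g}"

(* The closure of the test functions in the H^1(\<Omega>) norm. *)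
definition H10 :: "'a::euclidean_space set \<Rightarrow> ('a \<Rightarrow> real) set" where
  "H10 \<Omega> = {u. \<exists>g. has_H1_gradient \<Omega> u g \<and>
      (\<exists>\<phi>::nat \<Rightarrow> 'a \<Rightarrow> real. (\<forall>k. \<phi> k \<in> test_functions \<Omega>) \<and>
         (\<lambda>k. LINT x|lebesgue_on \<Omega>. (u x - \<phi> k x)\<^sup>2 + (norm (g x - grad (\<phi> k) x))\<^sup>2)
           \<longlonglongrightarrow> 0)}"

definition radially_symmetric :: "('a::euclidean_space \<Rightarrow> real) \<Rightarrow> bool" where
  "radially_symmetric u \<longleftrightarrow> (\<exists>v. AE x in lebesgue. u x = v (norm x))"

definition H_space :: "'a::euclidean_space set \<Rightarrow> ('a \<Rightarrow> real) set" where
  "H_space \<Omega> = (if \<Omega> = UNIV then {u \<in> H1 UNIV. radially_symmetric u} else H10 \<Omega>)"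

(* u is a weak solution in H of - Laplace u + lam u = f in \<Omega>; the boundary condition u = 0 is
   the membership in H.  The right-hand side must be locally integrable for the equation to
   make sense as one between distributions; without this clause the integral of a
   non-integrable function would be 0. *)
definition weak_solution ::
  "'a::euclidean_space set \<Rightarrow> real \<Rightarrow> ('a \<Rightarrow> real) \<Rightarrow> ('a \<Rightarrow> real) \<Rightarrow> bool" where
  "weak_solution \<Omega> lam u f \<longleftrightarrow> u \<in> H_space \<Omega> \<and>
      (\<forall>K. compact K \<and> K \<subseteq> \<Omega> \<longrightarrow> set_integrable lebesgue K f) \<and>
      (\<exists>g. has_H1_gradient \<Omega> u g \<and>
         (\<forall>\<phi>\<in>test_functions \<Omega>.
            (LINT x|lebesgue_on \<Omega>. g x \<bullet> grad \<phi> x + lam * u x * \<phi> x) =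
            (LINT x|lebesgue_on \<Omega>. f x * \<phi> x)))"

definition positive_in :: "'a::euclidean_space set \<Rightarrow> ('a \<Rightarrow> real) \<Rightarrow> bool" where
  "positive_in \<Omega> u \<longleftrightarrow> (AE x in lebesgue_on \<Omega>. u x > 0)"

definition positive_vector_solution ::
  "'a::euclidean_space set \<Rightarrow> real \<Rightarrow> real^'n^'n \<Rightarrow> ('n \<Rightarrow> 'a \<Rightarrow> real) \<Rightarrow> bool" where
  "positive_vector_solution \<Omega> lam A u \<longleftrightarrow>
      (\<forall>i. weak_solution \<Omega> lam (u i) (\<lambda>x. \<Sum>j\<in>UNIV. A $ i $ j * u i x * (u j x)\<^sup>2) \<and>
           positive_in \<Omega> (u i))"

definition positive_scalar_solution ::
  "'a::euclidean_space set \<Rightarrow> real \<Rightarrow> ('a \<Rightarrow> real) \<Rightarrow> bool" where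
  "positive_scalar_solution \<Omega> lam U \<longleftrightarrow>
      weak_solution \<Omega> lam U (\<lambda>x. (U x) ^ 3) \<and> positive_in \<Omega> U"

definition synchronized ::
  "'a::euclidean_space set \<Rightarrow> real \<Rightarrow> ('n::finite \<Rightarrow> 'a \<Rightarrow> real) \<Rightarrow> bool" where
  "synchronized \<Omega> lam u \<longleftrightarrow>
      (\<exists>U. positive_scalar_solution \<Omega> lam U \<and>
         (\<exists>c::real^'n. \<forall>i. AE x in lebesgue_on \<Omega>. u i x = c $ i * U x))"

definition eigenspace :: "real^'n^'n \<Rightarrow> real \<Rightarrow> (real^'n) set" where
  "eigenspace A \<mu> = {v. A *v v = \<mu> *\<^sub>R v}"

definition eigenvalues :: "real^'n^'n \<Rightarrow> real set" where
  "eigenvalues A = {\<mu>. \<exists>v \<in> eigenspace A \<mu>. v \<noteq> 0}"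

(* Eigenvalues are counted with their multiplicity, the dimension of the eigenspace; this is
   used for symmetric matrices only, where algebraic and geometric multiplicity agree. *)
definition num_positive_eigenvalues :: "real^'n^'n \<Rightarrow> nat" where
  "num_positive_eigenvalues A = (\<Sum>\<mu> \<in> {\<mu> \<in> eigenvalues A. \<mu> > 0}. dim (eigenspace A \<mu>))"

end

theory Submission
  imports Defs "HOL-Computational_Algebra.Polynomial"
begin

text \<open>
  Write \<open>f\<^sub>i = \<Sum>\<^sub>k a\<^sub>i\<^sub>k u\<^sub>k\<^sup>2\<close>, so that \<open>u\<^sub>i > 0\<close> solves \<open>- \<Delta>u\<^sub>i + \<lambda>u\<^sub>i = f\<^sub>i u\<^sub>i\<close>. Testing this equation with
  \<open>z\<^sup>2 / u\<^sub>i\<close> gives Picone's inequality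
  \<open>\<integral>f\<^sub>i z\<^sup>2 + \<integral>\<bar>\<nabla>z - (z / u\<^sub>i) \<nabla>u\<^sub>i\<bar>\<^sup>2 \<le> \<integral>\<bar>\<nabla>z\<bar>\<^sup>2 + \<lambda>z\<^sup>2\<close> for all \<open>z\<close> in \<open>H\<close>; with \<open>z = u\<^sub>j\<close> the right-hand
  side is \<open>\<integral>f\<^sub>j u\<^sub>j\<^sup>2\<close>. So \<open>\<integral>f\<^sub>i u\<^sub>j\<^sup>2 \<le> \<integral>f\<^sub>j u\<^sub>j\<^sup>2\<close> for all \<open>i, j\<close>, and the finiteness of
  these integrals also comes from Picone's inequality.

  Let \<open>p\<close> maximize the quadratic form of \<open>A\<close> on the standard simplex. Since \<open>A\<close> has one positive
  eigenvalue, it satisfies a reverse Cauchy-Schwarz inequality, which yields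
  \<open>w \<bullet> A w \<le> (\<Sum>\<^sub>j w\<^sub>j) (p \<bullet> A w)\<close> for all \<open>w \<ge> 0\<close>. Applied pointwise to \<open>w\<^sub>j = u\<^sub>j\<^sup>2\<close> and integrated, it is
  opposite to the average of the previous inequalities with the weights \<open>p\<^sub>i\<close>. So equality holds for
  every \<open>j\<close> as soon as \<open>p\<^sub>i > 0\<close>, and the remainder in Picone's inequality vanishes:
  \<open>\<nabla>u\<^sub>j = (u\<^sub>j / u\<^sub>i) \<nabla>u\<^sub>i\<close>. As \<open>\<nabla>u\<^sub>j / u\<^sub>j\<close> is locally square integrable, the bounded quotient
  \<open>u\<^sub>j / (u\<^sub>j + u\<^sub>i)\<close> has distributional gradient 0 and is constant on the connected set \<open>\<Omega>\<close>.
\<close>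

section \<open>Smooth functions\<close>

text \<open>The obstacle is low regularity: the components are weak solutions in \<open>H\<close>,
  positive only almost everywhere, with no lower bound on compact sets. So \<open>z^2 / u_i\<close>
  need not be an admissible test function. The denominator is therefore replaced by
  \<open>|v| + \<epsilon>\<close>, itself a limit of
  \<open>sqrt (\<psi>_k^2 + c_k) + \<epsilon>\<close> with test functions \<open>\<psi>_k\<close>,
  and the numerator is at first the square of a test function. Fatou's lemma removes the
  regularization: it keeps the remainder term and yields the integrability of \<open>f z^2\<close>
  instead of presupposing it. For the same reason \<open>u_j\<close> cannot simply be inserted into
  its own equation. The energy bound comes from testing with approximations of \<open>u_j\<close>
  and absorbing half of the energy by Picone's inequality; it is an inequality, opposite to the one
  that Picone's inequality gives for \<open>z = u_j\<close>. Both cases of \<open>H\<close> enter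
  through one property, approximability by test functions. On the whole space this is the density of
  test functions in \<open>H^1\<close>, proved by cutoff and mollification. Mollification serves
  again to show that a vanishing distributional gradient forces local constancy.\<close>

lemma frechet_derivative_eqI:
  "(f has_derivative f') (at x) \<Longrightarrow> frechet_derivative f (at x) = f'"
  using frechet_derivative_at by fastforce

text \<open>In the recursive definition the membership of \<open>f\<close> itself in the lower class
  is only implicit. It is needed wherever a product rule leaves one factor undifferentiated.\<close>

lemma C_class_Suc_subset: "C_class (Suc k) \<subseteq> C_class k"
proof (induction k)
  case 0
  show ?case
    by (auto intro!: continuous_at_imp_continuous_on differentiable_imp_continuous_within)
next
  case (Suc k)
  then show ?case by (auto simp del: C_class.simps(1))
qed

lemma C_class_const: "(\<lambda>x. c) \<in> C_class k"
  by (induction k arbitrary: c) (auto simp: frechet_derivative_const)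

lemma C_class_inner: "(\<lambda>x. x \<bullet> v) \<in> C_class k"
proof (cases k)
  case (Suc j)
  have "frechet_derivative (\<lambda>x. x \<bullet> v) (at y) = (\<lambda>h. h \<bullet> v)" for y :: 'a
    by (intro frechet_derivative_eqI) (auto intro!: derivative_eq_intros)
  with Suc show ?thesis by (auto simp: C_class_const)
qed (auto intro!: continuous_intros)

lemma C_class_add:
  "f \<in> C_class k \<Longrightarrow> g \<in> C_class k \<Longrightarrow> (\<lambda>x. f x + g x) \<in> C_class k"
proof (induction k arbitrary: f g)
  case (Suc k)
  have "frechet_derivative (\<lambda>x. f x + g x) (at x) =
      (\<lambda>h. frechet_derivative f (at x) h + frechet_derivative g (at x) h)" for x
    using Suc.prems
    by (intro frechet_derivative_eqI has_derivative_add) (auto simp: frechet_derivative_works)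
  with Suc show ?case by auto
qed (auto intro: continuous_on_add)

lemma C_class_mult:
  fixes f g :: "'a::euclidean_space \<Rightarrow> real"
  shows "f \<in> C_class k \<Longrightarrow> g \<in> C_class k \<Longrightarrow> (\<lambda>x. f x * g x) \<in> C_class k"
proof (induction k arbitrary: f g)
  case (Suc k)
  have "frechet_derivative (\<lambda>x. f x * g x) (at x) =
      (\<lambda>h. f x * frechet_derivative g (at x) h + frechet_derivative f (at x) h * g x)" for x
    using Suc.prems
    by (intro frechet_derivative_eqI has_derivative_mult) (auto simp: frechet_derivative_works)
  moreover have "f \<in> C_class k" "g \<in> C_class k"
    using Suc.prems C_class_Suc_subset by blast+
  ultimately show ?case
    using Suc by (auto intro!: C_class_add)
qed (auto intro: continuous_on_mult)

text \<open>The chain rule yields the product of \<open>h' \<circ> f\<close> and a derivative of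
  \<open>f\<close>. The first factor is again a composition, with \<open>h\<close> replaced by
  \<open>h'\<close>, so the induction has to generalize over both functions.\<close>

lemma C_class_comp:
  fixes h :: "real \<Rightarrow> real" and f :: "'a::euclidean_space \<Rightarrow> real"
  shows "h \<in> C_class k \<Longrightarrow> f \<in> C_class k \<Longrightarrow> (\<lambda>x. h (f x)) \<in> C_class k"
proof (induction k arbitrary: h f)
  case 0
  then show ?case
    using continuous_on_compose2[of UNIV h UNIV f] by simp
next
  case (Suc k)
  have "frechet_derivative (\<lambda>x. h (f x)) (at x) =
      (\<lambda>v. frechet_derivative h (at (f x)) 1 * frechet_derivative f (at x) v)" for x
  proof (rule frechet_derivative_eqI)
    have "((\<lambda>x. h (f x)) has_derivative
        (\<lambda>v. frechet_derivative h (at (f x)) (frechet_derivative f (at x) v))) (at x)"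
    proof -
      have "(f has_derivative frechet_derivative f (at x)) (at x)"
        using Suc.prems(2) by (simp add: frechet_derivative_works[symmetric])
      moreover have "(h has_derivative frechet_derivative h (at (f x))) (at (f x))"
        using Suc.prems(1) by (simp add: frechet_derivative_works[symmetric])
      ultimately show ?thesis by (rule has_derivative_compose)
    qed
    moreover have "frechet_derivative h (at (f x)) r = frechet_derivative h (at (f x)) 1 * r" for r
    proof -
      have "linear (frechet_derivative h (at (f x)))"
        using Suc.prems by (auto intro: linear_frechet_derivative)
      from linear_scale[OF this, of r 1] show ?thesis by simp
    qed
    then have "(\<lambda>v. frechet_derivative h (at (f x)) (frechet_derivative f (at x) v)) =
        (\<lambda>v. frechet_derivative h (at (f x)) 1 * frechet_derivative f (at x) v)"
      by (rule ext)
    ultimately show "((\<lambda>x. h (f x)) has_derivative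
        (\<lambda>v. frechet_derivative h (at (f x)) 1 * frechet_derivative f (at x) v)) (at x)"
      by (simp only:)
  qed
  \<comment> \<open>The only basis vector of the real line is 1, so the direction 1 gives the
    ordinary derivative of \<open>h\<close>.\<close>
  moreover have "(\<lambda>x. frechet_derivative h (at (f x)) 1) \<in> C_class k"
    using Suc.prems C_class_Suc_subset
    by (intro Suc.IH[of "\<lambda>y. frechet_derivative h (at y) 1" f]) (simp, blast)
  moreover have "\<And>x. (\<lambda>x. h (f x)) differentiable (at x)"
  proof -
    fix x show "(\<lambda>x. h (f x)) differentiable (at x)"
      using Suc.prems by (auto intro!: differentiable_chain_at[of f x h, unfolded o_def])
  qed
  ultimately show ?case
    using Suc.prems by (auto intro!: C_class_mult)
qed

text \<open>The derivative is written as a product containing \<open>inverse (f x)\<close> twice, so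
  the induction hypothesis for the reciprocal itself applies to it.\<close>

lemma C_class_inverse:
  fixes f :: "'a::euclidean_space \<Rightarrow> real"
  assumes "\<And>x. f x \<noteq> 0"
  shows "f \<in> C_class k \<Longrightarrow> (\<lambda>x. inverse (f x)) \<in> C_class k"
proof (induction k)
  case (Suc k)
  have *: "((\<lambda>x. inverse (f x)) has_derivative
      (\<lambda>h. - 1 * (inverse (f x) * frechet_derivative f (at x) h * inverse (f x)))) (at x)" for x
    using Suc.prems assms
    by (auto intro!: derivative_eq_intros simp: frechet_derivative_works)
  have "f \<in> C_class k"
    using Suc.prems C_class_Suc_subset by blast
  then have "(\<lambda>x. inverse (f x)) \<in> C_class k" by (rule Suc.IH)
  moreover have "frechet_derivative (\<lambda>x. inverse (f x)) (at x) =
      (\<lambda>h. - 1 * (inverse (f x) * frechet_derivative f (at x) h * inverse (f x)))" for x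
    by (rule frechet_derivative_eqI[OF *])
  moreover have "(\<lambda>x. inverse (f x)) differentiable (at x)" for x
    using * by (auto simp: differentiable_def)
  moreover have "(\<lambda>x. - 1 * (inverse (f x) * frechet_derivative f (at x) b * inverse (f x))) \<in> C_class k"
    if "b \<in> Basis" for b
    using Suc.prems that \<open>(\<lambda>x. inverse (f x)) \<in> C_class k\<close>
    by (intro C_class_mult C_class_const) auto
  ultimately show ?case
    by simp
qed (use assms in \<open>auto intro!: continuous_on_inverse\<close>)

lemma C_class_sqrt:
  fixes f :: "'a::euclidean_space \<Rightarrow> real"
  assumes "\<And>x. f x > 0"
  shows "f \<in> C_class k \<Longrightarrow> (\<lambda>x. sqrt (f x)) \<in> C_class k"
proof (induction k)
  case (Suc k)
  have *: "((\<lambda>x. sqrt (f x)) has_derivative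
      (\<lambda>h. frechet_derivative f (at x) h * (inverse (sqrt (f x)) * (1/2)))) (at x)" for x
    using Suc.prems assms
    by (auto intro!: derivative_eq_intros simp: frechet_derivative_works fun_eq_iff field_simps)
  have "f \<in> C_class k"
    using Suc.prems C_class_Suc_subset by blast
  then have "(\<lambda>x. sqrt (f x)) \<in> C_class k" by (rule Suc.IH)
  then have "(\<lambda>x. inverse (sqrt (f x))) \<in> C_class k"
    by (rule C_class_inverse[rotated]) (use assms in \<open>auto simp: less_imp_neq[symmetric]\<close>)
  moreover have "frechet_derivative (\<lambda>x. sqrt (f x)) (at x) =
      (\<lambda>h. frechet_derivative f (at x) h * (inverse (sqrt (f x)) * (1/2)))" for x
    by (rule frechet_derivative_eqI[OF *])
  moreover have "(\<lambda>x. sqrt (f x)) differentiable (at x)" for x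
    using * by (auto simp: differentiable_def)
  ultimately show ?case
    using Suc.prems by (auto intro!: C_class_mult C_class_const simp del: times_divide_eq_right times_divide_eq_left)
qed (use assms in \<open>auto intro!: continuous_on_real_sqrt\<close>)

definition smooth :: "('a::euclidean_space \<Rightarrow> real) \<Rightarrow> bool" where
  "smooth f \<longleftrightarrow> (\<forall>k. f \<in> C_class k)"

lemma smooth_const [intro]: "smooth (\<lambda>x. c)"
  and smooth_inner [intro]: "smooth (\<lambda>x. x \<bullet> v)"
  and smooth_add [intro]: "smooth f \<Longrightarrow> smooth g \<Longrightarrow> smooth (\<lambda>x. f x + g x)"
  and smooth_mult [intro]: "smooth f \<Longrightarrow> smooth g \<Longrightarrow> smooth (\<lambda>x. f x * g x)"
  and smooth_comp: "smooth h \<Longrightarrow> smooth f \<Longrightarrow> smooth (\<lambda>x. h (f x))"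
  and smooth_inverse: "smooth f \<Longrightarrow> (\<And>x. f x \<noteq> 0) \<Longrightarrow> smooth (\<lambda>x. inverse (f x))"
  and smooth_sqrt: "smooth f \<Longrightarrow> (\<And>x. f x > 0) \<Longrightarrow> smooth (\<lambda>x. sqrt (f x))"
  by (auto simp: smooth_def C_class_const C_class_inner C_class_add C_class_mult C_class_comp
      C_class_inverse C_class_sqrt)

lemma smooth_sum [intro]:
  "(\<And>i. i \<in> I \<Longrightarrow> smooth (f i)) \<Longrightarrow> smooth (\<lambda>x. \<Sum>i\<in>I. f i x)"
  by (induction I rule: infinite_finite_induct) auto

lemma smooth_differentiable: "smooth f \<Longrightarrow> f differentiable (at x)"
proof -
  assume "smooth f"
  then have "f \<in> C_class (Suc 0)" unfolding smooth_def by blast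
  then show ?thesis by simp
qed

lemma smooth_derivative: "smooth f \<Longrightarrow> b \<in> Basis \<Longrightarrow> smooth (\<lambda>x. frechet_derivative f (at x) b)"
  unfolding smooth_def
proof
  fix k assume "\<forall>k. f \<in> C_class k" "b \<in> Basis"
  then have "f \<in> C_class (Suc k)" by blast
  with \<open>b \<in> Basis\<close> show "(\<lambda>x. frechet_derivative f (at x) b) \<in> C_class k" by simp
qed

lemma smooth_continuous: "smooth f \<Longrightarrow> continuous_on UNIV f"
proof -
  assume "smooth f"
  then have "f \<in> C_class 0" unfolding smooth_def by blast
  then show ?thesis by simp
qed

lemma has_derivative_grad:
  fixes f :: "'a::euclidean_space \<Rightarrow> real"
  assumes "f differentiable (at x)"
  shows "(f has_derivative (\<lambda>h. grad f x \<bullet> h)) (at x)"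
proof -
  have f: "(f has_derivative frechet_derivative f (at x)) (at x)"
    using assms frechet_derivative_works by blast
  interpret linear "frechet_derivative f (at x)"
    using f by (rule has_derivative_linear)
  have "frechet_derivative f (at x) h = grad f x \<bullet> h" for h
  proof -
    have "frechet_derivative f (at x) h =
        frechet_derivative f (at x) (\<Sum>b\<in>Basis. (h \<bullet> b) *\<^sub>R b)"
      by (simp add: euclidean_representation)
    also have "\<dots> = grad f x \<bullet> h"
      by (simp only: sum scale grad_def inner_sum_left inner_scaleR_left real_scaleR_def)
         (simp add: inner_commute mult.commute)
    finally show ?thesis .
  qed
  then have "frechet_derivative f (at x) = (\<lambda>h. grad f x \<bullet> h)" by auto
  with f show ?thesis by simp
qed

lemma grad_eqI:
  fixes f :: "'a::euclidean_space \<Rightarrow> real"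
  assumes "(f has_derivative (\<lambda>h. g \<bullet> h)) (at x)"
  shows "grad f x = g"
  unfolding grad_def frechet_derivative_eqI[OF assms] by (simp add: euclidean_representation)

lemma smooth_has_derivative:
  "smooth f \<Longrightarrow> (f has_derivative (\<lambda>h. grad f x \<bullet> h)) (at x)"
  by (intro has_derivative_grad smooth_differentiable)

lemma smooth_grad_inner: "smooth f \<Longrightarrow> smooth (\<lambda>x. grad f x \<bullet> v)"
proof -
  assume f: "smooth f"
  have "(\<lambda>x. grad f x \<bullet> v) = (\<lambda>x. \<Sum>b\<in>Basis. frechet_derivative f (at x) b * (b \<bullet> v))"
    by (auto simp: grad_def inner_sum_left)
  then show ?thesis using smooth_derivative[OF f] by (simp add: smooth_sum smooth_mult smooth_const)
qed

lemma continuous_on_grad: "smooth f \<Longrightarrow> continuous_on A (grad f)"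
proof -
  assume f: "smooth f"
  have "continuous_on A (\<lambda>x. grad f x \<bullet> b)" for b
    using smooth_continuous[OF smooth_grad_inner[OF f]] continuous_on_subset by blast
  then show ?thesis
    by (subst continuous_on_componentwise) auto
qed

lemma grad_mult:
  "smooth f \<Longrightarrow> smooth g \<Longrightarrow> grad (\<lambda>x. f x * g x) x = f x *\<^sub>R grad g x + g x *\<^sub>R grad f x"
  by (rule grad_eqI)
     (auto intro!: derivative_eq_intros smooth_has_derivative simp: inner_add_left algebra_simps)

lemma grad_add:
  "smooth f \<Longrightarrow> smooth g \<Longrightarrow> grad (\<lambda>x. f x + g x) x = grad f x + grad g x"
  by (rule grad_eqI)
     (auto intro!: derivative_eq_intros smooth_has_derivative simp: inner_add_left algebra_simps)

lemma grad_const: "grad (\<lambda>x. c) x = 0"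
  by (rule grad_eqI) (auto intro!: derivative_eq_intros)

lemma grad_scale:
  "smooth f \<Longrightarrow> grad (\<lambda>x. c * f x) x = c *\<^sub>R grad f x"
  using grad_mult[of "\<lambda>x. c" f x] by (auto simp: grad_const)

text \<open>The functions \<open>p(1/t) exp(-1/t)\<close>, extended by 0 to \<open>t \<le> 0\<close>, are closed under differentiation.\<close>

definition exp_flat :: "real poly \<Rightarrow> real \<Rightarrow> real" where
  "exp_flat p t = (if t > 0 then poly p (1 / t) * exp (- (1 / t)) else 0)"

lemma poly_exp_tendsto_0: "((\<lambda>s. poly p s * exp (- s)) \<longlongrightarrow> (0::real)) at_top"
proof -
  have "((\<lambda>s. \<Sum>i\<le>degree p. coeff p i * (s ^ i / exp s)) \<longlongrightarrow> (\<Sum>i\<le>degree p. coeff p i * 0)) at_top"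
    by (intro tendsto_intros tendsto_power_div_exp_0)
  then show ?thesis
    by (simp add: poly_altdef sum_distrib_right exp_minus divide_inverse mult.assoc)
qed

lemma exp_flat_at_right_0: "((\<lambda>t. poly p (1 / t) * exp (- (1 / t))) \<longlongrightarrow> (0::real)) (at_right 0)"
  using filterlim_compose[OF poly_exp_tendsto_0[of p] filterlim_inverse_at_top_right]
  by (simp add: inverse_eq_divide)

text \<open>With \<open>s = 1 / t\<close>, the derivative of \<open>p(s) exp(-s)\<close> in
  \<open>t\<close> is \<open>s^2 (p(s) - p'(s)) exp(-s)\<close>; the factor \<open>s^2\<close> is
  the polynomial \<open>[:0, 0, 1:]\<close>. Only the origin requires a limit.\<close>

lemma exp_flat_DERIV:
  "(exp_flat p has_real_derivative exp_flat ([:0, 0, 1:] * (p - pderiv p)) t) (at t)"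
proof -
  consider "t > 0" | "t < 0" | "t = 0" by linarith
  then show ?thesis
  proof cases
    case 1
    have "((\<lambda>t. poly p (1 / t) * exp (- (1 / t))) has_real_derivative
        exp_flat ([:0, 0, 1:] * (p - pderiv p)) t) (at t)"
      using 1 by (auto intro!: derivative_eq_intros poly_DERIV[THEN DERIV_chain2]
          simp: exp_flat_def field_simps power2_eq_square)
    then show ?thesis
      by (rule has_field_derivative_transform_within_open[where S = "{0<..}"])
         (use 1 in \<open>auto simp: exp_flat_def\<close>)
  next
    case 2
    have "((\<lambda>t. 0) has_real_derivative exp_flat ([:0, 0, 1:] * (p - pderiv p)) t) (at t)"
      using 2 by (auto simp: exp_flat_def)
    then show ?thesis
      by (rule has_field_derivative_transform_within_open[where S = "{..<0}"])
         (use 2 in \<open>auto simp: exp_flat_def\<close>)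
  next
    case 3
    \<comment> \<open>Dividing by \<open>y\<close> multiplies the polynomial in \<open>1 / y\<close>
      by its variable, so the difference quotient is again a flat function.\<close>
    have "((\<lambda>y. exp_flat p y / y) \<longlongrightarrow> 0) (at_right 0)"
      using exp_flat_at_right_0[of "[:0, 1:] * p"]
      by (rule tendsto_cong[THEN iffD1, rotated])
         (auto simp: eventually_at_filter exp_flat_def)
    moreover have "((\<lambda>y. exp_flat p y / y) \<longlongrightarrow> 0) (at_left 0)"
      by (rule tendsto_eventually) (auto simp: eventually_at_filter exp_flat_def)
    ultimately have "((\<lambda>y. exp_flat p y / y) \<longlongrightarrow> 0) (at 0)"
      using filterlim_split_at by blast
    then show ?thesis
      using 3 by (simp add: has_field_derivative_iff exp_flat_def)
  qed
qed

lemma smooth_exp_flat: "smooth (exp_flat p)"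
proof -
  have "exp_flat p \<in> C_class k" for k
  proof (induction k arbitrary: p)
    case 0
    show ?case
      using DERIV_isCont[OF exp_flat_DERIV] by (simp add: continuous_at_imp_continuous_on)
  next
    case (Suc k)
    have *: "(exp_flat p has_derivative (\<lambda>h. exp_flat ([:0, 0, 1:] * (p - pderiv p)) t * h)) (at t)" for t
      using exp_flat_DERIV[of p t] by (simp add: has_field_derivative_def)
    then have "frechet_derivative (exp_flat p) (at t) = (\<lambda>h. exp_flat ([:0, 0, 1:] * (p - pderiv p)) t * h)" for t
      by (rule frechet_derivative_eqI)
    moreover have "exp_flat p differentiable (at t)" for t
      using * by (auto simp: differentiable_def)
    ultimately show ?case using Suc by (simp del: mult_pCons_left)
  qed
  then show ?thesis by (simp add: smooth_def)
qed

section \<open>Test functions\<close>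

abbreviation supp :: "('a::topological_space \<Rightarrow> real) \<Rightarrow> 'a set" where
  "supp \<phi> \<equiv> closure {x. \<phi> x \<noteq> 0}"

lemma test_functions_iff:
  "\<phi> \<in> test_functions \<Omega> \<longleftrightarrow> smooth \<phi> \<and> compact (supp \<phi>) \<and> supp \<phi> \<subseteq> \<Omega>"
  by (auto simp: test_functions_def smooth_def)

lemma test_smooth [dest]: "\<phi> \<in> test_functions \<Omega> \<Longrightarrow> smooth \<phi>"
  by (simp add: test_functions_iff)

lemma test_functionsI:
  assumes "smooth \<psi>" "compact K" "K \<subseteq> \<Omega>" "\<And>x. x \<notin> K \<Longrightarrow> \<psi> x = 0"
  shows "\<psi> \<in> test_functions \<Omega>"
proof -
  have "supp \<psi> \<subseteq> K"
    using assms by (intro closure_minimal) (auto simp: compact_imp_closed)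
  then show ?thesis
    using assms compact_Int_closed[of K "supp \<psi>"]
    by (auto simp: test_functions_iff Int_absorb1)
qed

lemma test_zero_outside: "x \<notin> supp \<phi> \<Longrightarrow> \<phi> x = 0"
  using closure_subset[of "{x. \<phi> x \<noteq> 0}"] by blast

lemma grad_zero_outside:
  fixes \<phi> :: "'a::euclidean_space \<Rightarrow> real"
  assumes "x \<notin> supp \<phi>"
  shows "grad \<phi> x = 0"
proof (rule grad_eqI)
  have "((\<lambda>_. 0) has_derivative (\<lambda>h. 0 \<bullet> h)) (at x)" by auto
  then show "(\<phi> has_derivative (\<lambda>h. 0 \<bullet> h)) (at x)"
  proof (rule has_derivative_transform_within_open[where s = "- supp \<phi>"])
    show "0 = \<phi> y" if "y \<in> - supp \<phi>" for y
      using that by (intro test_zero_outside[of y \<phi>, symmetric]) (rule ComplD)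
  qed (use assms in \<open>auto simp only: open_Compl closed_closure Compl_iff\<close>)
qed

lemma test_mult:
  assumes "\<phi> \<in> test_functions \<Omega>" "smooth \<psi>"
  shows "(\<lambda>x. \<phi> x * \<psi> x) \<in> test_functions \<Omega>"
proof (rule test_functionsI)
  show "\<phi> x * \<psi> x = 0" if "x \<notin> supp \<phi>" for x
    using test_zero_outside[OF that] by (rule ssubst) (rule mult_zero_left)
qed (use assms in \<open>auto simp only: test_functions_iff intro: smooth_mult\<close>)

lemma test_add:
  assumes "\<phi> \<in> test_functions \<Omega>" "\<psi> \<in> test_functions \<Omega>"
  shows "(\<lambda>x. \<phi> x + \<psi> x) \<in> test_functions \<Omega>"
proof (rule test_functionsI)
  show "\<phi> x + \<psi> x = 0" if "x \<notin> supp \<phi> \<union> supp \<psi>" for x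
  proof -
    have "\<phi> x = 0" "\<psi> x = 0" using that by (intro test_zero_outside; blast)+
    then show ?thesis by linarith
  qed
qed (use assms in \<open>auto simp only: test_functions_iff intro: smooth_add compact_Un\<close>)

lemma test_grad_inner:
  assumes "\<phi> \<in> test_functions \<Omega>"
  shows "(\<lambda>x. grad \<phi> x \<bullet> v) \<in> test_functions \<Omega>"
proof (rule test_functionsI)
  show "grad \<phi> x \<bullet> v = 0" if "x \<notin> supp \<phi>" for x
    using grad_zero_outside[OF that] by (rule ssubst) (rule inner_zero_left)
qed (use assms in \<open>auto simp only: test_functions_iff intro: smooth_grad_inner\<close>)

lemma test_mono: "\<Omega> \<subseteq> \<Omega>' \<Longrightarrow> \<phi> \<in> test_functions \<Omega> \<Longrightarrow> \<phi> \<in> test_functions \<Omega>'"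
  by (auto simp: test_functions_iff)

lemma bounded_of_compact_support:
  fixes h :: "'a::topological_space \<Rightarrow> 'b::real_normed_vector"
  assumes "continuous_on UNIV h" "compact K" "\<And>x. x \<notin> K \<Longrightarrow> h x = 0"
  obtains C where "C > 0" "\<And>x. norm (h x) \<le> C"
proof -
  have "bounded (h ` K)"
    using assms by (intro compact_imp_bounded compact_continuous_image) (auto intro: continuous_on_subset)
  then obtain C where C: "C > 0" "\<And>y. y \<in> h ` K \<Longrightarrow> norm y \<le> C"
    unfolding bounded_pos by blast
  then have "norm (h x) \<le> C" for x
    using assms(3)[of x] by (cases "x \<in> K") (auto intro: less_imp_le)
  with C show ?thesis using that by blast
qed

lemma test_bounded:
  assumes "\<phi> \<in> test_functions \<Omega>"
  obtains C where "C > 0" "\<And>x. \<bar>\<phi> x\<bar> \<le> C" "\<And>x. norm (grad \<phi> x) \<le> C"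
proof -
  have "smooth \<phi>" "compact (supp \<phi>)" using assms by (auto simp: test_functions_iff)
  from bounded_of_compact_support[OF smooth_continuous[OF this(1)] this(2) test_zero_outside[of _ \<phi>]]
  obtain C where C: "C > 0" "\<And>x. norm (\<phi> x) \<le> C" by blast
  from bounded_of_compact_support[OF continuous_on_grad[OF \<open>smooth \<phi>\<close>] \<open>compact (supp \<phi>)\<close> grad_zero_outside]
  obtain D where D: "D > 0" "\<And>x. norm (grad \<phi> x) \<le> D" by blast
  have "C \<le> max C D" "D \<le> max C D" by auto
  with C D show ?thesis
    by (intro that[of "max C D"]) (auto simp: less_max_iff_disj le_max_iff_disj)
qed

lemma test_Lipschitz:
  assumes "\<phi> \<in> test_functions \<Omega>"
  obtains L where "L > 0" "\<And>x y. \<bar>\<phi> x - \<phi> y\<bar> \<le> L * norm (x - y)"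
proof -
  obtain C where C: "C > 0" "\<And>x. norm (grad \<phi> x) \<le> C" using test_bounded[OF assms] by metis
  have "norm (\<phi> x - \<phi> y) \<le> C * norm (x - y)" for x y
  proof (rule differentiable_bound[of UNIV \<phi> "\<lambda>x h. grad \<phi> x \<bullet> h"])
    show "(\<phi> has_derivative (\<bullet>) (grad \<phi> x)) (at x within UNIV)" for x
      using assms by (auto intro!: smooth_has_derivative)
    show "onorm ((\<bullet>) (grad \<phi> x)) \<le> C" for x
      by (rule onorm_le) (metis C(2) mult_right_mono norm_ge_zero Cauchy_Schwarz_ineq2 order_trans real_norm_def)
  qed auto
  then show ?thesis using that C by auto
qed

text \<open>The bump is \<open>exp(-1 / (r^2 - |x|^2))\<close> inside the ball, divided by its
  integral. It is smooth as a flat function of a polynomial in the coordinates, and its integral is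
  positive because it is positive on a ball.\<close>

lemma bump_exists:
  fixes r :: real assumes "r > 0"
  obtains \<rho> :: "'a::euclidean_space \<Rightarrow> real" where "\<rho> \<in> test_functions UNIV"
    "\<And>x. \<rho> x \<ge> 0" "\<And>x. norm x \<ge> r \<Longrightarrow> \<rho> x = 0" "(LINT x|lborel. \<rho> x) = 1"
    "integrable lborel \<rho>"
proof -
  define \<sigma> :: "'a \<Rightarrow> real" where "\<sigma> x = exp_flat 1 (r\<^sup>2 - (norm x)\<^sup>2)" for x
  have eq: "r\<^sup>2 - (norm x)\<^sup>2 = r\<^sup>2 + (-1) * (\<Sum>b\<in>Basis. (x \<bullet> b) * (x \<bullet> b))" for x :: 'a
    by (simp add: power2_norm_eq_inner euclidean_inner[of x x])
  have sm: "smooth \<sigma>"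
    unfolding \<sigma>_def eq by (intro smooth_comp[OF smooth_exp_flat] smooth_add smooth_mult smooth_const smooth_sum smooth_inner)
  have nn: "\<sigma> x \<ge> 0" for x by (simp add: \<sigma>_def exp_flat_def)
  have z: "\<sigma> x = 0" if "norm x \<ge> r" for x
    using power_mono[of r "norm x" 2] that assms by (simp add: \<sigma>_def exp_flat_def not_less)
  have test: "\<sigma> \<in> test_functions UNIV"
    using z by (intro test_functionsI[OF sm, of "cball 0 r"]) auto
  have cont: "continuous_on UNIV \<sigma>" using sm by (rule smooth_continuous)
  have int: "integrable lborel \<sigma>"
  proof -
    have "integrable lborel (\<lambda>x. indicator (cball 0 r) x *\<^sub>R \<sigma> x)"
      using borel_integrable_compact[of "cball 0 r" \<sigma>] cont
      by (auto simp: set_integrable_def intro: continuous_on_subset)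
    also have "(\<lambda>x. indicator (cball 0 r) x *\<^sub>R \<sigma> x) = \<sigma>"
      using z by (auto simp: indicator_def fun_eq_iff)
    finally show ?thesis .
  qed
  have "(LINT x|lborel. \<sigma> x) \<noteq> 0"
  proof
    assume "(LINT x|lborel. \<sigma> x) = 0"
    then have "AE x in lborel. \<sigma> x = 0"
      using integral_nonneg_eq_0_iff_AE[OF int] nn by auto
    moreover have "\<sigma> x \<noteq> 0" if "x \<in> ball 0 r" for x
    proof -
      have "(norm x)\<^sup>2 < r\<^sup>2" using that assms by (intro power_strict_mono) auto
      then show ?thesis by (simp add: \<sigma>_def exp_flat_def)
    qed
    ultimately have "AE x in lborel. x \<notin> ball (0::'a) r" by (auto elim: AE_mp)
    then have "emeasure lborel (ball (0::'a) r) = 0"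
      by (subst (asm) AE_iff_measurable[of "ball 0 r"]) auto
    then show False using emeasure_ball[of r "0::'a"] assms content_ball_pos[of r "0::'a"]
      by (simp add: emeasure_lborel_ball_finite measure_def)
  qed
  moreover have "(LINT x|lborel. \<sigma> x) \<ge> 0" using nn by simp
  ultimately have pos: "(LINT x|lborel. \<sigma> x) > 0" by simp
  define c where "c = inverse (LINT x|lborel. \<sigma> x)"
  show ?thesis
  proof (rule that[of "\<lambda>x. \<sigma> x * c"])
    show "(\<lambda>x. \<sigma> x * c) \<in> test_functions UNIV" using test by (intro test_mult) auto
  qed (use nn z pos int in \<open>auto simp: c_def\<close>)
qed

section \<open>Mollification\<close>

lemma lborel_distr_reflect: "distr lborel borel (\<lambda>x. t - x) = (lborel :: 'a::euclidean_space measure)"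
proof -
  have "(\<lambda>x. t + (-1) *\<^sub>R x) = (\<lambda>x. t - x :: 'a)" by (simp add: fun_eq_iff)
  then show ?thesis
    using lborel_affine[of "-1" t] by (simp add: density_1)
qed

lemma integrable_translate:
  fixes f :: "'a::euclidean_space \<Rightarrow> real"
  assumes "integrable lborel f"
  shows "integrable lborel (\<lambda>x. f (x - y))" "(LINT x|lborel. f (x - y)) = (LINT x|lborel. f x)"
proof -
  have f [measurable]: "f \<in> borel_measurable borel" using assms by (auto dest: borel_measurable_integrable)
  show "integrable lborel (\<lambda>x. f (x - y))"
    using integrable_distr_eq[of "(+) (- y)" lborel borel f] assms lborel_distr_plus[of "- y"] by simp
  show "(LINT x|lborel. f (x - y)) = (LINT x|lborel. f x)"
    using integral_distr[of "(+) (- y)" lborel borel f] lborel_distr_plus[of "- y"] by simp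
qed

lemma integral_reflect:
  fixes f :: "'a::euclidean_space \<Rightarrow> real"
  assumes [measurable]: "f \<in> borel_measurable borel"
  shows "(LINT x|lborel. f (t - x)) = (LINT x|lborel. f x)"
    and "integrable lborel (\<lambda>x. f (t - x)) \<longleftrightarrow> integrable lborel f"
  using integral_distr[of "\<lambda>x. t - x" lborel borel f] lborel_distr_reflect[of t]
    integrable_distr_eq[of "\<lambda>x. t - x" lborel borel f] by simp_all

text \<open>Translation is an isometry of \<open>L^1\<close>, so replacing \<open>f\<close> by
  \<open>g\<close> costs the distance of the two functions twice. With a quarter of \<open>e\<close>
  for each term, continuity passes to functions approximable by good ones.\<close>

lemma L1_translation_approx:
  fixes f :: "'a::euclidean_space \<Rightarrow> real" and y :: "nat \<Rightarrow> 'a"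
  assumes f: "integrable lborel f"
    and approx: "\<And>e. e > 0 \<Longrightarrow> \<exists>g. integrable lborel g \<and> (LINT x|lborel. \<bar>f x - g x\<bar>) < e \<and>
      (\<lambda>n. LINT x|lborel. \<bar>g (x - y n) - g x\<bar>) \<longlonglongrightarrow> 0"
  shows "(\<lambda>n. LINT x|lborel. \<bar>f (x - y n) - f x\<bar>) \<longlonglongrightarrow> 0"
proof (rule tendstoI)
  fix e :: real assume "e > 0"
  then obtain g where g: "integrable lborel g" "(LINT x|lborel. \<bar>f x - g x\<bar>) < e / 4"
    "(\<lambda>n. LINT x|lborel. \<bar>g (x - y n) - g x\<bar>) \<longlonglongrightarrow> 0"
    using approx[of "e / 4"] by auto
  have le: "(LINT x|lborel. \<bar>f (x - y n) - f x\<bar>) \<le>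
      (LINT x|lborel. \<bar>g (x - y n) - g x\<bar>) + 2 * (LINT x|lborel. \<bar>f x - g x\<bar>)" for n
  proof -
    have d: "integrable lborel (\<lambda>x. \<bar>f x - g x\<bar>)" using f g by auto
    note i = integrable_translate[OF f, of "y n"] integrable_translate[OF g(1), of "y n"]
      integrable_translate[OF d, of "y n"]
    have "(LINT x|lborel. \<bar>f (x - y n) - f x\<bar>) \<le>
        (LINT x|lborel. \<bar>g (x - y n) - g x\<bar> + (\<bar>f (x - y n) - g (x - y n)\<bar> + \<bar>f x - g x\<bar>))"
      using i f g d by (intro integral_mono) auto
    also have "\<dots> = (LINT x|lborel. \<bar>g (x - y n) - g x\<bar>) + 2 * (LINT x|lborel. \<bar>f x - g x\<bar>)"
      using i f g d by simp
    finally show ?thesis .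
  qed
  have "\<forall>\<^sub>F n in sequentially. (LINT x|lborel. \<bar>g (x - y n) - g x\<bar>) < e / 4"
    using order_tendstoD(2)[OF g(3), of "e / 4"] \<open>e > 0\<close> by simp
  then show "\<forall>\<^sub>F n in sequentially. dist (LINT x|lborel. \<bar>f (x - y n) - f x\<bar>) 0 < e"
  proof eventually_elim
    case (elim n)
    have "(LINT x|lborel. \<bar>f (x - y n) - f x\<bar>) \<ge> 0" by simp
    then show ?case using le[of n] elim g(2) \<open>e > 0\<close> by (simp add: dist_real_def)
  qed
qed

text \<open>The absolute difference of two indicators is their sum minus twice their product, so
  only the product has to converge. Openness gives this pointwise: for \<open>x\<close> in
  \<open>U\<close> the shifted point is eventually in \<open>U\<close>, and off \<open>U\<close> the
  product is 0.\<close>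

lemma L1_translation_open:
  fixes y :: "nat \<Rightarrow> 'a::euclidean_space" and c :: real
  assumes U: "open U" "emeasure lborel U < \<infinity>" and y: "y \<longlonglongrightarrow> 0"
  shows "(\<lambda>n. LINT x|lborel. \<bar>indicator U (x - y n) * c - indicator U x * c\<bar>) \<longlonglongrightarrow> 0"
proof -
  have [measurable]: "U \<in> sets borel" using U by auto
  let ?f = "\<lambda>n x. indicator U x * indicator U (x - y n) :: real"
  have int: "integrable lborel (indicator U :: 'a \<Rightarrow> real)"
    using U by (intro integrable_real_indicator) auto
  note int' = integrable_translate[OF int]
  have intf: "integrable lborel (?f n)" for n
    by (rule Bochner_Integration.integrable_bound[OF int]) (auto simp: indicator_def)
  have "(\<lambda>n. LINT x|lborel. ?f n x) \<longlonglongrightarrow> (LINT x|lborel. indicator U x)"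
  proof (rule integral_dominated_convergence[where w = "indicator U"])
    show "AE x in lborel. (\<lambda>n. ?f n x) \<longlonglongrightarrow> indicator U x"
    proof (rule AE_I2)
      fix x
      show "(\<lambda>n. ?f n x) \<longlonglongrightarrow> indicator U x"
      proof (cases "x \<in> U")
        case True
        have "(\<lambda>n. x - y n) \<longlonglongrightarrow> x - 0" by (intro tendsto_intros y)
        then have "\<forall>\<^sub>F n in sequentially. x - y n \<in> U"
          using topological_tendstoD[of "\<lambda>n. x - y n" x sequentially U] True U by simp
        then have "\<forall>\<^sub>F n in sequentially. ?f n x = indicator U x"
          by eventually_elim (use True in auto)
        then show ?thesis by (rule tendsto_eventually)
      qed auto
    qed
  qed (use int in \<open>auto simp: indicator_def\<close>)
  then have "(\<lambda>n. \<bar>c\<bar> * (2 * (LINT x|lborel. indicator U x) - 2 * (LINT x|lborel. ?f n x))) \<longlonglongrightarrow>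
      \<bar>c\<bar> * (2 * (LINT x|lborel. indicator U x) - 2 * (LINT x|lborel. indicator U x))"
    by (intro tendsto_intros)
  moreover have "(LINT x|lborel. \<bar>indicator U (x - y n) * c - indicator U x * c\<bar>) =
      \<bar>c\<bar> * (2 * (LINT x|lborel. indicator U x) - 2 * (LINT x|lborel. ?f n x))" for n
  proof -
    have "(LINT x|lborel. \<bar>indicator U (x - y n) * c - indicator U x * c\<bar>) =
        (LINT x|lborel. \<bar>c\<bar> * (indicator U (x - y n) + indicator U x - 2 * ?f n x))"
      by (intro Bochner_Integration.integral_cong) (auto simp: indicator_def)
    also have "\<dots> = \<bar>c\<bar> * (2 * (LINT x|lborel. indicator U x) - 2 * (LINT x|lborel. ?f n x))"
      using int int' intf by simp
    finally show ?thesis .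
  qed
  ultimately show ?thesis by simp
qed

text \<open>Induction over integrable functions. For an indicator, outer regularity supplies an open
  set that is close in measure; sums use the triangle inequality, limits the dominated convergence
  theorem.\<close>

lemma L1_translation_continuous:
  fixes f :: "'a::euclidean_space \<Rightarrow> real"
  assumes "integrable lborel f" and y: "y \<longlonglongrightarrow> 0"
  shows "(\<lambda>n. LINT x|lborel. \<bar>f (x - y n) - f x\<bar>) \<longlonglongrightarrow> 0"
  using assms(1)
proof (induction rule: integrable_induct)
  case (base A c)
  have [measurable]: "A \<in> sets borel" using base by simp
  have intA: "integrable lborel (indicator A :: 'a \<Rightarrow> real)"
    using base by (intro integrable_real_indicator) auto
  show ?case
  proof (rule L1_translation_approx)
    show "integrable lborel (\<lambda>x. indicator A x *\<^sub>R c)" using intA by simp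
  next
    fix e :: real assume "e > 0"
    \<comment> \<open>The summand 1 in the denominator covers \<open>c = 0\<close> and makes
      \<open>e' * \<bar>c\<bar> < e\<close> strict.\<close>
    define e' where "e' = e / (\<bar>c\<bar> + 1)"
    have e': "e' > 0" "e' * \<bar>c\<bar> < e" using \<open>e > 0\<close> by (auto simp: e'_def field_simps)
    have "A \<in> sets lebesgue" using base by simp
    from sets_lebesgue_outer_open[OF this e'(1)]
    obtain U where U: "open U" "A \<subseteq> U" "U - A \<in> lmeasurable" "emeasure lebesgue (U - A) < ennreal e'" .
    have [measurable]: "U \<in> sets borel" using U by auto
    have UA: "emeasure lborel (U - A) < ennreal e'" using U(4) by simp
    have finUA: "emeasure lborel (U - A) < \<infinity>" using UA by (auto simp: less_top[symmetric])
    have "emeasure lborel U \<le> emeasure lborel A + emeasure lborel (U - A)"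
      by (rule order_trans[OF _ emeasure_subadditive]) (auto intro!: emeasure_mono)
    also have "\<dots> < \<infinity>" using base finUA by (auto simp: less_top[symmetric])
    finally have finU: "emeasure lborel U < \<infinity>" .
    have "(LINT x|lborel. \<bar>indicator A x *\<^sub>R c - indicator U x * c\<bar>) =
        (LINT x|lborel. indicator (U - A) x * \<bar>c\<bar>)"
      using U by (intro Bochner_Integration.integral_cong) (auto simp: indicator_def)
    also have "\<dots> = measure lborel (U - A) * \<bar>c\<bar>" by simp
    also have "\<dots> \<le> e' * \<bar>c\<bar>"
      using UA e' by (intro mult_right_mono) (auto simp: measure_def intro: enn2real_leI less_imp_le)
    also have "\<dots> < e" by (rule e')
    finally show "\<exists>g. integrable lborel g \<and> (LINT x|lborel. \<bar>indicator A x *\<^sub>R c - g x\<bar>) < e \<and>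
        (\<lambda>n. LINT x|lborel. \<bar>g (x - y n) - g x\<bar>) \<longlonglongrightarrow> 0"
      using L1_translation_open[OF U(1) finU y, of c] finU
      by (intro exI[of _ "\<lambda>x. indicator U x * c"]) auto
  qed
next
  case (add f g)
  have "(\<lambda>n. (LINT x|lborel. \<bar>f (x - y n) - f x\<bar>) + (LINT x|lborel. \<bar>g (x - y n) - g x\<bar>)) \<longlonglongrightarrow> 0"
    using tendsto_add[OF add.IH] by simp
  then show ?case
  proof (rule real_tendsto_sandwich[OF _ _ tendsto_const, rotated 2])
    show "\<forall>\<^sub>F n in sequentially. (LINT x|lborel. \<bar>f (x - y n) + g (x - y n) - (f x + g x)\<bar>) \<le>
        (LINT x|lborel. \<bar>f (x - y n) - f x\<bar>) + (LINT x|lborel. \<bar>g (x - y n) - g x\<bar>)"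
    proof (rule always_eventually, rule allI)
      fix n
      note i = add.hyps integrable_translate(1)[OF add.hyps(1), of "y n"]
        integrable_translate(1)[OF add.hyps(2), of "y n"]
      have "(LINT x|lborel. \<bar>f (x - y n) + g (x - y n) - (f x + g x)\<bar>) \<le>
        (LINT x|lborel. \<bar>f (x - y n) - f x\<bar> + \<bar>g (x - y n) - g x\<bar>)"
        using i by (intro integral_mono) auto
      then show "(LINT x|lborel. \<bar>f (x - y n) + g (x - y n) - (f x + g x)\<bar>) \<le>
        (LINT x|lborel. \<bar>f (x - y n) - f x\<bar>) + (LINT x|lborel. \<bar>g (x - y n) - g x\<bar>)"
        using i by simp
    qed
  qed auto
next
  case (lim f s)
  have "(\<lambda>i. LINT x|lborel. \<bar>f x - s i x\<bar>) \<longlonglongrightarrow> (LINT x|(lborel :: 'a measure). 0)"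
  proof (rule integral_dominated_convergence[where w = "\<lambda>x. 3 * \<bar>f x\<bar>"])
    show "AE x in lborel. (\<lambda>i. \<bar>f x - s i x\<bar>) \<longlonglongrightarrow> 0"
    proof (rule AE_I2)
      fix x :: 'a
      have "(\<lambda>i. \<bar>f x - s i x\<bar>) \<longlonglongrightarrow> \<bar>f x - f x\<bar>"
        using lim.hyps(2)[of x] by (intro tendsto_intros) auto
      then show "(\<lambda>i. \<bar>f x - s i x\<bar>) \<longlonglongrightarrow> 0" by simp
    qed
    \<comment> \<open>The approximants of the induction rule satisfy
      \<open>\<bar>s i x\<bar> \<le> 2 * \<bar>f x\<bar>\<close>, whence the factor 3.\<close>
    show "AE x in lborel. norm \<bar>f x - s i x\<bar> \<le> 3 * \<bar>f x\<bar>" for i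
    proof (rule AE_I2)
      fix x :: 'a
      show "norm \<bar>f x - s i x\<bar> \<le> 3 * \<bar>f x\<bar>"
        using lim.hyps(3)[of x i] by (simp add: abs_if split: if_splits)
    qed
  qed (use lim.hyps in auto)
  then have *: "(\<lambda>i. LINT x|lborel. \<bar>f x - s i x\<bar>) \<longlonglongrightarrow> 0" by simp
  show ?case
  proof (rule L1_translation_approx[OF lim.hyps(4)])
    fix e :: real assume "e > 0"
    from order_tendstoD(2)[OF * this]
    obtain i where "(LINT x|lborel. \<bar>f x - s i x\<bar>) < e"
      by (auto simp: eventually_sequentially)
    then show "\<exists>g. integrable lborel g \<and> (LINT x|lborel. \<bar>f x - g x\<bar>) < e \<and>
        (\<lambda>n. LINT x|lborel. \<bar>g (x - y n) - g x\<bar>) \<longlonglongrightarrow> 0"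
      using lim.hyps(1) lim.IH by blast
  qed
qed

text \<open>Truncate \<open>u\<close> in size and in space. The truncation is integrable and bounded
  by \<open>m\<close>, so the square of its translation error is at most \<open>2 m\<close> times
  the error itself, and the \<open>L^1\<close> result applies.\<close>

lemma L2_translation_continuous:
  fixes u :: "'a::euclidean_space \<Rightarrow> real"
  assumes [measurable]: "u \<in> borel_measurable borel" and u2: "integrable lborel (\<lambda>x. (u x)\<^sup>2)"
    and y: "y \<longlonglongrightarrow> 0"
  shows "(\<lambda>n. LINT x|lborel. (u (x - y n) - u x)\<^sup>2) \<longlonglongrightarrow> 0"
proof (rule tendstoI)
  fix e :: real assume "e > 0"
  define t where "t m x = (if \<bar>u x\<bar> \<le> real m \<and> norm x \<le> real m then u x else 0)" for m x
  have tm [measurable]: "t m \<in> borel_measurable borel" for m unfolding t_def by measurable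
  have tle: "\<bar>t m x\<bar> \<le> \<bar>u x\<bar>" "\<bar>t m x\<bar> \<le> real m" for m x by (auto simp: t_def)
  have ut: "(u x - t m x)\<^sup>2 \<le> (u x)\<^sup>2" for m x by (auto simp: t_def)
  have intd: "integrable lborel (\<lambda>x. (u x - t m x)\<^sup>2)" for m
    by (rule Bochner_Integration.integrable_bound[OF u2]) (use ut in auto)
  have intt: "integrable lborel (t m)" for m
  proof (rule Bochner_Integration.integrable_bound)
    show "integrable lborel (\<lambda>x. real m * indicator (cball (0::'a) (real m)) x)"
      using emeasure_lborel_cball_finite[of "0::'a" "real m"]
      by (intro integrable_mult_right integrable_real_indicator) (auto simp: less_top)
  qed (auto simp: t_def indicator_def)
  have "(\<lambda>m. LINT x|lborel. (u x - t m x)\<^sup>2) \<longlonglongrightarrow> (LINT x|(lborel :: 'a measure). 0)"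
  proof (rule integral_dominated_convergence[where w = "\<lambda>x. (u x)\<^sup>2"])
    show "AE x in lborel. (\<lambda>m. (u x - t m x)\<^sup>2) \<longlonglongrightarrow> 0"
    proof (rule AE_I2, rule tendsto_eventually)
      fix x :: 'a
      have "\<forall>\<^sub>F m in sequentially. max \<bar>u x\<bar> (norm x) \<le> real m"
        by (rule eventually_sequentiallyI[of "nat \<lceil>max \<bar>u x\<bar> (norm x)\<rceil>"]) linarith
      then show "\<forall>\<^sub>F m in sequentially. (u x - t m x)\<^sup>2 = 0"
        by eventually_elim (auto simp: t_def)
    qed
  qed (use ut u2 in auto)
  then have "(\<lambda>m. LINT x|lborel. (u x - t m x)\<^sup>2) \<longlonglongrightarrow> 0" by simp
  \<comment> \<open>The estimate below counts the truncation error 6 times: a factor 3 from the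
    square of three summands, and 2 from the translated and untranslated copies. This uses up half
    of \<open>e\<close>.\<close>
  from order_tendstoD(2)[OF this, of "e / 12"] \<open>e > 0\<close>
  obtain m where m: "(LINT x|lborel. (u x - t m x)\<^sup>2) < e / 12"
    by (auto simp: eventually_sequentially)
  have le: "(LINT x|lborel. (u (x - y n) - u x)\<^sup>2) \<le>
      6 * (LINT x|lborel. (u x - t m x)\<^sup>2) + 6 * real m * (LINT x|lborel. \<bar>t m (x - y n) - t m x\<bar>)" for n
  proof -
    note i = integrable_translate[OF intd[of m], of "y n"] integrable_translate[OF intt[of m], of "y n"] intd[of m] intt[of m]
    have "(u (x - y n) - u x)\<^sup>2 \<le> 3 * ((u (x - y n) - t m (x - y n))\<^sup>2 + (u x - t m x)\<^sup>2)
        + 6 * real m * \<bar>t m (x - y n) - t m x\<bar>" for x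
    proof -
      define a where "a = u (x - y n) - t m (x - y n)"
      define b where "b = u x - t m x"
      define c where "c = t m (x - y n) - t m x"
      have "(a - b + c)\<^sup>2 \<le> 3 * (a\<^sup>2 + b\<^sup>2) + 3 * c\<^sup>2"
        using zero_le_power2[of "a + b"] zero_le_power2[of "a - c"] zero_le_power2[of "b + c"]
        by (simp add: power2_eq_square algebra_simps)
      moreover have "c\<^sup>2 \<le> (2 * real m) * \<bar>c\<bar>"
      proof -
        have "\<bar>c\<bar> \<le> 2 * real m" using tle(2)[of m x] tle(2)[of m "x - y n"] by (simp add: c_def)
        then have "\<bar>c\<bar> * \<bar>c\<bar> \<le> 2 * real m * \<bar>c\<bar>" by (intro mult_right_mono) auto
        then show ?thesis by (simp add: power2_eq_square)
      qed
      moreover have "u (x - y n) - u x = a - b + c" by (simp add: a_def b_def c_def)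
      ultimately show ?thesis by (simp add: a_def[symmetric] b_def[symmetric] c_def[symmetric])
    qed
    then have "(LINT x|lborel. (u (x - y n) - u x)\<^sup>2) \<le> (LINT x|lborel. 3 * ((u (x - y n) - t m (x - y n))\<^sup>2 + (u x - t m x)\<^sup>2)
        + 6 * real m * \<bar>t m (x - y n) - t m x\<bar>)"
      using i by (intro integral_mono') auto
    also have "\<dots> = 6 * (LINT x|lborel. (u x - t m x)\<^sup>2) + 6 * real m * (LINT x|lborel. \<bar>t m (x - y n) - t m x\<bar>)"
      using i by simp
    finally show ?thesis .
  qed
  have "(\<lambda>n. 6 * real m * (LINT x|lborel. \<bar>t m (x - y n) - t m x\<bar>)) \<longlonglongrightarrow> 6 * real m * 0"
    by (intro tendsto_intros L1_translation_continuous[OF intt y])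
  then have "(\<lambda>n. 6 * real m * (LINT x|lborel. \<bar>t m (x - y n) - t m x\<bar>)) \<longlonglongrightarrow> 0" by simp
  from order_tendstoD(2)[OF this, of "e / 2"] \<open>e > 0\<close>
  have "\<forall>\<^sub>F n in sequentially. 6 * real m * (LINT x|lborel. \<bar>t m (x - y n) - t m x\<bar>) < e / 2" by simp
  then show "\<forall>\<^sub>F n in sequentially. dist (LINT x|lborel. (u (x - y n) - u x)\<^sup>2) 0 < e"
  proof eventually_elim
    case (elim n)
    have "(LINT x|lborel. (u (x - y n) - u x)\<^sup>2) \<ge> 0" by simp
    then show ?case using le[of n] elim m \<open>e > 0\<close> by (simp add: dist_real_def)
  qed
qed

text \<open>A mollifier averages over all small shifts at once, so the sequential statement is
  turned into one uniform in the shift.\<close>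

lemma L2_translation_uniform:
  fixes u :: "'a::euclidean_space \<Rightarrow> real"
  assumes [measurable]: "u \<in> borel_measurable borel" and u2: "integrable lborel (\<lambda>x. (u x)\<^sup>2)"
    and "e > 0"
  obtains d where "d > 0" "\<And>y. norm y < d \<Longrightarrow> (LINT x|lborel. (u (x - y) - u x)\<^sup>2) < e"
proof (rule ccontr)
  assume "\<not> thesis"
  then have "\<exists>y. norm y < inverse (real (Suc n)) \<and> \<not> (LINT x|lborel. (u (x - y) - u x)\<^sup>2) < e" for n
    using that[of "inverse (real (Suc n))"] by fastforce
  then obtain y where y: "\<And>n. norm (y n) < inverse (real (Suc n))"
      "\<And>n. \<not> (LINT x|lborel. (u (x - y n) - u x)\<^sup>2) < e" by metis
  have "y \<longlonglongrightarrow> 0"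
    using y(1) by (intro Lim_null_comparison[OF _ LIMSEQ_inverse_real_of_nat] always_eventually) (auto intro: less_imp_le)
  from L2_translation_continuous[OF assms(1) u2 this]
  have "\<forall>\<^sub>F n in sequentially. (LINT x|lborel. (u (x - y n) - u x)\<^sup>2) < e"
    using \<open>e > 0\<close> by (rule order_tendstoD(2))
  with y(2) show False by simp
qed

section \<open>Convolution with a test function\<close>

definition conv :: "('a::euclidean_space \<Rightarrow> real) \<Rightarrow> ('a \<Rightarrow> real) \<Rightarrow> 'a \<Rightarrow> real" where
  "conv u \<rho> x = (LINT y|lborel. u y * \<rho> (x - y))"

lemma test_measurable [measurable_dest]:
  "\<phi> \<in> test_functions \<Omega> \<Longrightarrow> \<phi> \<in> borel_measurable borel"
  by (auto intro!: borel_measurable_continuous_onI smooth_continuous)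

lemma integrable_mult_bounded:
  fixes f h :: "'a \<Rightarrow> real"
  assumes "integrable M f" "h \<in> borel_measurable M" "\<And>x. \<bar>h x\<bar> \<le> C"
  shows "integrable M (\<lambda>x. f x * h x)"
proof (rule Bochner_Integration.integrable_bound)
  show "integrable M (\<lambda>x. C * f x)" using assms by simp
  have "C \<ge> 0" using assms(3)[of undefined] by simp
  then show "AE x in M. norm (f x * h x) \<le> norm (C * f x)"
    using assms(3) by (auto simp: abs_mult mult.commute[of C] intro!: mult_left_mono)
qed (use assms in auto)

lemma conv_integrable:
  assumes "integrable lborel u" "\<rho> \<in> test_functions UNIV"
  shows "integrable lborel (\<lambda>y. u y * \<rho> (x - y))"
proof -
  obtain C where "\<And>x. \<bar>\<rho> x\<bar> \<le> C" using test_bounded[OF assms(2)] by metis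
  moreover have [measurable]: "\<rho> \<in> borel_measurable borel" using assms by measurable
  ultimately show ?thesis using assms(1) by (intro integrable_mult_bounded[where C = C]) auto
qed

text \<open>The mean value inequality is applied to \<open>\<phi>\<close> minus its linear part at
  \<open>x\<close> on the ball of radius \<open>norm h\<close>, where the gradient deviates by at
  most \<open>K * norm h\<close>. The constant does not depend on \<open>x\<close>, which is what
  differentiation under the integral needs.\<close>

lemma test_Taylor:
  fixes \<phi> :: "'a::euclidean_space \<Rightarrow> real"
  assumes "\<phi> \<in> test_functions \<Omega>"
  obtains L where "L > 0" "\<And>x h. \<bar>\<phi> (x + h) - \<phi> x - grad \<phi> x \<bullet> h\<bar> \<le> L * (norm h)\<^sup>2"
proof -
  have "\<exists>L>0. \<forall>x y. \<bar>grad \<phi> x \<bullet> b - grad \<phi> y \<bullet> b\<bar> \<le> L * norm (x - y)" for b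
    using test_Lipschitz[OF test_grad_inner[OF assms, of b]] by metis
  then obtain L where L: "\<And>b. L b > 0" "\<And>b x y. \<bar>grad \<phi> x \<bullet> b - grad \<phi> y \<bullet> b\<bar> \<le> L b * norm (x - y)"
    by metis
  define K where "K = (\<Sum>b\<in>(Basis::'a set). L b)"
  have K: "norm (grad \<phi> x - grad \<phi> y) \<le> K * norm (x - y)" for x y
    unfolding K_def sum_distrib_right using L
    by (intro order_trans[OF norm_le_l1] sum_mono) (auto simp: inner_diff_left)
  have "K > 0" unfolding K_def using L by (intro sum_pos) auto
  moreover have "\<bar>\<phi> (x + h) - \<phi> x - grad \<phi> x \<bullet> h\<bar> \<le> K * (norm h)\<^sup>2" for x h
  proof -
    have "norm ((\<phi> (x + h) - grad \<phi> x \<bullet> (x + h)) - (\<phi> x - grad \<phi> x \<bullet> x)) \<le> (K * norm h) * norm ((x + h) - x)"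
    proof (rule differentiable_bound[of "cball x (norm h)" "\<lambda>y. \<phi> y - grad \<phi> x \<bullet> y" "\<lambda>y k. (grad \<phi> y - grad \<phi> x) \<bullet> k"])
      fix y assume y: "y \<in> cball x (norm h)"
      show "((\<lambda>y. \<phi> y - grad \<phi> x \<bullet> y) has_derivative (\<lambda>k. (grad \<phi> y - grad \<phi> x) \<bullet> k)) (at y within cball x (norm h))"
        using has_derivative_at_withinI[OF smooth_has_derivative[OF test_smooth[OF assms], of y]]
        by (auto intro!: derivative_eq_intros simp: inner_diff_left)
      have "norm (grad \<phi> y - grad \<phi> x) \<le> K * norm h"
        using K[of y x] y \<open>K > 0\<close>
        by (intro order_trans[OF K[of y x]] mult_left_mono) (auto simp: dist_norm norm_minus_commute)
      then show "onorm (\<lambda>k. (grad \<phi> y - grad \<phi> x) \<bullet> k) \<le> K * norm h"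
        by (intro onorm_le) (metis Cauchy_Schwarz_ineq2 mult_right_mono norm_ge_zero order_trans real_norm_def)
    qed (auto simp: dist_norm)
    then show ?thesis by (simp add: inner_add_right power2_eq_square algebra_simps)
  qed
  ultimately show ?thesis by (rule that)
qed

text \<open>The Taylor remainder of \<open>\<rho>\<close> is quadratic uniformly in the base point,
  so integrating it against \<open>\<bar>u\<bar>\<close> leaves a remainder of size
  \<open>N * L * (norm h)^2\<close>.\<close>

lemma conv_has_derivative:
  fixes u :: "'a::euclidean_space \<Rightarrow> real"
  assumes u: "integrable lborel u" and \<rho>: "\<rho> \<in> test_functions UNIV"
  shows "(conv u \<rho> has_derivative (\<lambda>h. conv u (\<lambda>z. grad \<rho> z \<bullet> h) x)) (at x)"
proof -
  note i1 = conv_integrable[OF u \<rho>] and i2 = conv_integrable[OF u test_grad_inner[OF \<rho>]]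
  have lin: "linear (\<lambda>h. conv u (\<lambda>z. grad \<rho> z \<bullet> h) x)"
  proof (rule linearI)
    show "conv u (\<lambda>z. grad \<rho> z \<bullet> (v + w)) x = conv u (\<lambda>z. grad \<rho> z \<bullet> v) x + conv u (\<lambda>z. grad \<rho> z \<bullet> w) x" for v w
      unfolding conv_def inner_add_right distrib_left by (rule Bochner_Integration.integral_add[OF i2 i2])
    show "conv u (\<lambda>z. grad \<rho> z \<bullet> (c *\<^sub>R v)) x = c *\<^sub>R conv u (\<lambda>z. grad \<rho> z \<bullet> v) x" for c v
      unfolding conv_def inner_scaleR_right by (simp add: mult.left_commute[of _ c])
  qed
  obtain L where L: "L > 0" "\<And>x h. \<bar>\<rho> (x + h) - \<rho> x - grad \<rho> x \<bullet> h\<bar> \<le> L * (norm h)\<^sup>2"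
    using test_Taylor[OF \<rho>] by metis
  define N where "N = (LINT y|lborel. \<bar>u y\<bar>)"
  have "N \<ge> 0" by (simp add: N_def)
  have rem: "\<bar>conv u \<rho> (x + h) - conv u \<rho> x - conv u (\<lambda>z. grad \<rho> z \<bullet> h) x\<bar> \<le> N * L * (norm h)\<^sup>2" for h
  proof -
    have "conv u \<rho> (x + h) - conv u \<rho> x - conv u (\<lambda>z. grad \<rho> z \<bullet> h) x =
        (LINT y|lborel. u y * \<rho> (x + h - y) - u y * \<rho> (x - y) - u y * (grad \<rho> (x - y) \<bullet> h))"
      unfolding conv_def using i1 i2 by simp
    also have "\<bar>\<dots>\<bar> \<le> (LINT y|lborel. \<bar>u y\<bar> * (L * (norm h)\<^sup>2))"
    proof (rule order_trans[OF integral_abs_bound integral_mono'])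
      show "\<bar>u y * \<rho> (x + h - y) - u y * \<rho> (x - y) - u y * (grad \<rho> (x - y) \<bullet> h)\<bar> \<le> \<bar>u y\<bar> * (L * (norm h)\<^sup>2)" for y
        using mult_left_mono[OF L(2)[of "x - y" h], of "\<bar>u y\<bar>"]
        by (simp add: abs_mult[symmetric] algebra_simps)
    qed (use u L(1) in auto)
    also have "\<dots> = N * L * (norm h)\<^sup>2" by (simp add: N_def)
    finally show ?thesis .
  qed
  show ?thesis
    unfolding has_derivative_at_alt
  proof (intro conjI allI impI)
    show "bounded_linear (\<lambda>h. conv u (\<lambda>z. grad \<rho> z \<bullet> h) x)"
      using lin linear_conv_bounded_linear by blast
    fix e :: real assume "e > 0"
    define d where "d = e / (N * L + 1)"
    have NL: "N * L \<ge> 0" using \<open>N \<ge> 0\<close> L by simp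
    show "\<exists>d>0. \<forall>y. norm (y - x) < d \<longrightarrow>
        norm (conv u \<rho> y - conv u \<rho> x - conv u (\<lambda>z. grad \<rho> z \<bullet> (y - x)) x) \<le> e * norm (y - x)"
    proof (intro exI[of _ d] conjI allI impI)
      show "d > 0" using \<open>e > 0\<close> NL by (simp add: d_def add_nonneg_pos)
      fix y assume "norm (y - x) < d"
      then have "N * L * norm (y - x) \<le> (N * L + 1) * d"
        using NL by (intro mult_mono) auto
      also have "\<dots> = e" using NL by (simp add: d_def)
      finally have "N * L * norm (y - x) * norm (y - x) \<le> e * norm (y - x)"
        by (rule mult_right_mono) simp
      then show "norm (conv u \<rho> y - conv u \<rho> x - conv u (\<lambda>z. grad \<rho> z \<bullet> (y - x)) x) \<le> e * norm (y - x)"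
        using rem[of "y - x"] by (simp add: power2_eq_square mult.assoc)
    qed
  qed
qed

text \<open>A partial derivative falls on the kernel and produces a convolution of the same
  \<open>u\<close> with another test function; hence the induction over all kernels.\<close>

lemma conv_smooth:
  fixes u :: "'a::euclidean_space \<Rightarrow> real"
  assumes u: "integrable lborel u" and \<rho>: "\<rho> \<in> test_functions UNIV"
  shows "smooth (conv u \<rho>)"
proof -
  have "conv u \<rho> \<in> C_class k" for k
    using \<rho>
  proof (induction k arbitrary: \<rho>)
    case 0
    then show ?case
      using has_derivative_continuous[OF conv_has_derivative[OF u 0]]
      by (simp add: continuous_at_imp_continuous_on)
  next
    case (Suc k)
    have "conv u \<rho> differentiable (at x)" for x
      using conv_has_derivative[OF u Suc.prems] by (auto simp: differentiable_def)
    moreover have "(\<lambda>x. frechet_derivative (conv u \<rho>) (at x) b) \<in> C_class k" for b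
      using Suc.IH[OF test_grad_inner[OF Suc.prems, of b]]
      by (simp add: frechet_derivative_eqI[OF conv_has_derivative[OF u Suc.prems]])
    ultimately show ?case by simp
  qed
  then show ?thesis by (simp add: smooth_def)
qed

lemma conv_grad_inner:
  fixes u :: "'a::euclidean_space \<Rightarrow> real"
  assumes u: "integrable lborel u" and \<rho>: "\<rho> \<in> test_functions UNIV"
  shows "grad (conv u \<rho>) x \<bullet> v = conv u (\<lambda>z. grad \<rho> z \<bullet> v) x"
proof -
  have "(conv u \<rho> has_derivative (\<lambda>h. grad (conv u \<rho>) x \<bullet> h)) (at x)"
    by (intro smooth_has_derivative conv_smooth assms)
  from has_derivative_unique[OF this conv_has_derivative[OF u \<rho>]]
  show ?thesis by (rule fun_cong)
qed

lemma conv_zero: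
  assumes "\<And>y. y \<notin> K \<Longrightarrow> u y = 0" "\<And>z. norm z \<ge> r \<Longrightarrow> \<rho> z = 0"
    and "\<And>y. y \<in> K \<Longrightarrow> norm (x - y) \<ge> r"
  shows "conv u \<rho> x = 0"
proof -
  have "(\<lambda>y. u y * \<rho> (x - y)) = (\<lambda>y. 0)"
  proof
    show "u y * \<rho> (x - y) = 0" for y using assms by (cases "y \<in> K") auto
  qed
  then show ?thesis by (simp add: conv_def)
qed

text \<open>Jensen's inequality for the probability density \<open>\<rho>\<close>, followed by Tonelli's theorem.\<close>

lemma conv_L2_error:
  fixes u :: "'a::euclidean_space \<Rightarrow> real"
  assumes u: "integrable lborel u" and u2: "integrable lborel (\<lambda>x. (u x)\<^sup>2)"
    and \<rho>: "\<rho> \<in> test_functions UNIV" "\<And>x. \<rho> x \<ge> 0" "(LINT x|lborel. \<rho> x) = 1" "integrable lborel \<rho>"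
      "\<And>x. norm x \<ge> d \<Longrightarrow> \<rho> x = 0"
    and d: "\<And>y. norm y < d \<Longrightarrow> (LINT x|lborel. (u (x - y) - u x)\<^sup>2) < e" and "e > 0"
  shows "integrable lborel (\<lambda>x. (conv u \<rho> x - u x)\<^sup>2)" "(LINT x|lborel. (conv u \<rho> x - u x)\<^sup>2) \<le> e"
proof -
  have [measurable]: "u \<in> borel_measurable borel" "\<rho> \<in> borel_measurable borel"
    using u \<rho>(1) by (auto dest: borel_measurable_integrable) measurable
  have convm [measurable]: "conv u \<rho> \<in> borel_measurable borel"
    by (intro borel_measurable_continuous_onI smooth_continuous conv_smooth u \<rho>)
  \<comment> \<open>Stated in \<open>ennreal\<close>, so that an infinite right-hand side needs no
    argument and Tonelli's theorem applies without integrability.\<close>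
  have jensen: "ennreal ((conv u \<rho> x - u x)\<^sup>2) \<le> (\<integral>\<^sup>+y. ennreal ((u (x - y) - u x)\<^sup>2 * \<rho> y) \<partial>lborel)" for x
  proof (cases "integrable lborel (\<lambda>y. (u (x - y) - u x)\<^sup>2 * \<rho> y)")
    case True
    let ?d = "\<lambda>y. u (x - y) - u x"
    have i1: "integrable lborel (\<lambda>y. u (x - y) * \<rho> y)"
      using integral_reflect(2)[of "\<lambda>y. u y * \<rho> (x - y)" x] conv_integrable[OF u \<rho>(1), of x] by simp
    have c: "conv u \<rho> x = (LINT y|lborel. u (x - y) * \<rho> y)"
      using integral_reflect(1)[of "\<lambda>y. u y * \<rho> (x - y)" x] by (simp add: conv_def)
    have i2: "integrable lborel (\<lambda>y. ?d y * \<rho> y)"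
      using i1 \<rho>(4) by (simp add: left_diff_distrib)
    define m where "m = conv u \<rho> x - u x"
    have m: "m = (LINT y|lborel. ?d y * \<rho> y)"
      using i1 \<rho>(3,4) by (simp add: m_def c left_diff_distrib)
    \<comment> \<open>Jensen's inequality for the square is the non-negativity of the variance of
      \<open>?d\<close> with respect to the density \<open>\<rho>\<close>.\<close>
    have "0 \<le> (LINT y|lborel. (?d y - m)\<^sup>2 * \<rho> y)"
      using \<rho>(2) by (intro Bochner_Integration.integral_nonneg) auto
    also have "\<dots> = (LINT y|lborel. (?d y)\<^sup>2 * \<rho> y - 2 * m * (?d y * \<rho> y) + m\<^sup>2 * \<rho> y)"
      by (intro Bochner_Integration.integral_cong) (auto simp: power2_eq_square algebra_simps)
    also have "\<dots> = (LINT y|lborel. (?d y)\<^sup>2 * \<rho> y) - m\<^sup>2"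
      using True i2 \<rho>(3,4) by (simp add: m[symmetric] power2_eq_square)
    finally have "m\<^sup>2 \<le> (LINT y|lborel. (?d y)\<^sup>2 * \<rho> y)" by simp
    then show ?thesis
      using True \<rho>(2) by (subst nn_integral_eq_integral) (auto simp: m_def intro!: ennreal_leI)
  next
    case False
    then have "(\<integral>\<^sup>+y. ennreal ((u (x - y) - u x)\<^sup>2 * \<rho> y) \<partial>lborel) = \<infinity>"
      using \<rho>(2) by (auto simp: integrable_iff_bounded less_top[symmetric])
    then show ?thesis by simp
  qed
  have fin: "integrable lborel (\<lambda>x. (u (x - y) - u x)\<^sup>2)" for y
  proof (rule Bochner_Integration.integrable_bound)
    show "integrable lborel (\<lambda>x. 2 * (u (x - y))\<^sup>2 + 2 * (u x)\<^sup>2)"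
      using integrable_translate[OF u2, of y] u2 by auto
    have "(u (x - y) - u x)\<^sup>2 \<le> 2 * (u (x - y))\<^sup>2 + 2 * (u x)\<^sup>2" for x
      using zero_le_power2[of "u (x - y) + u x"] by (simp add: power2_eq_square algebra_simps)
    then show "AE x in lborel. norm ((u (x - y) - u x)\<^sup>2) \<le> norm (2 * (u (x - y))\<^sup>2 + 2 * (u x)\<^sup>2)"
      by simp
  qed measurable
  have "(\<integral>\<^sup>+x. ennreal ((conv u \<rho> x - u x)\<^sup>2) \<partial>lborel) \<le>
      (\<integral>\<^sup>+x. (\<integral>\<^sup>+y. ennreal ((u (x - y) - u x)\<^sup>2 * \<rho> y) \<partial>lborel) \<partial>lborel)"
    by (intro nn_integral_mono jensen)
  also have "\<dots> = (\<integral>\<^sup>+y. (\<integral>\<^sup>+x. ennreal ((u (x - y) - u x)\<^sup>2 * \<rho> y) \<partial>lborel) \<partial>lborel)"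
    by (rule lborel_pair.Fubini') measurable
  also have "\<dots> \<le> (\<integral>\<^sup>+y. ennreal (e * \<rho> y) \<partial>lborel)"
  proof (intro nn_integral_mono)
    fix y :: 'a
    have "(\<integral>\<^sup>+x. ennreal ((u (x - y) - u x)\<^sup>2 * \<rho> y) \<partial>lborel) =
        ennreal ((LINT x|lborel. (u (x - y) - u x)\<^sup>2) * \<rho> y)"
      using fin[of y] \<rho>(2) by (subst nn_integral_eq_integral) auto
    \<comment> \<open>The translation estimate holds only for shifts shorter than \<open>d\<close>;
      for the others \<open>\<rho>\<close> vanishes.\<close>
    also have "\<dots> \<le> ennreal (e * \<rho> y)"
    proof (cases "norm y < d")
      case True
      then show ?thesis using d[OF True] \<rho>(2)[of y] by (intro ennreal_leI mult_right_mono) auto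
    qed (use \<rho>(5)[of y] in auto)
    finally show "(\<integral>\<^sup>+x. ennreal ((u (x - y) - u x)\<^sup>2 * \<rho> y) \<partial>lborel) \<le> ennreal (e * \<rho> y)" .
  qed
  also have "\<dots> = ennreal e"
    using \<rho> \<open>e > 0\<close> by (subst nn_integral_eq_integral) auto
  finally have *: "(\<integral>\<^sup>+x. ennreal ((conv u \<rho> x - u x)\<^sup>2) \<partial>lborel) \<le> ennreal e" .
  show int: "integrable lborel (\<lambda>x. (conv u \<rho> x - u x)\<^sup>2)"
    using * by (intro integrableI_bounded) (auto simp: less_top[symmetric] top_unique)
  show "(LINT x|lborel. (conv u \<rho> x - u x)\<^sup>2) \<le> e"
    using * \<open>e > 0\<close> by (subst (asm) nn_integral_eq_integral[OF int]) auto
qed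

section \<open>Approximation by test functions\<close>

text \<open>The common ground of the two cases of \<open>H\<close>. The gradient is carried as a
  separate argument because the later estimates speak about one fixed representative of it.\<close>

definition approximable :: "'a::euclidean_space set \<Rightarrow> ('a \<Rightarrow> real) \<Rightarrow> ('a \<Rightarrow> 'a) \<Rightarrow> bool" where
  "approximable \<Omega> u g \<longleftrightarrow> u \<in> L2 \<Omega> \<and> g \<in> L2 \<Omega> \<and>
      (\<exists>\<phi>::nat \<Rightarrow> 'a \<Rightarrow> real. (\<forall>k. \<phi> k \<in> test_functions \<Omega>) \<and>
         (\<lambda>k. LINT x|lebesgue_on \<Omega>. (u x - \<phi> k x)\<^sup>2 + (norm (g x - grad (\<phi> k) x))\<^sup>2)
           \<longlonglongrightarrow> 0)"

section \<open>Square integrable functions on a set\<close>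

lemma measurable_lebesgue_on [measurable (raw)]:
  "f \<in> borel_measurable borel \<Longrightarrow> f \<in> borel_measurable (lebesgue_on \<Omega>)"
  by (rule measurable_restrict_space1) (simp add: measurable_completion)

lemma L2_measurable [measurable_dest]: "f \<in> L2 \<Omega> \<Longrightarrow> f \<in> borel_measurable (lebesgue_on \<Omega>)"
  and L2_integrable: "f \<in> L2 \<Omega> \<Longrightarrow> integrable (lebesgue_on \<Omega>) (\<lambda>x. (norm (f x))\<^sup>2)"
  by (auto simp: L2_def)

lemma L2_dominated:
  assumes "f \<in> borel_measurable (lebesgue_on \<Omega>)" "h \<in> L2 \<Omega>" "\<And>x. norm (f x) \<le> C * norm (h x)"
  shows "f \<in> L2 \<Omega>"
  unfolding L2_def
proof (safe intro!: assms(1))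
  have [measurable]: "f \<in> borel_measurable (lebesgue_on \<Omega>)" by fact
  show "integrable (lebesgue_on \<Omega>) (\<lambda>x. (norm (f x))\<^sup>2)"
  proof (rule Bochner_Integration.integrable_bound)
    show "integrable (lebesgue_on \<Omega>) (\<lambda>x. C\<^sup>2 * (norm (h x))\<^sup>2)"
      using L2_integrable[OF assms(2)] by simp
    show "AE x in lebesgue_on \<Omega>. norm ((norm (f x))\<^sup>2) \<le> norm (C\<^sup>2 * (norm (h x))\<^sup>2)"
      using power_mono[OF assms(3) norm_ge_zero, of _ 2] by (simp add: power_mult_distrib)
  qed measurable
qed

lemma L2_add:
  assumes "f \<in> L2 \<Omega>" "h \<in> L2 \<Omega>" shows "(\<lambda>x. f x + h x) \<in> L2 \<Omega>"
  unfolding L2_def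
proof (safe)
  have [measurable]: "f \<in> borel_measurable (lebesgue_on \<Omega>)" "h \<in> borel_measurable (lebesgue_on \<Omega>)"
    using assms by (auto dest: L2_measurable)
  then show "(\<lambda>x. f x + h x) \<in> borel_measurable (lebesgue_on \<Omega>)" by measurable
  show "integrable (lebesgue_on \<Omega>) (\<lambda>x. (norm (f x + h x))\<^sup>2)"
  proof (rule Bochner_Integration.integrable_bound)
    show "integrable (lebesgue_on \<Omega>) (\<lambda>x. 2 * (norm (f x))\<^sup>2 + 2 * (norm (h x))\<^sup>2)"
      using L2_integrable[OF assms(1)] L2_integrable[OF assms(2)] by simp
    have "(norm (f x + h x))\<^sup>2 \<le> 2 * (norm (f x))\<^sup>2 + 2 * (norm (h x))\<^sup>2" for x
      using power_mono[OF norm_triangle_ineq[of "f x" "h x"], of 2] zero_le_power2[of "norm (f x) - norm (h x)"]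
      by (simp add: power2_eq_square algebra_simps)
    then show "AE x in lebesgue_on \<Omega>. norm ((norm (f x + h x))\<^sup>2) \<le> norm (2 * (norm (f x))\<^sup>2 + 2 * (norm (h x))\<^sup>2)"
      by simp
  qed measurable
qed

lemma L2_scaleR: "f \<in> L2 \<Omega> \<Longrightarrow> (\<lambda>x. c *\<^sub>R f x) \<in> L2 \<Omega>"
  by (rule L2_dominated[where C = "\<bar>c\<bar>" and h = f]) (auto dest: L2_measurable)

lemma L2_diff: "f \<in> L2 \<Omega> \<Longrightarrow> h \<in> L2 \<Omega> \<Longrightarrow> (\<lambda>x. f x - h x) \<in> L2 \<Omega>"
  using L2_add[of f \<Omega> "\<lambda>x. (-1) *\<^sub>R h x"] L2_scaleR[of h \<Omega> "-1"] by simp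

lemma L2_inner_const: "f \<in> L2 \<Omega> \<Longrightarrow> (\<lambda>x. f x \<bullet> v) \<in> L2 \<Omega>"
  by (rule L2_dominated[where C = "norm v" and h = f])
     (auto dest: L2_measurable simp: Cauchy_Schwarz_ineq2 mult.commute[of "norm v"])

lemma L2_scaleR_const: "f \<in> L2 \<Omega> \<Longrightarrow> (\<lambda>x. f x *\<^sub>R v) \<in> L2 \<Omega>"
  by (rule L2_dominated[where C = "norm v" and h = f])
     (auto dest: L2_measurable simp: mult.commute)

lemma L2_inner_integrable:
  assumes "f \<in> L2 \<Omega>" "h \<in> L2 \<Omega>"
  shows "integrable (lebesgue_on \<Omega>) (\<lambda>x. f x \<bullet> h x)"
    and "integrable (lebesgue_on \<Omega>) (\<lambda>x. norm (f x) * norm (h x))"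
proof -
  have [measurable]: "f \<in> borel_measurable (lebesgue_on \<Omega>)" "h \<in> borel_measurable (lebesgue_on \<Omega>)"
    using assms by (auto dest: L2_measurable)
  have i: "integrable (lebesgue_on \<Omega>) (\<lambda>x. (norm (f x))\<^sup>2 + (norm (h x))\<^sup>2)"
    using L2_integrable[OF assms(1)] L2_integrable[OF assms(2)] by simp
  have le: "norm (f x) * norm (h x) \<le> (norm (f x))\<^sup>2 + (norm (h x))\<^sup>2" for x
    using zero_le_power2[of "norm (f x) - norm (h x)"] zero_le_power2[of "norm (f x)"] zero_le_power2[of "norm (h x)"]
    unfolding power2_diff by linarith
  show "integrable (lebesgue_on \<Omega>) (\<lambda>x. norm (f x) * norm (h x))"
    by (rule Bochner_Integration.integrable_bound[OF i]) (use le in auto)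
  show "integrable (lebesgue_on \<Omega>) (\<lambda>x. f x \<bullet> h x)"
    by (rule Bochner_Integration.integrable_bound[OF i])
       (use le in \<open>auto intro: order_trans[OF Cauchy_Schwarz_ineq2]\<close>)
qed

lemma integrable_lebesgue_on:
  fixes h :: "'a::euclidean_space \<Rightarrow> 'b::{banach, second_countable_topology}"
  assumes "integrable lborel h" "\<Omega> \<in> sets lebesgue"
  shows "integrable (lebesgue_on \<Omega>) h"
proof -
  have "integrable lebesgue h"
    using assms(1) by (subst integrable_completion) auto
  then show ?thesis
    using assms(2) by (auto simp: integrable_restrict_space intro!: integrable_mult_indicator)
qed

lemma integrable_compact_support:
  fixes h :: "'a::euclidean_space \<Rightarrow> real"
  assumes "continuous_on UNIV h" "compact K" "\<And>x. x \<notin> K \<Longrightarrow> h x = 0"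
  shows "integrable lborel h"
proof -
  have "integrable lborel (\<lambda>x. indicator K x *\<^sub>R h x)"
    using borel_integrable_compact[of K h] assms
    by (auto simp: set_integrable_def intro: continuous_on_subset)
  also have "(\<lambda>x. indicator K x *\<^sub>R h x) = h"
    using assms by (auto simp: indicator_def fun_eq_iff)
  finally show ?thesis .
qed

lemma L2_compact_support:
  fixes h :: "'a::euclidean_space \<Rightarrow> 'b::euclidean_space"
  assumes "continuous_on UNIV h" "compact K" "\<And>x. x \<notin> K \<Longrightarrow> h x = 0" "\<Omega> \<in> sets lebesgue"
  shows "h \<in> L2 \<Omega>"
  unfolding L2_def
proof safe
  show "h \<in> borel_measurable (lebesgue_on \<Omega>)"
    using assms by (intro measurable_lebesgue_on borel_measurable_continuous_onI)
  show "integrable (lebesgue_on \<Omega>) (\<lambda>x. (norm (h x))\<^sup>2)"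
    using assms by (intro integrable_lebesgue_on integrable_compact_support[of _ K] continuous_intros) auto
qed

lemma test_L2:
  assumes "\<phi> \<in> test_functions \<Omega>'" "\<Omega> \<in> sets lebesgue" shows "\<phi> \<in> L2 \<Omega>"
  using assms by (intro L2_compact_support[where K = "supp \<phi>"])
    (auto intro: smooth_continuous test_zero_outside[of _ \<phi>] simp: test_functions_iff)

lemma grad_L2:
  assumes "\<phi> \<in> test_functions \<Omega>'" "\<Omega> \<in> sets lebesgue" shows "grad \<phi> \<in> L2 \<Omega>"
  using assms by (intro L2_compact_support[where K = "supp \<phi>"])
    (auto intro: continuous_on_grad grad_zero_outside[of _ \<phi>] simp: test_functions_iff)

lemma test_integrable: "\<phi> \<in> test_functions \<Omega> \<Longrightarrow> integrable lborel \<phi>"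
  by (intro integrable_compact_support[where K = "supp \<phi>"])
    (auto intro: smooth_continuous test_zero_outside[of _ \<phi>] simp: test_functions_iff)

section \<open>Density of test functions in \<open>H^1\<close> of the whole space\<close>

lemma has_derivative_reflect:
  assumes "smooth \<rho>"
  shows "((\<lambda>y. \<rho> (x - y)) has_derivative (\<lambda>h. - (grad \<rho> (x - y) \<bullet> h))) (at y)"
proof -
  have "((\<lambda>y. x - y) has_derivative (\<lambda>h. - h)) (at y)" by (auto intro!: derivative_eq_intros)
  from has_derivative_compose[OF this smooth_has_derivative[OF assms]] show ?thesis by simp
qed

lemma grad_reflect:
  "smooth \<rho> \<Longrightarrow> grad (\<lambda>y. \<rho> (x - y)) y = - grad \<rho> (x - y)"
  using has_derivative_reflect[of \<rho> x y] by (intro grad_eqI) simp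

lemma smooth_reflect:
  fixes \<rho> :: "'a::euclidean_space \<Rightarrow> real"
  assumes "smooth \<rho>" shows "smooth (\<lambda>y. \<rho> (x - y))"
proof -
  have "(\<lambda>y. \<rho> (x - y)) \<in> C_class k" for k
    using assms
  proof (induction k arbitrary: \<rho>)
    case 0
    have "continuous_on UNIV \<rho>" by (rule smooth_continuous) fact
    then show ?case by (auto intro!: continuous_intros continuous_on_compose2[of UNIV \<rho>])
  next
    case (Suc k)
    note d = has_derivative_reflect[OF Suc.prems, of x]
    have "(\<lambda>y. - 1 * (grad \<rho> (x - y) \<bullet> b)) \<in> C_class k" for b
      by (intro C_class_mult C_class_const Suc.IH[of "\<lambda>y. grad \<rho> y \<bullet> b"] smooth_grad_inner Suc.prems)
    then show ?case
      using d by (auto simp: frechet_derivative_eqI[OF d] differentiable_def intro!: exI)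
  qed
  then show ?thesis by (simp add: smooth_def)
qed

lemma test_reflect:
  fixes \<rho> :: "'a::euclidean_space \<Rightarrow> real"
  assumes "smooth \<rho>" "\<And>z. norm z \<ge> r \<Longrightarrow> \<rho> z = 0" "cball x r \<subseteq> \<Omega>"
  shows "(\<lambda>y. \<rho> (x - y)) \<in> test_functions \<Omega>"
proof (rule test_functionsI)
  show "\<rho> (x - y) = 0" if "y \<notin> cball x r" for y
    using that assms(2)[of "x - y"] by (simp add: dist_norm)
qed (use assms smooth_reflect in auto)

text \<open>A single radius for \<open>u\<close> and all components of its gradient lets one
  mollifier approximate them simultaneously.\<close>

lemma L2_translation_uniform_finite:
  fixes F :: "('a::euclidean_space \<Rightarrow> real) set"
  assumes "finite F" "\<And>u. u \<in> F \<Longrightarrow> u \<in> borel_measurable borel"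
    "\<And>u. u \<in> F \<Longrightarrow> integrable lborel (\<lambda>x. (u x)\<^sup>2)" "e > 0"
  shows "\<exists>d>0. \<forall>u\<in>F. \<forall>y. norm y < d \<longrightarrow> (LINT x|lborel. (u (x - y) - u x)\<^sup>2) < e"
  using assms
proof (induction F)
  case empty
  then show ?case by (auto intro: exI[of _ 1])
next
  case (insert u F)
  obtain d where "d > 0" "\<forall>u\<in>F. \<forall>y. norm y < d \<longrightarrow> (LINT x|lborel. (u (x - y) - u x)\<^sup>2) < e"
    using insert by auto
  moreover obtain d' where "d' > 0" "\<And>y. norm y < d' \<Longrightarrow> (LINT x|lborel. (u (x - y) - u x)\<^sup>2) < e"
    by (rule L2_translation_uniform[of u e]) (use insert.prems in auto)
  ultimately show ?case by (intro exI[of _ "min d d'"]) auto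
qed

text \<open>On a bounded set \<open>\<bar>u\<bar> \<le> u^2 + 1\<close> has an integrable right-hand
  side.\<close>

lemma integrable_bounded_support:
  fixes u :: "'a::euclidean_space \<Rightarrow> real"
  assumes [measurable]: "u \<in> borel_measurable borel" and "integrable lborel (\<lambda>x. (u x)\<^sup>2)"
    and "\<And>x. x \<notin> cball 0 R \<Longrightarrow> u x = 0"
  shows "integrable lborel u"
proof (rule Bochner_Integration.integrable_bound)
  show "integrable lborel (\<lambda>x. (u x)\<^sup>2 + indicator (cball (0::'a) R) x)"
    using assms(2) emeasure_lborel_cball_finite[of "0::'a" R]
    by (intro Bochner_Integration.integrable_add integrable_real_indicator) (auto simp: less_top)
  show "AE x in lborel. norm (u x) \<le> norm ((u x)\<^sup>2 + indicator (cball 0 R) x)"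
  proof (rule AE_I2)
    fix x
    have "\<bar>u x\<bar> \<le> (u x)\<^sup>2 + 1"
      using zero_le_power2[of "\<bar>u x\<bar> - 1"] zero_le_power2[of "u x"] unfolding power2_diff power2_abs by simp
    then show "norm (u x) \<le> norm ((u x)\<^sup>2 + indicator (cball 0 R) x)"
      using assms(3)[of x] by (cases "x \<in> cball 0 R") (auto simp: indicator_def)
  qed
qed measurable

text \<open>For fixed \<open>x\<close> the reflected kernel \<open>\<rho>(x - y)\<close> is a test
  function in \<open>y\<close>. Inserting it into the weak identity shows that the gradient of the
  mollification is the mollification of the weak gradient, the two minus signs cancelling. Both
  errors are then translation errors. Bounded support of \<open>u\<close> makes the mollification a
  test function.\<close>

lemma mollification_approximates:
  fixes u :: "'a::euclidean_space \<Rightarrow> real" and G :: "'a \<Rightarrow> 'a \<Rightarrow> real"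
  assumes um: "u \<in> borel_measurable borel" and Gm: "\<And>b. b \<in> Basis \<Longrightarrow> G b \<in> borel_measurable borel"
    and u2: "integrable lborel (\<lambda>x. (u x)\<^sup>2)" and G2: "\<And>b. b \<in> Basis \<Longrightarrow> integrable lborel (\<lambda>x. (G b x)\<^sup>2)"
    and u0: "\<And>x. x \<notin> cball 0 R \<Longrightarrow> u x = 0" and G0: "\<And>b x. b \<in> Basis \<Longrightarrow> x \<notin> cball 0 R \<Longrightarrow> G b x = 0"
    and weak: "\<And>\<phi> b. \<phi> \<in> test_functions UNIV \<Longrightarrow> b \<in> Basis \<Longrightarrow>
      (LINT x|lborel. u x * (grad \<phi> x \<bullet> b)) = - (LINT x|lborel. G b x * \<phi> x)"
    and "e > 0"
  shows "\<exists>\<phi>\<in>test_functions UNIV. (LINT x|lborel. (u x - \<phi> x)\<^sup>2 + (\<Sum>b\<in>Basis. (G b x - grad \<phi> x \<bullet> b)\<^sup>2)) < e"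
proof -
  \<comment> \<open>There are \<open>DIM('a) + 1\<close> errors of size at most \<open>e'\<close>;
    the extra share makes the total strictly less than \<open>e\<close>.\<close>
  define e' where "e' = e / (DIM('a) + 2)"
  have e0: "e' > 0" and "(DIM('a) + 2) * e' = e"
    using \<open>e > 0\<close> by (simp_all add: e'_def add_pos_pos)
  then have e': "e' > 0" "e' + DIM('a) * e' < e"
    by (auto simp: algebra_simps)
  obtain d where d: "d > 0" "\<And>w y. w \<in> insert u (G ` Basis) \<Longrightarrow> norm y < d \<Longrightarrow> (LINT x|lborel. (w (x - y) - w x)\<^sup>2) < e'"
  proof -
    have "\<And>w. w \<in> insert u (G ` Basis) \<Longrightarrow> w \<in> borel_measurable borel \<and> integrable lborel (\<lambda>x. (w x)\<^sup>2)"
      using um Gm u2 G2 by auto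
    then show ?thesis
      using L2_translation_uniform_finite[of "insert u (G ` Basis)" e'] e' that by fastforce
  qed
  obtain \<rho> :: "'a \<Rightarrow> real" where \<rho>: "\<rho> \<in> test_functions UNIV"
    "\<And>x. \<rho> x \<ge> 0" "\<And>x. norm x \<ge> d \<Longrightarrow> \<rho> x = 0" "(LINT x|lborel. \<rho> x) = 1" "integrable lborel \<rho>"
    using bump_exists[OF d(1)] by metis
  have u1: "integrable lborel u" using integrable_bounded_support[OF um u2 u0] by simp
  have G1: "integrable lborel (G b)" if "b \<in> Basis" for b
    using integrable_bounded_support[OF Gm[OF that] G2[OF that] G0[OF that]] by simp
  define \<phi> where "\<phi> = conv u \<rho>"
  have sm: "smooth \<phi>" unfolding \<phi>_def by (rule conv_smooth[OF u1 \<rho>(1)])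
  have "\<phi> x = 0" if "x \<notin> cball 0 (R + d)" for x
    unfolding \<phi>_def
  proof (rule conv_zero[where K = "cball 0 R"])
    show "norm (x - y) \<ge> d" if "y \<in> cball 0 R" for y
      using that \<open>x \<notin> cball 0 (R + d)\<close> norm_triangle_ineq2[of x y] by simp
  qed (use u0 \<rho>(3) in auto)
  then have test: "\<phi> \<in> test_functions UNIV" by (intro test_functionsI[OF sm, of "cball 0 (R + d)"]) auto
  have gr: "grad \<phi> x \<bullet> b = conv (G b) \<rho> x" if b: "b \<in> Basis" for b x
  proof -
    have t: "(\<lambda>y. \<rho> (x - y)) \<in> test_functions UNIV"
      using \<rho> by (intro test_reflect[of \<rho> d]) auto
    have "grad \<phi> x \<bullet> b = (LINT y|lborel. u y * (grad \<rho> (x - y) \<bullet> b))"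
      unfolding \<phi>_def conv_grad_inner[OF u1 \<rho>(1)] by (simp add: conv_def)
    also have "\<dots> = - (LINT y|lborel. u y * (grad (\<lambda>y. \<rho> (x - y)) y \<bullet> b))"
      using \<rho>(1) by (simp add: grad_reflect test_smooth)
    also have "\<dots> = conv (G b) \<rho> x"
      using weak[OF t b] by (simp add: conv_def)
    finally show ?thesis .
  qed
  have 1: "integrable lborel (\<lambda>x. (u x - \<phi> x)\<^sup>2)" "(LINT x|lborel. (u x - \<phi> x)\<^sup>2) \<le> e'"
    using conv_L2_error[OF u1 u2 \<rho>(1,2,4,5,3) d(2) e'(1)] by (simp_all add: \<phi>_def power2_commute)
  have 2: "integrable lborel (\<lambda>x. (G b x - grad \<phi> x \<bullet> b)\<^sup>2)" "(LINT x|lborel. (G b x - grad \<phi> x \<bullet> b)\<^sup>2) \<le> e'"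
    if b: "b \<in> Basis" for b
    using conv_L2_error[OF G1[OF b] G2[OF b] \<rho>(1,2,4,5,3) d(2) e'(1)] b by (simp_all add: gr[OF b] power2_commute)
  have "(LINT x|lborel. (u x - \<phi> x)\<^sup>2 + (\<Sum>b\<in>Basis. (G b x - grad \<phi> x \<bullet> b)\<^sup>2)) =
      (LINT x|lborel. (u x - \<phi> x)\<^sup>2) + (\<Sum>b\<in>Basis. LINT x|lborel. (G b x - grad \<phi> x \<bullet> b)\<^sup>2)"
    using 1 2 by (subst Bochner_Integration.integral_add) (auto intro!: Bochner_Integration.integral_sum)
  also have "\<dots> \<le> e' + (\<Sum>b\<in>(Basis::'a set). e')"
    using 1 2 by (intro add_mono sum_mono) auto
  also have "\<dots> < e" using e' by simp
  finally show ?thesis using test by blast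
qed

text \<open>Mollify the indicator of the ball of radius \<open>R + 1\<close> with a fixed bump of
  radius 1. Because the bump is fixed and the indicator is at most 1, the gradient is bounded by the
  \<open>L^1\<close> norms of the partial derivatives of the bump, independently of
  \<open>R\<close>.\<close>

lemma cutoff_exists:
  obtains C where "C > 0" "\<And>R. R > 0 \<Longrightarrow> \<exists>\<eta>\<in>test_functions (UNIV :: 'a::euclidean_space set).
    \<forall>x. \<bar>\<eta> x\<bar> \<le> 1 \<and> norm (grad \<eta> x) \<le> C \<and> (norm x < R \<longrightarrow> \<eta> x = 1 \<and> grad \<eta> x = 0)"
proof -
  obtain \<rho> :: "'a \<Rightarrow> real" where \<rho>: "\<rho> \<in> test_functions UNIV"
    "\<And>x. \<rho> x \<ge> 0" "\<And>x. norm x \<ge> 1 \<Longrightarrow> \<rho> x = 0" "(LINT x|lborel. \<rho> x) = 1" "integrable lborel \<rho>"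
    using bump_exists[of 1] by (metis zero_less_one)
  have [measurable]: "\<rho> \<in> borel_measurable borel" using \<rho>(1) by measurable
  note ig = test_integrable[OF test_grad_inner[OF \<rho>(1)]]
  define C where "C = 1 + (\<Sum>b\<in>Basis. LINT y|lborel. \<bar>grad \<rho> y \<bullet> b\<bar>)"
  have "C > 0" unfolding C_def by (intro add_pos_nonneg sum_nonneg) auto
  moreover have "\<exists>\<eta>\<in>test_functions (UNIV :: 'a set).
    \<forall>x. \<bar>\<eta> x\<bar> \<le> 1 \<and> norm (grad \<eta> x) \<le> C \<and> (norm x < R \<longrightarrow> \<eta> x = 1 \<and> grad \<eta> x = 0)" if "R > 0" for R
  proof
    let ?B = "cball (0::'a) (R + 1)"
    define \<eta> where "\<eta> = conv (indicator ?B) \<rho>"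
    have iB: "integrable lborel (indicator ?B :: 'a \<Rightarrow> real)"
      using emeasure_lborel_cball_finite[of "0::'a" "R+1"] by (intro integrable_real_indicator) (auto simp: less_top)
    have sm: "smooth \<eta>" unfolding \<eta>_def by (rule conv_smooth[OF iB \<rho>(1)])
    have "\<eta> x = 0" if "x \<notin> cball 0 (R + 2)" for x
      unfolding \<eta>_def
    proof (rule conv_zero[where K = ?B])
      show "norm (x - y) \<ge> 1" if "y \<in> ?B" for y
        using that \<open>x \<notin> cball 0 (R + 2)\<close> norm_triangle_ineq2[of x y] by simp
    qed (use \<rho>(3) in auto)
    then show "\<eta> \<in> test_functions UNIV" by (intro test_functionsI[OF sm, of "cball 0 (R + 2)"]) auto
    have reflect: "(LINT y|lborel. \<bar>h (x - y)\<bar>) = (LINT y|lborel. \<bar>h y\<bar>)"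
      if "integrable lborel h" for h :: "'a \<Rightarrow> real" and x
      using integral_reflect(1)[of "\<lambda>y. \<bar>h y\<bar>" x] that by (auto dest: borel_measurable_integrable)
    have bound: "\<bar>conv (indicator ?B) h x\<bar> \<le> (LINT y|lborel. \<bar>h y\<bar>)" if "integrable lborel h" for h x
    proof -
      have i: "integrable lborel (\<lambda>y. h (x - y))"
        using integral_reflect(2)[of h x] that by (auto dest: borel_measurable_integrable)
      have "\<bar>conv (indicator ?B) h x\<bar> \<le> (LINT y|lborel. \<bar>h (x - y)\<bar>)"
        unfolding conv_def using i
        by (intro order_trans[OF integral_abs_bound integral_mono']) (auto simp: indicator_def)
      then show ?thesis by (simp add: reflect[OF that])
    qed
    have le1: "\<bar>\<eta> x\<bar> \<le> 1" for x
      using bound[OF \<rho>(5), of x] \<rho>(2,4) by (simp add: \<eta>_def)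
    have eq1: "\<eta> x = 1" if "norm x < R" for x
    proof -
      have "indicator ?B y * \<rho> (x - y) = \<rho> (x - y)" for y
        using \<rho>(3)[of "x - y"] that norm_triangle_ineq2[of y x]
        by (cases "norm (x - y) < 1") (auto simp: indicator_def norm_minus_commute)
      then have "\<eta> x = (LINT y|lborel. \<rho> (x - y))"
        unfolding \<eta>_def conv_def by (rule Bochner_Integration.integral_cong[OF refl])
      also have "\<dots> = 1" using integral_reflect(1)[of \<rho> x] \<rho>(4) by simp
      finally show ?thesis .
    qed
    have gr0: "grad \<eta> x = 0" if "norm x < R" for x
    proof (rule grad_eqI)
      have "((\<lambda>_. 1) has_derivative (\<lambda>h. 0 \<bullet> h)) (at x)" by auto
      then show "(\<eta> has_derivative (\<lambda>h. 0 \<bullet> h)) (at x)"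
        by (rule has_derivative_transform_within_open[where s = "ball 0 R"]) (use that eq1 in auto)
    qed
    have grb: "norm (grad \<eta> x) \<le> C" for x
    proof -
      have "norm (grad \<eta> x) \<le> (\<Sum>b\<in>Basis. \<bar>grad \<eta> x \<bullet> b\<bar>)" by (rule norm_le_l1)
      also have "\<dots> \<le> (\<Sum>b\<in>Basis. LINT y|lborel. \<bar>grad \<rho> y \<bullet> b\<bar>)"
        unfolding \<eta>_def conv_grad_inner[OF iB \<rho>(1)] by (intro sum_mono bound ig)
      finally show ?thesis by (simp add: C_def)
    qed
    show "\<forall>x. \<bar>\<eta> x\<bar> \<le> 1 \<and> norm (grad \<eta> x) \<le> C \<and> (norm x < R \<longrightarrow> \<eta> x = 1 \<and> grad \<eta> x = 0)"
      using le1 eq1 gr0 grb by blast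
  qed
  ultimately show ?thesis by (rule that)
qed

lemma tail_integral_small:
  fixes h :: "'a::euclidean_space \<Rightarrow> real"
  assumes h: "integrable lborel h" and "e > 0"
  obtains R where "R > 0" "(LINT x|lborel. (if norm x < R then 0 else h x)) < e"
proof -
  have [measurable]: "h \<in> borel_measurable borel" using h by (auto dest: borel_measurable_integrable)
  have "(\<lambda>n. LINT x|lborel. (if norm x < real (Suc n) then 0 else h x)) \<longlonglongrightarrow> (LINT x|(lborel :: 'a measure). 0)"
  proof (rule integral_dominated_convergence[where w = "\<lambda>x. \<bar>h x\<bar>"])
    show "AE x in lborel. (\<lambda>n. if norm x < real (Suc n) then 0 else h x) \<longlonglongrightarrow> 0"
    proof (rule AE_I2, rule tendsto_eventually)
      fix x :: 'a
      show "\<forall>\<^sub>F n in sequentially. (if norm x < real (Suc n) then 0 else h x) = 0"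
      proof (rule eventually_sequentiallyI[of "nat \<lceil>norm x\<rceil>"])
        fix n assume "nat \<lceil>norm x\<rceil> \<le> n"
        then have "norm x < real (Suc n)" by linarith
        then show "(if norm x < real (Suc n) then 0 else h x) = 0" by simp
      qed
    qed
  qed (use h in auto)
  then have "(\<lambda>n. LINT x|lborel. (if norm x < real (Suc n) then 0 else h x)) \<longlonglongrightarrow> 0" by simp
  from order_tendstoD(2)[OF this \<open>e > 0\<close>]
  obtain n where "(LINT x|lborel. (if norm x < real (Suc n) then 0 else h x)) < e"
    by (auto simp: eventually_sequentially)
  then show ?thesis by (intro that[of "real (Suc n)"]) auto
qed

text \<open>The function is multiplied by a cutoff and then mollified. By the product rule
  \<open>G1 b\<close> is the weak derivative of the cut function, as one sees by testing the
  identity for \<open>u\<close> with \<open>\<phi> * \<eta>\<close>. The cutoff error lives outside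
  the ball of radius \<open>R\<close> and is controlled by a tail integral since the gradient bound
  \<open>C\<close> is uniform in \<open>R\<close>.\<close>

lemma whole_space_approximates:
  fixes u :: "'a::euclidean_space \<Rightarrow> real" and G :: "'a \<Rightarrow> 'a \<Rightarrow> real"
  assumes um [measurable]: "u \<in> borel_measurable borel" and Gm: "\<And>b. b \<in> Basis \<Longrightarrow> G b \<in> borel_measurable borel"
    and u2: "integrable lborel (\<lambda>x. (u x)\<^sup>2)" and G2: "\<And>b. b \<in> Basis \<Longrightarrow> integrable lborel (\<lambda>x. (G b x)\<^sup>2)"
    and weak: "\<And>\<phi> b. \<phi> \<in> test_functions UNIV \<Longrightarrow> b \<in> Basis \<Longrightarrow>
      (LINT x|lborel. u x * (grad \<phi> x \<bullet> b)) = - (LINT x|lborel. G b x * \<phi> x)"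
    and "e > 0"
  shows "\<exists>\<phi>\<in>test_functions UNIV. (LINT x|lborel. (u x - \<phi> x)\<^sup>2 + (\<Sum>b\<in>Basis. (G b x - grad \<phi> x \<bullet> b)\<^sup>2)) < e"
proof -
  obtain C where C: "C > 0" and cut: "\<And>R. R > 0 \<Longrightarrow> \<exists>\<eta>\<in>test_functions (UNIV :: 'a set).
    \<forall>x. \<bar>\<eta> x\<bar> \<le> 1 \<and> norm (grad \<eta> x) \<le> C \<and> (norm x < R \<longrightarrow> \<eta> x = 1 \<and> grad \<eta> x = 0)"
    using cutoff_exists by metis
  define D where "D = real DIM('a)"
  \<comment> \<open>This dominates the cutoff error: 4 is the square of the bound 2 for
    \<open>\<bar>1 - \<eta> x\<bar>\<close>, 8 is twice that, and \<open>2 * C^2 * (u x)^2\<close>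
    occurs once for each of the \<open>D\<close> basis vectors.\<close>
  define h where "h x = (4 + 2 * C\<^sup>2 * D) * (u x)\<^sup>2 + 8 * (\<Sum>b\<in>Basis. (G b x)\<^sup>2)" for x
  have inth: "integrable lborel h" unfolding h_def using u2 G2 by auto
  have D0: "D \<ge> 0" by (simp add: D_def)
  have h0: "h x \<ge> 0" for x
    unfolding h_def using D0 by (intro add_nonneg_nonneg mult_nonneg_nonneg sum_nonneg) auto
  obtain R where R: "R > 0" "(LINT x|lborel. (if norm x < R then 0 else h x)) < e / 4"
    using tail_integral_small[OF inth, of "e / 4"] \<open>e > 0\<close> by auto
  obtain \<eta> where \<eta>: "\<eta> \<in> test_functions (UNIV :: 'a set)" "\<And>x. \<bar>\<eta> x\<bar> \<le> 1" "\<And>x. norm (grad \<eta> x) \<le> C"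
    "\<And>x. norm x < R \<Longrightarrow> \<eta> x = 1" "\<And>x. norm x < R \<Longrightarrow> grad \<eta> x = 0"
    using cut[OF R(1)] by blast
  have [measurable]: "\<eta> \<in> borel_measurable borel" using \<eta>(1) by measurable
  have gm [measurable]: "(\<lambda>x. grad \<eta> x \<bullet> b) \<in> borel_measurable borel" for b
    using test_grad_inner[OF \<eta>(1), of b] by measurable
  have grb: "\<bar>grad \<eta> x \<bullet> b\<bar> \<le> C" if "b \<in> Basis" for x b
    using order_trans[OF Basis_le_norm[OF that] \<eta>(3)] .
  have "bounded (supp \<eta>)"
    using \<eta>(1) by (intro compact_imp_bounded) (auto simp: test_functions_iff)
  then obtain R' where R': "supp \<eta> \<subseteq> cball 0 R'"
    unfolding bounded_iff by (metis mem_cball_0 subsetI)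
  define u1 where "u1 x = \<eta> x * u x" for x
  define G1 where "G1 b x = \<eta> x * G b x + u x * (grad \<eta> x \<bullet> b)" for b x
  have u1m [measurable]: "u1 \<in> borel_measurable borel" unfolding u1_def by measurable
  have G1m: "G1 b \<in> borel_measurable borel" if "b \<in> Basis" for b
  proof -
    note [measurable] = Gm[OF that]
    show ?thesis unfolding G1_def by measurable
  qed
  have u12: "integrable lborel (\<lambda>x. (u1 x)\<^sup>2)"
  proof (rule Bochner_Integration.integrable_bound[OF u2])
    have "(u1 x)\<^sup>2 \<le> (u x)\<^sup>2" for x
      unfolding u1_def abs_le_square_iff[symmetric] using \<eta>(2)[of x] by (simp add: abs_mult mult_left_le_one_le)
    then show "AE x in lborel. norm ((u1 x)\<^sup>2) \<le> norm ((u x)\<^sup>2)" by simp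
  qed measurable
  have sq: "(a + b)\<^sup>2 \<le> 2 * a\<^sup>2 + 2 * b\<^sup>2" for a b :: real
    using zero_le_power2[of "a - b"] by (simp add: power2_eq_square algebra_simps)
  have sq': "(a * b)\<^sup>2 \<le> K\<^sup>2 * b\<^sup>2" if "\<bar>a\<bar> \<le> K" for a b K :: real
    using that by (auto simp: power_mult_distrib abs_le_square_iff[symmetric] intro!: mult_right_mono)
  have G1b: "(G1 b x)\<^sup>2 \<le> 2 * (G b x)\<^sup>2 + 2 * (C\<^sup>2 * (u x)\<^sup>2)" if "b \<in> Basis" for b x
    using sq[of "\<eta> x * G b x" "(grad \<eta> x \<bullet> b) * u x"] sq'[OF \<eta>(2)[of x], of "G b x"] sq'[OF grb[OF that, of x], of "u x"]
    by (simp add: G1_def mult.commute)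
  have G12: "integrable lborel (\<lambda>x. (G1 b x)\<^sup>2)" if "b \<in> Basis" for b
  proof (rule Bochner_Integration.integrable_bound)
    show "integrable lborel (\<lambda>x. 2 * (G b x)\<^sup>2 + 2 * (C\<^sup>2 * (u x)\<^sup>2))" using u2 G2[OF that] by simp
    show "AE x in lborel. norm ((G1 b x)\<^sup>2) \<le> norm (2 * (G b x)\<^sup>2 + 2 * (C\<^sup>2 * (u x)\<^sup>2))"
      using G1b[OF that] by simp
    note [measurable] = G1m[OF that]
    show "(\<lambda>x. (G1 b x)\<^sup>2) \<in> borel_measurable lborel" by measurable
  qed
  have out: "\<eta> x = 0" "grad \<eta> x = 0" if "x \<notin> cball 0 R'" for x
  proof -
    have "x \<notin> supp \<eta>" using that R' by blast
    then show "\<eta> x = 0" "grad \<eta> x = 0" by (rule test_zero_outside, rule grad_zero_outside)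
  qed
  have weak1: "(LINT x|lborel. u1 x * (grad \<phi> x \<bullet> b)) = - (LINT x|lborel. G1 b x * \<phi> x)"
    if \<phi>: "\<phi> \<in> test_functions UNIV" and b: "b \<in> Basis" for \<phi> b
  proof -
    have t: "(\<lambda>x. \<phi> x * \<eta> x) \<in> test_functions UNIV" using \<phi> \<eta>(1) by (intro test_mult) auto
    have L: "integrable lborel (\<lambda>x. u x * \<psi> x)" "integrable lborel (\<lambda>x. G b x * \<psi> x)"
      if "\<psi> \<in> test_functions UNIV" for \<psi>
    proof -
      note [measurable] = Gm[OF b] test_measurable[OF that]
      have p2: "integrable lborel (\<lambda>x. (\<psi> x)\<^sup>2)"
        using test_integrable[OF test_mult[OF that test_smooth[OF that]]] by (simp add: power2_eq_square)
      have "integrable lborel (\<lambda>x. w x * \<psi> x)" if "integrable lborel (\<lambda>x. (w x)\<^sup>2)" and [measurable]: "w \<in> borel_measurable borel" for w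
      proof (rule Bochner_Integration.integrable_bound)
        show "integrable lborel (\<lambda>x. (w x)\<^sup>2 + (\<psi> x)\<^sup>2)" using that p2 by simp
        have "\<bar>w x * \<psi> x\<bar> \<le> (w x)\<^sup>2 + (\<psi> x)\<^sup>2" for x
          using zero_le_power2[of "\<bar>w x\<bar> - \<bar>\<psi> x\<bar>"] zero_le_power2[of "w x"] zero_le_power2[of "\<psi> x"]
          mult_nonneg_nonneg[OF abs_ge_zero abs_ge_zero, of "w x" "\<psi> x"]
          unfolding power2_diff power2_abs abs_mult by linarith
        then show "AE x in lborel. norm (w x * \<psi> x) \<le> norm ((w x)\<^sup>2 + (\<psi> x)\<^sup>2)" by simp
      qed measurable
      then show "integrable lborel (\<lambda>x. u x * \<psi> x)" "integrable lborel (\<lambda>x. G b x * \<psi> x)"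
        using u2 G2[OF b] by auto
    qed
    have i1: "integrable lborel (\<lambda>x. u x * (grad (\<lambda>x. \<phi> x * \<eta> x) x \<bullet> b))" by (rule L(1)[OF test_grad_inner[OF t]])
    have i2: "integrable lborel (\<lambda>x. u x * (\<phi> x * (grad \<eta> x \<bullet> b)))"
      by (rule L(1)[OF test_mult[OF \<phi> test_smooth[OF test_grad_inner[OF \<eta>(1)]]]])
    have i3: "integrable lborel (\<lambda>x. G b x * (\<phi> x * \<eta> x))" by (rule L(2)[OF t])
    have "(LINT x|lborel. u1 x * (grad \<phi> x \<bullet> b)) =
        (LINT x|lborel. u x * (grad (\<lambda>x. \<phi> x * \<eta> x) x \<bullet> b) - u x * (\<phi> x * (grad \<eta> x \<bullet> b)))"
      using \<phi> \<eta>(1) by (intro Bochner_Integration.integral_cong refl)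
        (auto simp: u1_def grad_mult test_smooth inner_add_left algebra_simps)
    also have "\<dots> = - (LINT x|lborel. G b x * (\<phi> x * \<eta> x)) - (LINT x|lborel. u x * (\<phi> x * (grad \<eta> x \<bullet> b)))"
      using i1 i2 weak[OF t b] by simp
    also have "\<dots> = - (LINT x|lborel. G b x * (\<phi> x * \<eta> x) + u x * (\<phi> x * (grad \<eta> x \<bullet> b)))"
      using i2 i3 by simp
    also have "(\<lambda>x. G b x * (\<phi> x * \<eta> x) + u x * (\<phi> x * (grad \<eta> x \<bullet> b))) = (\<lambda>x. G1 b x * \<phi> x)"
      by (auto simp: G1_def algebra_simps)
    finally show ?thesis .
  qed
  obtain \<phi> where \<phi>: "\<phi> \<in> test_functions UNIV"
    "(LINT x|lborel. (u1 x - \<phi> x)\<^sup>2 + (\<Sum>b\<in>Basis. (G1 b x - grad \<phi> x \<bullet> b)\<^sup>2)) < e / 4"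
    using mollification_approximates[OF u1m G1m u12 G12 _ _ weak1, of R' "e / 4"] out \<open>e > 0\<close>
    by (auto simp: u1_def G1_def)
  have [measurable]: "\<phi> \<in> borel_measurable borel" "\<And>b. (\<lambda>x. grad \<phi> x \<bullet> b) \<in> borel_measurable borel"
    using \<phi>(1) test_grad_inner[OF \<phi>(1)] by measurable
  have sqd: "integrable lborel (\<lambda>x. (w x - \<psi> x)\<^sup>2)"
    if "integrable lborel (\<lambda>x. (w x)\<^sup>2)" "\<psi> \<in> test_functions UNIV" and [measurable]: "w \<in> borel_measurable borel" for w \<psi> :: "'a \<Rightarrow> real"
  proof (rule Bochner_Integration.integrable_bound)
    note [measurable] = test_measurable[OF that(2)]
    have "integrable lborel (\<lambda>x. (\<psi> x)\<^sup>2)"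
      using test_integrable[OF test_mult[OF that(2) test_smooth[OF that(2)]]] by (simp add: power2_eq_square)
    then show "integrable lborel (\<lambda>x. 2 * (w x)\<^sup>2 + 2 * (\<psi> x)\<^sup>2)" using that by simp
    show "AE x in lborel. norm ((w x - \<psi> x)\<^sup>2) \<le> norm (2 * (w x)\<^sup>2 + 2 * (\<psi> x)\<^sup>2)"
      using sq[of "w _" "- \<psi> _"] by simp
    show "(\<lambda>x. (w x - \<psi> x)\<^sup>2) \<in> borel_measurable lborel" by measurable
  qed
  have i1: "integrable lborel (\<lambda>x. (u1 x - \<phi> x)\<^sup>2 + (\<Sum>b\<in>Basis. (G1 b x - grad \<phi> x \<bullet> b)\<^sup>2))"
    using u12 G12 G1m \<phi>(1) test_grad_inner[OF \<phi>(1)]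
    by (intro Bochner_Integration.integrable_add Bochner_Integration.integrable_sum sqd) auto
  have [measurable]: "(\<lambda>x. if norm x < R then 0 else h x) \<in> borel_measurable borel"
    using borel_measurable_integrable[OF inth] by measurable
  have i2: "integrable lborel (\<lambda>x. if norm x < R then 0 else h x)"
    by (rule Bochner_Integration.integrable_bound[OF inth]) auto
  have le: "(u x - \<phi> x)\<^sup>2 + (\<Sum>b\<in>Basis. (G b x - grad \<phi> x \<bullet> b)\<^sup>2) \<le>
      2 * ((u1 x - \<phi> x)\<^sup>2 + (\<Sum>b\<in>Basis. (G1 b x - grad \<phi> x \<bullet> b)\<^sup>2)) + 2 * (if norm x < R then 0 else h x)" for x
  proof -
    have "(u x - \<phi> x)\<^sup>2 \<le> 2 * (u1 x - \<phi> x)\<^sup>2 + 2 * (u x - u1 x)\<^sup>2"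
      using sq[of "u1 x - \<phi> x" "u x - u1 x"] by simp
    moreover have "(\<Sum>b\<in>Basis. (G b x - grad \<phi> x \<bullet> b)\<^sup>2) \<le>
        (\<Sum>b\<in>Basis. 2 * (G1 b x - grad \<phi> x \<bullet> b)\<^sup>2 + 2 * (G b x - G1 b x)\<^sup>2)"
    proof (rule sum_mono)
      fix b
      show "(G b x - grad \<phi> x \<bullet> b)\<^sup>2 \<le> 2 * (G1 b x - grad \<phi> x \<bullet> b)\<^sup>2 + 2 * (G b x - G1 b x)\<^sup>2"
        using sq[of "G1 b x - grad \<phi> x \<bullet> b" "G b x - G1 b x"] by simp
    qed
    moreover have "(u x - u1 x)\<^sup>2 + (\<Sum>b\<in>Basis. (G b x - G1 b x)\<^sup>2) \<le> (if norm x < R then 0 else h x)"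
    proof (cases "norm x < R")
      case True
      then show ?thesis using \<eta>(4,5) by (simp add: u1_def G1_def)
    next
      case False
      have a: "\<bar>1 - \<eta> x\<bar> \<le> 2" using \<eta>(2)[of x] by linarith
      have "(u x - u1 x)\<^sup>2 \<le> 4 * (u x)\<^sup>2"
        using sq'[OF a, of "u x"] by (simp add: u1_def left_diff_distrib)
      moreover have "(\<Sum>b\<in>Basis. (G b x - G1 b x)\<^sup>2) \<le> (\<Sum>b\<in>(Basis::'a set). 8 * (G b x)\<^sup>2 + 2 * (C\<^sup>2 * (u x)\<^sup>2))"
      proof (rule sum_mono)
        fix b :: 'a assume b: "b \<in> Basis"
        have "G b x - G1 b x = (1 - \<eta> x) * G b x + (- (grad \<eta> x \<bullet> b)) * u x"
          by (simp add: G1_def algebra_simps)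
        then show "(G b x - G1 b x)\<^sup>2 \<le> 8 * (G b x)\<^sup>2 + 2 * (C\<^sup>2 * (u x)\<^sup>2)"
          using sq[of "(1 - \<eta> x) * G b x" "(- (grad \<eta> x \<bullet> b)) * u x"] sq'[OF a, of "G b x"]
            sq'[of "- (grad \<eta> x \<bullet> b)" C "u x"] grb[OF b, of x] by simp
      qed
      moreover have "(\<Sum>b\<in>(Basis::'a set). 8 * (G b x)\<^sup>2 + 2 * (C\<^sup>2 * (u x)\<^sup>2)) = 8 * (\<Sum>b\<in>Basis. (G b x)\<^sup>2) + 2 * C\<^sup>2 * D * (u x)\<^sup>2"
        by (simp add: sum.distrib sum_distrib_left[symmetric] D_def)
      ultimately show ?thesis using False by (simp add: h_def algebra_simps)
    qed
    ultimately show ?thesis by (simp add: sum.distrib sum_distrib_left[symmetric])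
  qed
  have "(LINT x|lborel. (u x - \<phi> x)\<^sup>2 + (\<Sum>b\<in>Basis. (G b x - grad \<phi> x \<bullet> b)\<^sup>2)) \<le>
      (LINT x|lborel. 2 * ((u1 x - \<phi> x)\<^sup>2 + (\<Sum>b\<in>Basis. (G1 b x - grad \<phi> x \<bullet> b)\<^sup>2)) + 2 * (if norm x < R then 0 else h x))"
  proof (rule integral_mono')
    show "integrable lborel (\<lambda>x. 2 * ((u1 x - \<phi> x)\<^sup>2 + (\<Sum>b\<in>Basis. (G1 b x - grad \<phi> x \<bullet> b)\<^sup>2)) +
        2 * (if norm x < R then 0 else h x))"
      by (intro Bochner_Integration.integrable_add integrable_mult_right i1 i2)
  qed (use le h0 in \<open>auto intro!: add_nonneg_nonneg sum_nonneg\<close>)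
  also have "\<dots> = 2 * (LINT x|lborel. (u1 x - \<phi> x)\<^sup>2 + (\<Sum>b\<in>Basis. (G1 b x - grad \<phi> x \<bullet> b)\<^sup>2)) +
      2 * (LINT x|lborel. (if norm x < R then 0 else h x))"
    by (subst Bochner_Integration.integral_add[OF integrable_mult_right[OF i1] integrable_mult_right[OF i2]])
       (simp only: integral_mult_right_zero)
  also have "\<dots> < e" using \<phi>(2) R(2) by linarith
  finally show ?thesis using \<phi>(1) by blast
qed

text \<open>Elements of \<open>H^1\<close> are only Lebesgue measurable, while translation and
  Tonelli's theorem are used for Borel functions.\<close>

lemma borel_representative:
  fixes f :: "'a::euclidean_space \<Rightarrow> real"
  assumes "f \<in> borel_measurable lebesgue"
  obtains f' where "f' \<in> borel_measurable borel" "AE x in lebesgue. f x = f' x"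
proof -
  obtain f' where f': "f' \<in> borel_measurable lborel" "AE x in lborel. f x = f' x"
    using completion_ex_borel_measurable_real[OF assms] by blast
  then show ?thesis using that[of f'] AE_completion[OF f'(2)] by simp
qed

lemma integral_lebesgue_lborel:
  fixes f :: "'a::euclidean_space \<Rightarrow> real"
  assumes "f \<in> borel_measurable lebesgue" "f' \<in> borel_measurable borel" "AE x in lebesgue. f x = f' x"
  shows "(LINT x|lebesgue. f x) = (LINT x|lborel. f' x)"
    and "integrable lebesgue f \<longleftrightarrow> integrable lborel f'"
proof -
  have m: "f' \<in> borel_measurable lebesgue" using assms(2) by (intro measurable_completion) auto
  show "(LINT x|lebesgue. f x) = (LINT x|lborel. f' x)"
    using integral_cong_AE[OF assms(1) m assms(3)] integral_completion[of f' lborel] assms(2) by simp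
  show "integrable lebesgue f \<longleftrightarrow> integrable lborel f'"
    using integrable_cong_AE[OF assms(1) m assms(3)] integrable_completion[of f' lborel] assms(2) by simp
qed

text \<open>The classical fact that \<open>H^1\<close> and \<open>H^1_0\<close> coincide on the
  whole space. The proof passes to Borel representatives of \<open>u\<close> and of each component
  of \<open>g\<close>, and back.\<close>

lemma approximable_whole_space:
  fixes u :: "'a::euclidean_space \<Rightarrow> real"
  assumes H: "has_H1_gradient UNIV u g"
  shows "approximable UNIV u g"
proof -
  have uL: "u \<in> L2 UNIV" and gL: "g \<in> L2 UNIV" and
    weak: "\<And>\<phi> b. \<phi> \<in> test_functions UNIV \<Longrightarrow> b \<in> Basis \<Longrightarrow>
      (LINT x|lebesgue. u x * (grad \<phi> x \<bullet> b)) = - (LINT x|lebesgue. (g x \<bullet> b) * \<phi> x)"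
    using H by (auto simp: has_H1_gradient_def lebesgue_on_UNIV_eq)
  have um [measurable]: "u \<in> borel_measurable lebesgue" and gm [measurable]: "g \<in> borel_measurable lebesgue"
    using uL gL by (auto simp: L2_def lebesgue_on_UNIV_eq)
  obtain u' where u' [measurable]: "u' \<in> borel_measurable borel" and uu': "AE x in lebesgue. u x = u' x"
    using borel_representative[OF um] .
  have "\<exists>f'. f' \<in> borel_measurable borel \<and> (AE x in lebesgue. g x \<bullet> b = f' x)" for b
  proof -
    have "(\<lambda>x. g x \<bullet> b) \<in> borel_measurable lebesgue" by measurable
    then show ?thesis by (rule borel_representative) blast
  qed
  then obtain G where G: "\<And>b. G b \<in> borel_measurable borel" and gG: "\<And>b. AE x in lebesgue. g x \<bullet> b = G b x"
    by metis
  note [measurable] = G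
  have bm [measurable (raw)]: "f \<in> borel_measurable lebesgue" if "f \<in> borel_measurable borel" for f :: "'a \<Rightarrow> real"
    using that by (intro measurable_completion) auto
  have u2: "integrable lborel (\<lambda>x. (u' x)\<^sup>2)"
    using L2_integrable[OF uL] uu'
    by (subst integral_lebesgue_lborel(2)[symmetric, of "\<lambda>x. (u x)\<^sup>2"]) (auto simp: lebesgue_on_UNIV_eq)
  have G2: "integrable lborel (\<lambda>x. (G b x)\<^sup>2)" for b
    using L2_integrable[OF L2_inner_const[OF gL]] gG[of b]
    by (subst integral_lebesgue_lborel(2)[symmetric, of "\<lambda>x. (g x \<bullet> b)\<^sup>2"]) (auto simp: lebesgue_on_UNIV_eq)
  have weak': "(LINT x|lborel. u' x * (grad \<phi> x \<bullet> b)) = - (LINT x|lborel. G b x * \<phi> x)"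
    if \<phi>: "\<phi> \<in> test_functions UNIV" and b: "b \<in> Basis" for \<phi> b
  proof -
    have [measurable]: "\<phi> \<in> borel_measurable borel" "(\<lambda>x. grad \<phi> x \<bullet> b) \<in> borel_measurable borel"
      using \<phi> test_grad_inner[OF \<phi>, of b] by measurable
    have "(LINT x|lebesgue. u x * (grad \<phi> x \<bullet> b)) = (LINT x|lborel. u' x * (grad \<phi> x \<bullet> b))"
      using uu' by (intro integral_lebesgue_lborel) auto
    moreover have "(LINT x|lebesgue. (g x \<bullet> b) * \<phi> x) = (LINT x|lborel. G b x * \<phi> x)"
      using gG[of b] by (intro integral_lebesgue_lborel) auto
    ultimately show ?thesis using weak[OF \<phi> b] by simp
  qed
  have "\<exists>\<phi>\<in>test_functions UNIV. (LINT x|lebesgue. (u x - \<phi> x)\<^sup>2 + (norm (g x - grad \<phi> x))\<^sup>2) < e" if e0: "e > 0" for e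
  proof -
    obtain \<phi> where \<phi>: "\<phi> \<in> test_functions UNIV"
      "(LINT x|lborel. (u' x - \<phi> x)\<^sup>2 + (\<Sum>b\<in>Basis. (G b x - grad \<phi> x \<bullet> b)\<^sup>2)) < e"
      using whole_space_approximates[OF u' G u2 G2 weak' e0] by blast
    have [measurable]: "\<phi> \<in> borel_measurable borel" "\<And>b. (\<lambda>x. grad \<phi> x \<bullet> b) \<in> borel_measurable borel"
      "grad \<phi> \<in> borel_measurable borel"
      using \<phi>(1) test_grad_inner[OF \<phi>(1)]
      by (auto intro!: borel_measurable_continuous_onI continuous_on_grad dest: test_measurable)
    have "(norm (g x - grad \<phi> x))\<^sup>2 = (\<Sum>b\<in>Basis. (g x \<bullet> b - grad \<phi> x \<bullet> b)\<^sup>2)" for x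
      unfolding power2_norm_eq_inner euclidean_inner[of "g x - grad \<phi> x" "g x - grad \<phi> x"]
      by (simp add: inner_diff_left power2_eq_square)
    moreover have "AE x in lebesgue. \<forall>b\<in>Basis. g x \<bullet> b = G b x"
      using gG by (intro AE_finite_allI) auto
    then have "(LINT x|lebesgue. (u x - \<phi> x)\<^sup>2 + (\<Sum>b\<in>Basis. (g x \<bullet> b - grad \<phi> x \<bullet> b)\<^sup>2)) =
        (LINT x|lborel. (u' x - \<phi> x)\<^sup>2 + (\<Sum>b\<in>Basis. (G b x - grad \<phi> x \<bullet> b)\<^sup>2))"
      using uu' by (intro integral_lebesgue_lborel) auto
    ultimately have "(LINT x|lebesgue. (u x - \<phi> x)\<^sup>2 + (norm (g x - grad \<phi> x))\<^sup>2) < e"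
      using \<phi>(2) by simp
    with \<phi>(1) show ?thesis by blast
  qed
  then have "\<forall>k. \<exists>\<phi>. \<phi> \<in> test_functions UNIV \<and>
      (LINT x|lebesgue. (u x - \<phi> x)\<^sup>2 + (norm (g x - grad \<phi> x))\<^sup>2) < inverse (real (Suc k))"
    by (simp add: Bex_def)
  from choice[OF this] obtain \<phi> where \<phi>: "\<And>k. \<phi> k \<in> test_functions UNIV"
    "\<And>k. (LINT x|lebesgue. (u x - \<phi> k x)\<^sup>2 + (norm (g x - grad (\<phi> k) x))\<^sup>2) < inverse (real (Suc k))"
    by blast
  have "(\<lambda>k. LINT x|lebesgue. (u x - \<phi> k x)\<^sup>2 + (norm (g x - grad (\<phi> k) x))\<^sup>2) \<longlonglongrightarrow> 0"
  proof (rule real_tendsto_sandwich[OF _ _ tendsto_const LIMSEQ_inverse_real_of_nat])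
    show "\<forall>\<^sub>F k in sequentially. (LINT x|lebesgue. (u x - \<phi> k x)\<^sup>2 + (norm (g x - grad (\<phi> k) x))\<^sup>2) \<le> inverse (real (Suc k))"
      using \<phi>(2) by (intro always_eventually) (auto intro: less_imp_le)
  qed auto
  then show ?thesis using uL gL \<phi>(1) by (auto simp: approximable_def lebesgue_on_UNIV_eq)
qed

section \<open>Functions with vanishing gradient\<close>

text \<open>At points of the small ball a mollification of radius at most \<open>r\<close> sees only
  the doubled ball, so its gradient vanishes there and it is constant on the small ball. Thus
  \<open>Q\<close> is an \<open>L^2\<close> limit of constants on that ball, and its mean is the
  constant sought.\<close>

lemma zero_gradient_locally_const:
  fixes Q :: "'a::euclidean_space \<Rightarrow> real"
  assumes meas: "Q \<in> borel_measurable (lebesgue_on \<Omega>)" and \<Omega>: "\<Omega> \<in> sets lebesgue"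
    and bdd: "\<And>x. \<bar>Q x\<bar> \<le> C"
    and weak: "\<And>\<phi> b. \<phi> \<in> test_functions \<Omega> \<Longrightarrow> b \<in> Basis \<Longrightarrow> (LINT x|lebesgue_on \<Omega>. Q x * (grad \<phi> x \<bullet> b)) = 0"
    and r: "r > 0" "ball x0 (2 * r) \<subseteq> \<Omega>"
  shows "\<exists>c. AE x in lebesgue. x \<in> ball x0 r \<longrightarrow> Q x = c"
proof -
  let ?D = "ball x0 (2 * r)" and ?B = "ball x0 r"
  have bm [measurable (raw)]: "f \<in> borel_measurable lebesgue" if "f \<in> borel_measurable borel" for f :: "'a \<Rightarrow> real"
    using that by (intro measurable_completion) auto
  \<comment> \<open>Cutting off makes the function integrable on the whole space; its weak gradient
    still vanishes against test functions supported in the doubled ball.\<close>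
  define W where "W x = indicator ?D x * Q x" for x
  have "(\<lambda>x. indicator \<Omega> x *\<^sub>R Q x) \<in> borel_measurable lebesgue"
    using meas \<Omega> by (subst (asm) borel_measurable_restrict_space_iff) auto
  moreover have "W = (\<lambda>x. indicator ?D x * (indicator \<Omega> x *\<^sub>R Q x))"
    using r(2) by (auto simp: W_def fun_eq_iff split: split_indicator)
  moreover have "(indicator ?D :: 'a \<Rightarrow> real) \<in> borel_measurable lebesgue" by (intro borel_measurable_indicator) auto
  ultimately have Wm [measurable]: "W \<in> borel_measurable lebesgue"
    by (simp only: borel_measurable_times)
  obtain w where w [measurable]: "w \<in> borel_measurable borel" and Ww: "AE x in lebesgue. W x = w x"
    using borel_representative[OF Wm] .
  have iD: "integrable lebesgue (\<lambda>x. C * indicator ?D x)" "integrable lebesgue (\<lambda>x. C\<^sup>2 * indicator ?D x)"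
    using emeasure_lborel_ball_finite[of x0 "2 * r"]
    by (auto intro!: integrable_mult_right integrable_real_indicator simp: less_top)
  have "C \<ge> 0" using bdd[of x0] by simp
  have "integrable lebesgue W"
    by (rule Bochner_Integration.integrable_bound[OF iD(1)]) (use bdd \<open>C \<ge> 0\<close> in \<open>auto simp: W_def indicator_def\<close>)
  then have w1: "integrable lborel w" using integral_lebesgue_lborel(2)[OF Wm w Ww] by simp
  have "integrable lebesgue (\<lambda>x. (W x)\<^sup>2)"
  proof (rule Bochner_Integration.integrable_bound[OF iD(2)])
    have "(Q x)\<^sup>2 \<le> C\<^sup>2" for x using power_mono[OF bdd[of x] abs_ge_zero, of 2] by simp
    then show "AE x in lebesgue. norm ((W x)\<^sup>2) \<le> norm (C\<^sup>2 * indicator ?D x)"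
      by (auto simp: W_def indicator_def)
  qed measurable
  then have w2: "integrable lborel (\<lambda>x. (w x)\<^sup>2)"
    using Ww by (subst integral_lebesgue_lborel(2)[symmetric, of "\<lambda>x. (W x)\<^sup>2"]) auto
  have weak': "(LINT x|lborel. w x * (grad \<phi> x \<bullet> b)) = 0" if \<phi>: "\<phi> \<in> test_functions ?D" and b: "b \<in> Basis" for \<phi> b
  proof -
    have [measurable]: "(\<lambda>x. grad \<phi> x \<bullet> b) \<in> borel_measurable borel"
      using test_grad_inner[OF \<phi>, of b] by measurable
    have z: "grad \<phi> x = 0" if "x \<notin> ?D" for x
    proof (rule grad_zero_outside)
      show "x \<notin> supp \<phi>" using \<phi> that unfolding test_functions_iff by blast
    qed
    have "(LINT x|lborel. w x * (grad \<phi> x \<bullet> b)) = (LINT x|lebesgue. W x * (grad \<phi> x \<bullet> b))"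
      using Ww by (intro integral_lebesgue_lborel(1)[symmetric]) auto
    also have "\<dots> = (LINT x|lebesgue. indicator \<Omega> x *\<^sub>R (Q x * (grad \<phi> x \<bullet> b)))"
    proof (rule Bochner_Integration.integral_cong[OF refl])
      fix x
      show "W x * (grad \<phi> x \<bullet> b) = indicator \<Omega> x *\<^sub>R (Q x * (grad \<phi> x \<bullet> b))"
      proof (cases "x \<in> ?D")
        case True
        then have "x \<in> \<Omega>" using r(2) by blast
        with True show ?thesis by (simp add: W_def)
      next
        case False
        then show ?thesis using z[of x] by simp
      qed
    qed
    also have "\<dots> = (LINT x|lebesgue_on \<Omega>. Q x * (grad \<phi> x \<bullet> b))"
      using \<Omega> by (simp add: integral_restrict_space)
    also have "\<dots> = 0" by (rule weak[OF test_mono[OF r(2) \<phi>] b])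
    finally show ?thesis .
  qed
  have const: "\<exists>c. (LINT x|lborel. indicator ?B x * (w x - c)\<^sup>2) \<le> e" if "e > 0" for e
  proof -
    obtain d where d: "d > 0" "\<And>y. norm y < d \<Longrightarrow> (LINT x|lborel. (w (x - y) - w x)\<^sup>2) < e"
      using L2_translation_uniform[OF w w2 \<open>e > 0\<close>] by blast
    \<comment> \<open>The bound by \<open>r\<close> keeps the reflected kernel inside the doubled
      ball for every centre in the small one.\<close>
    define d' where "d' = min d r"
    have d': "d' > 0" "d' \<le> r" "\<And>y. norm y < d' \<Longrightarrow> (LINT x|lborel. (w (x - y) - w x)\<^sup>2) < e"
      using d r by (auto simp: d'_def)
    obtain \<rho> :: "'a \<Rightarrow> real" where \<rho>: "\<rho> \<in> test_functions UNIV"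
      "\<And>x. \<rho> x \<ge> 0" "\<And>x. norm x \<ge> d' \<Longrightarrow> \<rho> x = 0" "(LINT x|lborel. \<rho> x) = 1" "integrable lborel \<rho>"
      using bump_exists[OF d'(1)] by metis
    note err = conv_L2_error[where d = d', OF w1 w2 \<rho>(1,2,4,5,3) d'(3) \<open>e > 0\<close>]
    have "\<exists>c. \<forall>x\<in>?B. conv w \<rho> x = c"
    proof (rule has_derivative_zero_constant)
      fix x assume x: "x \<in> ?B"
      have "conv w (\<lambda>z. grad \<rho> z \<bullet> b) x = 0" if b: "b \<in> Basis" for b
      proof -
        have "cball x d' \<subseteq> ?D"
        proof
          fix y assume "y \<in> cball x d'"
          then show "y \<in> ?D" using x d'(2) dist_triangle[of x0 y x] by (simp add: dist_commute)
        qed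
        then have t: "(\<lambda>y. \<rho> (x - y)) \<in> test_functions ?D"
          using \<rho> by (intro test_reflect[of \<rho> d']) auto
        have "conv w (\<lambda>z. grad \<rho> z \<bullet> b) x = - (LINT y|lborel. w y * (grad (\<lambda>y. \<rho> (x - y)) y \<bullet> b))"
          using \<rho>(1) by (simp add: conv_def grad_reflect test_smooth)
        then show ?thesis using weak'[OF t b] by simp
      qed
      then have "grad (conv w \<rho>) x \<bullet> b = 0 \<bullet> b" if "b \<in> Basis" for b
        using that by (simp add: conv_grad_inner[OF w1 \<rho>(1)])
      then have "grad (conv w \<rho>) x = 0"
        by (rule euclidean_eqI)
      then show "(conv w \<rho> has_derivative (\<lambda>h. 0)) (at x within ?B)"
        using has_derivative_at_withinI[OF smooth_has_derivative[OF conv_smooth[OF w1 \<rho>(1)], of x], of ?B]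
        by simp
    qed auto
    then obtain c where c: "\<And>x. x \<in> ?B \<Longrightarrow> conv w \<rho> x = c" by blast
    have "(LINT x|lborel. indicator ?B x * (w x - c)\<^sup>2) \<le> (LINT x|lborel. (conv w \<rho> x - w x)\<^sup>2)"
      using err(1) c by (intro integral_mono') (auto simp: indicator_def power2_commute)
    with err(2) show ?thesis by (intro exI[of _ c]) simp
  qed
  define N where "N = measure lborel ?B"
  have "N > 0" using r content_ball_pos[of r x0] by (simp add: N_def measure_def)
  define m where "m = (LINT x|lborel. indicator ?B x * w x) / N"
  have i0: "integrable lborel (indicator ?B :: 'a \<Rightarrow> real)"
    using emeasure_lborel_ball_finite[of x0 r] by (intro integrable_real_indicator) auto
  have N: "(LINT x|lborel. indicator ?B x) = N" by (simp add: N_def)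
  have i1: "integrable lborel (\<lambda>x. indicator ?B x * w x)"
    using integrable_mult_indicator[OF _ w1, of ?B] by simp
  have i2: "integrable lborel (\<lambda>x. indicator ?B x * (w x)\<^sup>2)"
    using integrable_mult_indicator[OF _ w2, of ?B] by simp
  \<comment> \<open>This quadratic polynomial in \<open>c\<close> exceeds its value at the mean
    \<open>m\<close> by \<open>N * (m - c)^2\<close>, so \<open>m\<close> is at least as good as
    every constant found above.\<close>
  have exp: "(LINT x|lborel. indicator ?B x * (w x - c)\<^sup>2) =
      (LINT x|lborel. indicator ?B x * (w x)\<^sup>2) - 2 * c * (N * m) + c\<^sup>2 * N" for c
  proof -
    have "(LINT x|lborel. indicator ?B x * (w x - c)\<^sup>2) =
        (LINT x|lborel. indicator ?B x * (w x)\<^sup>2 - 2 * c * (indicator ?B x * w x) + c\<^sup>2 * indicator ?B x)"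
      by (intro Bochner_Integration.integral_cong) (auto simp: power2_eq_square algebra_simps)
    also have "\<dots> = (LINT x|lborel. indicator ?B x * (w x)\<^sup>2) - 2 * c * (N * m) + c\<^sup>2 * N"
      using i0 i1 i2 \<open>N > 0\<close> N by (simp add: m_def)
    finally show ?thesis .
  qed
  have im: "integrable lborel (\<lambda>x. indicator ?B x * (w x - m)\<^sup>2)"
  proof -
    have "(\<lambda>x. indicator ?B x * (w x - m)\<^sup>2) =
        (\<lambda>x. indicator ?B x * (w x)\<^sup>2 - 2 * m * (indicator ?B x * w x) + m\<^sup>2 * indicator ?B x)"
      by (auto simp: power2_eq_square algebra_simps)
    then show ?thesis using i0 i1 i2 by simp
  qed
  have "(LINT x|lborel. indicator ?B x * (w x - m)\<^sup>2) \<le> e" if e0: "e > 0" for e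
  proof -
    obtain c where c: "(LINT x|lborel. indicator ?B x * (w x - c)\<^sup>2) \<le> e" using const[OF e0] by blast
    have "0 \<le> N * (m - c)\<^sup>2" using \<open>N > 0\<close> by simp
    with c show ?thesis unfolding exp by (simp add: power2_eq_square algebra_simps)
  qed
  then have "(LINT x|lborel. indicator ?B x * (w x - m)\<^sup>2) \<le> 0" by (rule field_le_epsilon) simp
  moreover have "(LINT x|lborel. indicator ?B x * (w x - m)\<^sup>2) \<ge> 0" by (intro Bochner_Integration.integral_nonneg) simp
  ultimately have "AE x in lborel. indicator ?B x * (w x - m)\<^sup>2 = 0"
    using integral_nonneg_eq_0_iff_AE[OF im] by simp
  from AE_completion[OF this] Ww have "AE x in lebesgue. x \<in> ?B \<longrightarrow> Q x = m"
  proof eventually_elim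
    case (elim x)
    show ?case
    proof
      assume "x \<in> ?B"
      moreover from this have "x \<in> ?D" using r by simp
      ultimately show "Q x = m" using elim by (simp add: W_def)
    qed
  qed
  then show ?thesis by blast
qed

text \<open>The local constants agree where two balls overlap, because a nonempty open set is not
  negligible. So the local constant is a locally constant function of the centre, hence constant on
  a connected set.\<close>

lemma zero_gradient_const:
  fixes Q :: "'a::euclidean_space \<Rightarrow> real"
  assumes meas: "Q \<in> borel_measurable (lebesgue_on \<Omega>)" and \<Omega>: "domain \<Omega>"
    and bdd: "\<And>x. \<bar>Q x\<bar> \<le> C"
    and weak: "\<And>\<phi> b. \<phi> \<in> test_functions \<Omega> \<Longrightarrow> b \<in> Basis \<Longrightarrow> (LINT x|lebesgue_on \<Omega>. Q x * (grad \<phi> x \<bullet> b)) = 0"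
  obtains c where "AE x in lebesgue_on \<Omega>. Q x = c"
proof -
  have op: "open \<Omega>" and con: "connected \<Omega>" and ne: "\<Omega> \<noteq> {}" using \<Omega> by (auto simp: domain_def)
  then have \<Omega>m: "\<Omega> \<in> sets lebesgue" by auto
  have "\<forall>x\<in>\<Omega>. \<exists>r>0. ball x r \<subseteq> \<Omega> \<and> (\<exists>c. AE y in lebesgue. y \<in> ball x r \<longrightarrow> Q y = c)"
  proof
    fix x assume "x \<in> \<Omega>"
    then obtain e where "e > 0" "ball x e \<subseteq> \<Omega>" using op openE by blast
    then show "\<exists>r>0. ball x r \<subseteq> \<Omega> \<and> (\<exists>c. AE y in lebesgue. y \<in> ball x r \<longrightarrow> Q y = c)"
      using zero_gradient_locally_const[OF meas \<Omega>m bdd weak, of "e / 2" x] subset_ball[of "e / 2" e x]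
      by (intro exI[of _ "e / 2"]) auto
  qed
  then obtain r where r: "\<And>x. x \<in> \<Omega> \<Longrightarrow> r x > 0 \<and> ball x (r x) \<subseteq> \<Omega> \<and> (\<exists>c. AE y in lebesgue. y \<in> ball x (r x) \<longrightarrow> Q y = c)"
    by metis
  then obtain c where c: "\<And>x. x \<in> \<Omega> \<Longrightarrow> AE y in lebesgue. y \<in> ball x (r x) \<longrightarrow> Q y = c x"
    by metis
  have "c constant_on \<Omega>"
  proof (rule locally_constant_imp_constant[OF con])
    fix x assume x: "x \<in> \<Omega>"
    have "c y = c x" if y: "y \<in> ball x (r x)" for y
    proof (rule ccontr)
      assume ne: "c y \<noteq> c x"
      have "y \<in> \<Omega>" using y r[OF x] by blast
      let ?I = "ball x (r x) \<inter> ball y (r y)"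
      have "AE z in lebesgue. z \<notin> ?I"
        using c[OF x] c[OF \<open>y \<in> \<Omega>\<close>] by eventually_elim (use ne in auto)
      then have "?I \<in> null_sets lebesgue"
        by (simp add: completion.null_sets_iff_AE)
      then have "negligible ?I" by (simp add: negligible_iff_null_sets)
      moreover have "y \<in> ?I" using y r[OF \<open>y \<in> \<Omega>\<close>] by simp
      ultimately show False using open_not_negligible[of ?I] by blast
    qed
    then have "\<forall>y\<in>ball x (r x). c y = c x" by blast
    moreover have "openin (top_of_set \<Omega>) (ball x (r x))" "x \<in> ball x (r x)"
      using r[OF x] by (auto intro: open_subset)
    ultimately show "\<exists>T. openin (top_of_set \<Omega>) T \<and> x \<in> T \<and> (\<forall>y\<in>T. c y = c x)"
      by blast
  qed
  then obtain k where k: "\<And>x. x \<in> \<Omega> \<Longrightarrow> c x = k" by (auto simp: constant_on_def)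
  \<comment> \<open>Each ball has its own exceptional null set and there are uncountably many balls;
    a set that is locally negligible is nevertheless negligible.\<close>
  let ?S = "{x \<in> \<Omega>. Q x \<noteq> k}"
  have "negligible ?S"
    unfolding locally_negligible_alt[of ?S]
  proof
    fix x assume "x \<in> ?S"
    then have x: "x \<in> \<Omega>" by simp
    have "AE z in lebesgue. z \<notin> ?S \<inter> ball x (r x)"
      using c[OF x] by eventually_elim (use k[OF x] in auto)
    then have "negligible (?S \<inter> ball x (r x))"
      by (simp add: negligible_iff_null_sets completion.null_sets_iff_AE)
    then show "\<exists>U. openin (top_of_set ?S) U \<and> x \<in> U \<and> negligible U"
      using r[OF x] \<open>x \<in> ?S\<close> by (intro exI[of _ "?S \<inter> ball x (r x)"]) (auto intro!: openin_open_Int)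
  qed
  then have "AE x in lebesgue. x \<notin> ?S"
    by (simp add: negligible_iff_null_sets completion.null_sets_iff_AE)
  then have "AE x in lebesgue_on \<Omega>. Q x = k"
    using \<Omega>m by (subst AE_restrict_space_iff) (auto elim!: AE_mp)
  then show ?thesis by (rule that)
qed

section \<open>Matrices with one positive eigenvalue\<close>

lemma symmetric_inner_swap:
  fixes A :: "real^'n^'n"
  assumes "transpose A = A"
  shows "x \<bullet> (A *v y) = y \<bullet> (A *v x)"
  by (metis assms dot_lmul_matrix inner_commute transpose_matrix_vector)

text \<open>Let \<open>e\<close> be an eigenvector of a positive eigenvalue. If the form were
  positive somewhere on the orthogonal complement of \<open>e\<close>, its maximum on the unit
  sphere there would be attained at a further eigenvector with positive eigenvalue, and two positive
  eigenvalues would be counted.\<close>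

lemma nonpositive_on_orthogonal_complement:
  fixes A :: "real^'n^'n"
  assumes sym: "transpose A = A" and one: "num_positive_eigenvalues A = 1"
  obtains e where "\<And>x. x \<bullet> e = 0 \<Longrightarrow> x \<bullet> (A *v x) \<le> 0"
proof -
  let ?P = "{\<mu> \<in> eigenvalues A. \<mu> > 0}"
  \<comment> \<open>A sum over an infinite set is 0 by convention, so the value 1 already gives
    finiteness; likewise it excludes the empty set.\<close>
  have fin: "finite ?P" using one unfolding num_positive_eigenvalues_def
    by (metis (no_types, lifting) sum.infinite zero_neq_one)
  have "?P \<noteq> {}" using one unfolding num_positive_eigenvalues_def by (metis sum.empty zero_neq_one)
  then obtain \<mu> where \<mu>: "\<mu> \<in> eigenvalues A" "\<mu> > 0" by blast
  then obtain e where e: "A *v e = \<mu> *\<^sub>R e" "e \<noteq> 0" by (auto simp: eigenvalues_def eigenspace_def)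
  have "x \<bullet> (A *v x) \<le> 0" if xe: "x \<bullet> e = 0" for x
  proof (rule ccontr)
    assume "\<not> x \<bullet> (A *v x) \<le> 0"
    then have pos: "x \<bullet> (A *v x) > 0" by simp
    then have "x \<noteq> 0" by auto
    let ?K = "{x. x \<bullet> e = 0} \<inter> sphere 0 1"
    have "compact ?K"
      by (intro closed_Int_compact) (auto intro!: closed_Collect_eq continuous_intros)
    moreover have K: "(1 / norm y) *\<^sub>R y \<in> ?K" if "y \<bullet> e = 0" "y \<noteq> 0" for y using that by auto
    then have "?K \<noteq> {}" using xe \<open>x \<noteq> 0\<close> by blast
    moreover have "continuous_on ?K (\<lambda>x. x \<bullet> (A *v x))"
      by (intro continuous_intros linear_continuous_on_compose[of _ id "(*v) A", unfolded id_def o_def])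
         (auto intro!: continuous_intros)
    ultimately obtain x0 where x0: "x0 \<in> ?K" "\<And>y. y \<in> ?K \<Longrightarrow> y \<bullet> (A *v y) \<le> x0 \<bullet> (A *v x0)"
      using continuous_attains_sup[of ?K "\<lambda>x. x \<bullet> (A *v x)"] by blast
    define \<nu> where "\<nu> = x0 \<bullet> (A *v x0)"
    have max: "y \<bullet> (A *v y) \<le> \<nu> * (y \<bullet> y)" if "y \<bullet> e = 0" for y
    proof (cases "y = 0")
      case False
      have "((1 / norm y) *\<^sub>R y) \<bullet> (A *v ((1 / norm y) *\<^sub>R y)) \<le> \<nu>"
        unfolding \<nu>_def using K[OF that False] by (rule x0(2))
      then have "(y \<bullet> (A *v y)) / (norm y * norm y) \<le> \<nu>" by (simp add: matrix_vector_mult_scaleR)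
      then have "y \<bullet> (A *v y) \<le> \<nu> * (norm y * norm y)" using False by (simp add: divide_le_eq)
      then show ?thesis by (simp add: power2_eq_square[symmetric] power2_norm_eq_inner)
    qed simp
    have "\<nu> > 0" using max[OF xe] pos \<open>x \<noteq> 0\<close>
      by (metis inner_gt_zero_iff less_le_trans zero_less_mult_pos2)
    have n0: "x0 \<bullet> x0 = 1" "x0 \<bullet> e = 0" "x0 \<noteq> 0" using x0(1) by (auto simp: norm_eq_1)
    \<comment> \<open>The first-order condition at the maximum \<open>x0\<close>, obtained by
      comparing it with \<open>x0 + t *\<^sub>R y\<close>.\<close>
    have stat: "y \<bullet> (A *v x0 - \<nu> *\<^sub>R x0) = 0" if "y \<bullet> e = 0" for y
    proof -
      define s where "s = y \<bullet> (A *v x0 - \<nu> *\<^sub>R x0)"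
      define q where "q = \<nu> * (y \<bullet> y) - y \<bullet> (A *v y)"
      have le: "2 * t * s \<le> t\<^sup>2 * q" for t
      proof -
        have "(x0 + t *\<^sub>R y) \<bullet> (A *v (x0 + t *\<^sub>R y)) \<le> \<nu> * ((x0 + t *\<^sub>R y) \<bullet> (x0 + t *\<^sub>R y))"
          using that n0 by (intro max) (simp add: inner_add_left)
        then show ?thesis
          using symmetric_inner_swap[OF sym, of x0 y] n0
          by (simp add: matrix_vector_mult_scaleR matrix_vector_right_distrib inner_add_left inner_add_right
              inner_diff_right s_def q_def \<nu>_def[symmetric] power2_eq_square inner_commute[of x0 y] algebra_simps)
      qed
      have "q \<ge> 0" using max[OF that] by (simp add: q_def)
      \<comment> \<open>A choice of \<open>t\<close> for which the linear term beats the quadratic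
        one; the summand 1 keeps the denominator positive when \<open>q = 0\<close>.\<close>
      have "2 * (s / (q + 1)) * s \<le> (s / (q + 1))\<^sup>2 * q" by (rule le)
      also have "\<dots> \<le> (s / (q + 1))\<^sup>2 * (q + 1)" by (intro mult_left_mono) auto
      also have "\<dots> = s * s / (q + 1)" using \<open>q \<ge> 0\<close> by (simp add: power2_eq_square)
      finally have "s * s / (q + 1) \<le> 0" by simp
      then have "s * s \<le> 0" using \<open>q \<ge> 0\<close> by (simp add: divide_le_0_iff)
      then show ?thesis unfolding s_def[symmetric] mult_le_0_iff by linarith
    qed
    \<comment> \<open>By symmetry the residual is itself orthogonal to \<open>e\<close>, so it may
      be used as the direction \<open>y\<close> in the first-order condition and must
      vanish.\<close>
    have "e \<bullet> (A *v x0 - \<nu> *\<^sub>R x0) = 0"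
      using symmetric_inner_swap[OF sym, of e x0] e(1) n0 by (simp add: inner_diff_right inner_commute)
    moreover have "(A *v x0 - \<nu> *\<^sub>R x0) \<bullet> e = 0" using calculation by (simp add: inner_commute)
    ultimately have "A *v x0 - \<nu> *\<^sub>R x0 = 0" using stat[of "A *v x0 - \<nu> *\<^sub>R x0"] by simp
    then have ev: "x0 \<in> eigenspace A \<nu>" by (simp add: eigenspace_def)
    then have \<nu>: "\<nu> \<in> ?P" using \<open>\<nu> > 0\<close> n0 by (auto simp: eigenvalues_def)
    have sub: "subspace (eigenspace A \<kappa>)" for \<kappa>
      by (auto simp: subspace_def eigenspace_def matrix_vector_right_distrib matrix_vector_mult_scaleR algebra_simps)
    have dim1: "dim (eigenspace A \<kappa>) \<ge> 1" if \<kappa>: "\<kappa> \<in> ?P" for \<kappa>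
    proof -
      obtain v where v: "v \<in> eigenspace A \<kappa>" "v \<noteq> 0" using \<kappa> unfolding eigenvalues_def by blast
      then have "\<not> eigenspace A \<kappa> \<subseteq> {0}" by auto
      then have "dim (eigenspace A \<kappa>) \<noteq> 0" unfolding dim_eq_0 .
      then show ?thesis by linarith
    qed
    have e_in: "e \<in> eigenspace A \<mu>" using e by (simp add: eigenspace_def)
    \<comment> \<open>Either one eigenspace contains the orthogonal vectors \<open>e\<close> and
      \<open>x0\<close>, or two different positive eigenvalues contribute at least 1 each.\<close>
    have "num_positive_eigenvalues A \<ge> 2"
    proof (cases "\<nu> = \<mu>")
      case True
      have "card {e, x0} \<le> dim (eigenspace A \<mu>)"
      proof (rule independent_card_le_dim)
        show "{e, x0} \<subseteq> eigenspace A \<mu>" using e_in ev True by simp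
        have "pairwise orthogonal {e, x0}" using n0 by (auto simp: pairwise_def orthogonal_def inner_commute)
        then show "independent {e, x0}" using e(2) n0 by (intro pairwise_orthogonal_independent) auto
      qed
      moreover have "e \<noteq> x0" using n0 e(2) by auto
      ultimately have "dim (eigenspace A \<mu>) \<ge> 2" by simp
      also have "dim (eigenspace A \<mu>) \<le> num_positive_eigenvalues A"
        unfolding num_positive_eigenvalues_def using \<mu> fin by (intro member_le_sum) auto
      finally show ?thesis .
    next
      case False
      have "(\<Sum>\<kappa>\<in>{\<mu>, \<nu>}. 1) \<le> (\<Sum>\<kappa>\<in>{\<mu>, \<nu>}. dim (eigenspace A \<kappa>))"
        using dim1 \<mu> \<nu> by (intro sum_mono) blast
      also have "\<dots> \<le> num_positive_eigenvalues A"
        unfolding num_positive_eigenvalues_def using \<mu> \<nu> fin by (intro sum_mono2) auto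
      finally show ?thesis using False by simp
    qed
    then show False using one by simp
  qed
  then show ?thesis by (rule that)
qed

text \<open>The form is positive at \<open>y\<close>, so \<open>y\<close> is not orthogonal to
  \<open>e\<close> and a multiple of it can be subtracted from \<open>x\<close> to reach the
  orthogonal complement, where the form is non-positive. This multiple need not minimize the
  quadratic in \<open>t\<close>, but the discrepancy \<open>(b - t * c)^2\<close> has the favourable
  sign.\<close>

lemma reverse_Cauchy_Schwarz:
  fixes A :: "real^'n^'n"
  assumes sym: "transpose A = A" and one: "num_positive_eigenvalues A = 1"
    and y: "y \<bullet> (A *v y) > 0"
  shows "(x \<bullet> (A *v x)) * (y \<bullet> (A *v y)) \<le> (x \<bullet> (A *v y))\<^sup>2"
proof -
  obtain e where e: "\<And>x. x \<bullet> e = 0 \<Longrightarrow> x \<bullet> (A *v x) \<le> 0"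
    using nonpositive_on_orthogonal_complement[OF sym one] by blast
  have "y \<bullet> e \<noteq> 0" using e[of y] y by auto
  define t where "t = (x \<bullet> e) / (y \<bullet> e)"
  define a b c where "a = x \<bullet> (A *v x)" and "b = x \<bullet> (A *v y)" and "c = y \<bullet> (A *v y)"
  have "(x - t *\<^sub>R y) \<bullet> (A *v (x - t *\<^sub>R y)) \<le> 0"
    using \<open>y \<bullet> e \<noteq> 0\<close> by (intro e) (simp add: t_def inner_diff_left)
  then have "a - 2 * t * b + t\<^sup>2 * c \<le> 0"
    using symmetric_inner_swap[OF sym, of x y]
    by (simp add: matrix_vector_mult_scaleR matrix_vector_mult_diff_distrib inner_diff_left inner_diff_right
        a_def b_def c_def power2_eq_square algebra_simps)
  then have "c * (a - 2 * t * b + t\<^sup>2 * c) \<le> 0"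
    using y by (intro mult_nonneg_nonpos) (auto simp: c_def)
  moreover have "0 \<le> (b - t * c)\<^sup>2" by simp
  ultimately have "a * c \<le> b\<^sup>2" by (simp add: power2_eq_square algebra_simps)
  then show ?thesis by (simp add: a_def b_def c_def)
qed

text \<open>\<open>p\<close> maximizes the quadratic form of \<open>A\<close> on the standard simplex.\<close>

lemma maximal_weight_exists:
  fixes A :: "real^'n^'n"
  assumes sym: "transpose A = A" and one: "num_positive_eigenvalues A = 1"
    and nonneg: "\<And>i j. A $ i $ j \<ge> 0" and row: "\<And>i. (\<Sum>j\<in>UNIV. A $ i $ j) > 0"
  obtains p :: "real^'n" where "\<And>i. p $ i \<ge> 0" "(\<Sum>i\<in>UNIV. p $ i) = 1"
    "\<And>w :: real^'n. (\<And>i. w $ i \<ge> 0) \<Longrightarrow> w \<bullet> (A *v w) \<le> (\<Sum>j\<in>UNIV. w $ j) * (p \<bullet> (A *v w))"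
proof -
  define K where "K = {p::real^'n. (\<forall>i. 0 \<le> p $ i) \<and> (\<Sum>i\<in>UNIV. p $ i) = 1}"
  have "closed K" unfolding K_def
    by (intro closed_Collect_conj closed_Collect_all closed_Collect_le closed_Collect_eq continuous_intros)
  moreover have "bounded K"
  proof (rule boundedI[of _ 1])
    fix p assume "p \<in> K"
    then have "(\<Sum>i\<in>UNIV. \<bar>p $ i\<bar>) = 1" by (auto simp: K_def)
    then show "norm p \<le> 1" using norm_le_l1_cart[of p] by simp
  qed
  ultimately have "compact K" by (simp add: compact_eq_bounded_closed)
  \<comment> \<open>The uniform weights witness that the maximum is positive: their value is a
    positive multiple of the sum of all row sums.\<close>
  define q :: "real^'n" where "q = (\<chi> i. 1 / CARD('n))"
  have "q \<in> K" by (simp add: K_def q_def)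
  have "A *v q = (\<chi> i. (\<Sum>j\<in>UNIV. A $ i $ j) / CARD('n))"
    by (simp add: matrix_vector_mult_def q_def sum_divide_distrib)
  then have qpos: "q \<bullet> (A *v q) > 0"
    using row by (auto simp: inner_vec_def q_def intro!: sum_pos)
  have "continuous_on K (\<lambda>x. x \<bullet> (A *v x))"
    by (intro continuous_intros linear_continuous_on_compose[of _ id "(*v) A", unfolded id_def o_def])
       (auto intro!: continuous_intros)
  then obtain p where p: "p \<in> K" "\<And>x. x \<in> K \<Longrightarrow> x \<bullet> (A *v x) \<le> p \<bullet> (A *v p)"
    using continuous_attains_sup[OF \<open>compact K\<close>, of "\<lambda>x. x \<bullet> (A *v x)"] \<open>q \<in> K\<close> by blast
  define m where "m = p \<bullet> (A *v p)"
  have m: "m > 0" using qpos p(2)[OF \<open>q \<in> K\<close>] by (simp add: m_def)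
  show ?thesis
  proof (rule that[of p])
    fix w :: "real^'n" assume w: "\<And>i. w $ i \<ge> 0"
    define s where "s = (\<Sum>j\<in>UNIV. w $ j)"
    define a where "a = w \<bullet> (A *v w)"
    define b where "b = p \<bullet> (A *v w)"
    have s: "s \<ge> 0" unfolding s_def using w by (intro sum_nonneg)
    have b: "b \<ge> 0" unfolding b_def inner_vec_def matrix_vector_mult_def
      using w nonneg p(1) by (auto simp: K_def intro!: sum_nonneg mult_nonneg_nonneg)
    \<comment> \<open>Maximality of \<open>p\<close>, extended from the simplex to all non-negative
      vectors by homogeneity of degree 2.\<close>
    have "a \<le> s\<^sup>2 * m"
    proof (cases "s = 0")
      case True
      then have "w = 0" using w sum_nonneg_eq_0_iff[of UNIV "\<lambda>j. w $ j"] by (auto simp: s_def vec_eq_iff)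
      then show ?thesis using m by (simp add: a_def)
    next
      case False
      have "(1 / s) *\<^sub>R w \<in> K"
        using w s False by (simp add: K_def sum_divide_distrib[symmetric] s_def[symmetric])
      from p(2)[OF this] have "a / s\<^sup>2 \<le> m"
        by (simp add: matrix_vector_mult_scaleR a_def m_def power2_eq_square)
      then show ?thesis using False by (simp add: divide_le_eq mult.commute)
    qed
    moreover have "a * m \<le> b\<^sup>2"
      using reverse_Cauchy_Schwarz[OF sym one, of p w] m symmetric_inner_swap[OF sym, of w p]
      by (simp add: a_def b_def m_def)
    \<comment> \<open>Multiplying \<open>a \<le> s^2 * m\<close> by the reverse Cauchy-Schwarz
      inequality \<open>a * m \<le> b^2\<close> cancels \<open>m\<close> and leaves a perfect square
      on each side.\<close>
    ultimately have "a \<le> s * b"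
    proof (cases "a \<ge> 0")
      case True
      assume "a \<le> s\<^sup>2 * m" "a * m \<le> b\<^sup>2"
      have "a\<^sup>2 * m \<le> s\<^sup>2 * m * (a * m)"
        using \<open>a \<le> s\<^sup>2 * m\<close> True m mult_right_mono[of a "s\<^sup>2 * m" "a * m"] by (simp add: power2_eq_square mult.assoc)
      also have "\<dots> \<le> s\<^sup>2 * m * b\<^sup>2"
        using \<open>a * m \<le> b\<^sup>2\<close> m by (intro mult_left_mono) auto
      finally have "a\<^sup>2 \<le> (s * b)\<^sup>2" using m by (simp add: power_mult_distrib algebra_simps)
      then show ?thesis using s b by (simp add: power2_le_iff_abs_le)
    qed (use s b in \<open>auto intro: order_trans[of _ 0]\<close>)
    then show "w \<bullet> (A *v w) \<le> (\<Sum>j\<in>UNIV. w $ j) * (p \<bullet> (A *v w))" by (simp add: a_def s_def b_def)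
  qed (use p(1) in \<open>auto simp: K_def\<close>)
qed

section \<open>Limits of integrals\<close>

lemma integral_mult_tendsto:
  fixes h m :: "'a \<Rightarrow> real" and s :: "nat \<Rightarrow> 'a \<Rightarrow> real"
  assumes h: "integrable M h" and [measurable]: "\<And>k. s k \<in> borel_measurable M" "m \<in> borel_measurable M"
    and b: "\<And>k x. \<bar>s k x\<bar> \<le> C" and lim: "AE x in M. (\<lambda>k. s k x) \<longlonglongrightarrow> m x"
  shows "integrable M (\<lambda>x. h x * s k x)" "integrable M (\<lambda>x. h x * m x)"
    "(\<lambda>k. LINT x|M. h x * s k x) \<longlonglongrightarrow> (LINT x|M. h x * m x)"
proof -
  have [measurable]: "h \<in> borel_measurable M" using h by auto
  have w: "integrable M (\<lambda>x. \<bar>h x\<bar> * C)" using h by simp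
  have l: "AE x in M. (\<lambda>k. h x * s k x) \<longlonglongrightarrow> h x * m x"
    using lim by eventually_elim (intro tendsto_intros)
  have d: "AE x in M. norm (h x * s k x) \<le> \<bar>h x\<bar> * C" for k
    using b by (auto simp: abs_mult intro!: mult_left_mono)
  show "integrable M (\<lambda>x. h x * s k x)"
    using h b by (intro integrable_mult_bounded[where C = C]) auto
  show "integrable M (\<lambda>x. h x * m x)"
    by (rule integrable_dominated_convergence[OF _ _ w l d]) auto
  show "(\<lambda>k. LINT x|M. h x * s k x) \<longlonglongrightarrow> (LINT x|M. h x * m x)"
    by (rule integral_dominated_convergence[OF _ _ w l d]) auto
qed

text \<open>Integrability of the limit belongs to the conclusion; this is how the finiteness of the
  integrals of \<open>f_i u_j^2\<close> is obtained.\<close>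

lemma Fatou_tendsto:
  fixes s :: "nat \<Rightarrow> 'a \<Rightarrow> real"
  assumes int: "\<And>k. integrable M (s k)" and nn: "\<And>k x. s k x \<ge> 0" and [measurable]: "f \<in> borel_measurable M"
    and lim: "AE x in M. (\<lambda>k. s k x) \<longlonglongrightarrow> f x"
    and le: "\<And>k. (LINT x|M. s k x) \<le> B k" and B: "B \<longlonglongrightarrow> b"
  shows "integrable M f" "(LINT x|M. f x) \<le> b"
proof -
  have [measurable]: "s k \<in> borel_measurable M" for k using int by auto
  have f0: "AE x in M. f x \<ge> 0"
    using lim by eventually_elim (rule LIMSEQ_le_const, use nn in auto)
  have B0: "B k \<ge> 0" for k
    using order_trans[OF _ le[of k], of 0] nn by simp
  have b0: "b \<ge> 0" using B B0 by (intro LIMSEQ_le_const[OF B]) auto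
  have "(\<integral>\<^sup>+x. ennreal (f x) \<partial>M) = (\<integral>\<^sup>+x. liminf (\<lambda>k. ennreal (s k x)) \<partial>M)"
  proof (rule nn_integral_cong_AE)
    show "AE x in M. ennreal (f x) = liminf (\<lambda>k. ennreal (s k x))"
      using lim by eventually_elim (rule lim_imp_Liminf[symmetric], auto intro: tendsto_ennrealI)
  qed
  also have "\<dots> \<le> liminf (\<lambda>k. \<integral>\<^sup>+x. ennreal (s k x) \<partial>M)"
    by (rule nn_integral_liminf) simp
  also have "\<dots> \<le> liminf (\<lambda>k. ennreal (B k))"
  proof (rule Liminf_mono, rule always_eventually, rule allI)
    fix k
    show "(\<integral>\<^sup>+x. ennreal (s k x) \<partial>M) \<le> ennreal (B k)"
      using nn le[of k] by (subst nn_integral_eq_integral[OF int]) (auto intro: ennreal_leI)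
  qed
  also have "\<dots> = ennreal b"
    by (rule lim_imp_Liminf) (use B in \<open>auto intro: tendsto_ennrealI\<close>)
  finally have *: "(\<integral>\<^sup>+x. ennreal (f x) \<partial>M) \<le> ennreal b" .
  show int': "integrable M f"
    using * f0 by (intro integrableI_nonneg) (auto simp: less_top[symmetric] top_unique)
  show "(LINT x|M. f x) \<le> b"
    using * f0 b0 by (subst (asm) nn_integral_eq_integral[OF int']) auto
qed

text \<open>Young's inequality with weight \<open>t\<close> takes the place of the integral
  Cauchy-Schwarz inequality: the fixed factor is made small by \<open>t\<close>, and then the
  vanishing factor absorbs \<open>1 / t\<close>.\<close>

lemma L2_pairing_tendsto_0:
  fixes h :: "'a::euclidean_space \<Rightarrow> 'b::euclidean_space" and d :: "nat \<Rightarrow> 'a \<Rightarrow> 'b"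
  assumes h: "h \<in> L2 \<Omega>" and d: "\<And>k. d k \<in> L2 \<Omega>"
    and lim: "(\<lambda>k. LINT x|lebesgue_on \<Omega>. (norm (d k x))\<^sup>2) \<longlonglongrightarrow> 0"
  shows "(\<lambda>k. LINT x|lebesgue_on \<Omega>. norm (h x) * norm (d k x)) \<longlonglongrightarrow> 0"
proof (rule tendstoI)
  fix e :: real assume "e > 0"
  define a where "a = (LINT x|lebesgue_on \<Omega>. (norm (h x))\<^sup>2)"
  have "a \<ge> 0" by (simp add: a_def)
  \<comment> \<open>With this weight each of the two terms of Young's inequality is eventually less
    than \<open>e\<close>, and the bound is half their sum.\<close>
  define t where "t = e / (a + 1)"
  have t: "t > 0" "t * a < e" using \<open>e > 0\<close> \<open>a \<ge> 0\<close> by (auto simp: t_def field_simps add_nonneg_pos)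
  have le: "(LINT x|lebesgue_on \<Omega>. norm (h x) * norm (d k x)) \<le>
      (t * a + (1 / t) * (LINT x|lebesgue_on \<Omega>. (norm (d k x))\<^sup>2)) / 2" for k
  proof -
    have "norm (h x) * norm (d k x) \<le> (t * (norm (h x))\<^sup>2 + (1 / t) * (norm (d k x))\<^sup>2) / 2" for x
    proof -
      have "0 \<le> (t * norm (h x) - norm (d k x))\<^sup>2 / t" using t by simp
      then show ?thesis using t by (simp add: power2_eq_square field_simps)
    qed
    then have "(LINT x|lebesgue_on \<Omega>. norm (h x) * norm (d k x)) \<le>
        (LINT x|lebesgue_on \<Omega>. (t * (norm (h x))\<^sup>2 + (1 / t) * (norm (d k x))\<^sup>2) / 2)"
      using L2_inner_integrable(2)[OF h d] L2_integrable[OF h] L2_integrable[OF d] by (intro integral_mono) auto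
    also have "\<dots> = (t * a + (1 / t) * (LINT x|lebesgue_on \<Omega>. (norm (d k x))\<^sup>2)) / 2"
      using L2_integrable[OF h] L2_integrable[OF d] by (simp add: a_def)
    finally show ?thesis .
  qed
  have "\<forall>\<^sub>F k in sequentially. (LINT x|lebesgue_on \<Omega>. (norm (d k x))\<^sup>2) < t * e"
    using order_tendstoD(2)[OF lim, of "t * e"] t \<open>e > 0\<close> by simp
  then show "\<forall>\<^sub>F k in sequentially. dist (LINT x|lebesgue_on \<Omega>. norm (h x) * norm (d k x)) 0 < e"
  proof eventually_elim
    case (elim k)
    have "(1 / t) * (LINT x|lebesgue_on \<Omega>. (norm (d k x))\<^sup>2) < e" using elim t by (simp add: field_simps)
    moreover have "(LINT x|lebesgue_on \<Omega>. norm (h x) * norm (d k x)) \<ge> 0" by simp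
    ultimately show ?case using le[of k] t(2) by (simp add: dist_real_def)
  qed
qed

lemma L2_inner_tendsto:
  fixes h u :: "'a::euclidean_space \<Rightarrow> 'b::euclidean_space" and s :: "nat \<Rightarrow> 'a \<Rightarrow> 'b"
  assumes h: "h \<in> L2 \<Omega>" and u: "u \<in> L2 \<Omega>" and s: "\<And>k. s k \<in> L2 \<Omega>"
    and lim: "(\<lambda>k. LINT x|lebesgue_on \<Omega>. (norm (u x - s k x))\<^sup>2) \<longlonglongrightarrow> 0"
  shows "(\<lambda>k. LINT x|lebesgue_on \<Omega>. h x \<bullet> s k x) \<longlonglongrightarrow> (LINT x|lebesgue_on \<Omega>. h x \<bullet> u x)"
proof -
  note d = L2_diff[OF u s]
  have "(\<lambda>k. LINT x|lebesgue_on \<Omega>. h x \<bullet> (u x - s k x)) \<longlonglongrightarrow> 0"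
  proof (rule Lim_null_comparison[OF _ L2_pairing_tendsto_0[OF h d lim]], rule always_eventually, rule allI)
    fix k
    show "norm (LINT x|lebesgue_on \<Omega>. h x \<bullet> (u x - s k x)) \<le> (LINT x|lebesgue_on \<Omega>. norm (h x) * norm (u x - s k x))"
      using L2_inner_integrable[OF h d[of k]]
      by (intro order_trans[OF integral_norm_bound integral_mono]) (auto simp: Cauchy_Schwarz_ineq2)
  qed
  then have "(\<lambda>k. (LINT x|lebesgue_on \<Omega>. h x \<bullet> u x) - (LINT x|lebesgue_on \<Omega>. h x \<bullet> (u x - s k x))) \<longlonglongrightarrow>
      (LINT x|lebesgue_on \<Omega>. h x \<bullet> u x) - 0" by (intro tendsto_intros)
  moreover have "(LINT x|lebesgue_on \<Omega>. h x \<bullet> u x) - (LINT x|lebesgue_on \<Omega>. h x \<bullet> (u x - s k x)) =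
      (LINT x|lebesgue_on \<Omega>. h x \<bullet> s k x)" for k
    using L2_inner_integrable(1)[OF h u] L2_inner_integrable(1)[OF h s] by (simp add: inner_diff_right)
  ultimately show ?thesis by simp
qed

lemma L2_norm_tendsto:
  fixes u :: "'a::euclidean_space \<Rightarrow> 'b::euclidean_space" and s :: "nat \<Rightarrow> 'a \<Rightarrow> 'b"
  assumes u: "u \<in> L2 \<Omega>" and s: "\<And>k. s k \<in> L2 \<Omega>"
    and lim: "(\<lambda>k. LINT x|lebesgue_on \<Omega>. (norm (u x - s k x))\<^sup>2) \<longlonglongrightarrow> 0"
  shows "(\<lambda>k. LINT x|lebesgue_on \<Omega>. (norm (s k x))\<^sup>2) \<longlonglongrightarrow> (LINT x|lebesgue_on \<Omega>. (norm (u x))\<^sup>2)"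
proof -
  have "(\<lambda>k. (LINT x|lebesgue_on \<Omega>. (norm (u x - s k x))\<^sup>2) + 2 * (LINT x|lebesgue_on \<Omega>. u x \<bullet> s k x) -
      (LINT x|lebesgue_on \<Omega>. (norm (u x))\<^sup>2)) \<longlonglongrightarrow>
      0 + 2 * (LINT x|lebesgue_on \<Omega>. u x \<bullet> u x) - (LINT x|lebesgue_on \<Omega>. (norm (u x))\<^sup>2)"
    by (intro tendsto_intros lim L2_inner_tendsto u s)
  moreover have "(LINT x|lebesgue_on \<Omega>. (norm (u x - s k x))\<^sup>2) =
      (LINT x|lebesgue_on \<Omega>. (norm (u x))\<^sup>2) - 2 * (LINT x|lebesgue_on \<Omega>. u x \<bullet> s k x) + (LINT x|lebesgue_on \<Omega>. (norm (s k x))\<^sup>2)" for k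
  proof -
    have "(LINT x|lebesgue_on \<Omega>. (norm (u x - s k x))\<^sup>2) =
        (LINT x|lebesgue_on \<Omega>. (norm (u x))\<^sup>2 - 2 * (u x \<bullet> s k x) + (norm (s k x))\<^sup>2)"
      by (intro Bochner_Integration.integral_cong refl)
         (simp add: power2_norm_eq_inner inner_diff_left inner_diff_right inner_commute)
    then show ?thesis
      using L2_integrable[OF u] L2_integrable[OF s] L2_inner_integrable(1)[OF u s] by simp
  qed
  ultimately show ?thesis by (simp add: power2_norm_eq_inner)
qed

text \<open>The squared error tends to 0 in \<open>L^1\<close>, hence almost everywhere along a
  subsequence, for the functions and the gradients at once. The norm limits serve for convergence of
  the energies, the pointwise ones for Fatou's lemma and dominated convergence.\<close>

lemma approximable_sequence:
  assumes "approximable \<Omega> u g" and \<Omega>: "\<Omega> \<in> sets lebesgue"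
  obtains \<phi> where "\<And>k. \<phi> k \<in> test_functions \<Omega>"
    "(\<lambda>k. LINT x|lebesgue_on \<Omega>. (norm (u x - \<phi> k x))\<^sup>2) \<longlonglongrightarrow> 0"
    "(\<lambda>k. LINT x|lebesgue_on \<Omega>. (norm (g x - grad (\<phi> k) x))\<^sup>2) \<longlonglongrightarrow> 0"
    "AE x in lebesgue_on \<Omega>. (\<lambda>k. \<phi> k x) \<longlonglongrightarrow> u x"
    "AE x in lebesgue_on \<Omega>. (\<lambda>k. grad (\<phi> k) x) \<longlonglongrightarrow> g x"
proof -
  obtain \<psi> where u: "u \<in> L2 \<Omega>" and g: "g \<in> L2 \<Omega>" and \<psi>: "\<And>k. \<psi> k \<in> test_functions \<Omega>"
    and lim: "(\<lambda>k. LINT x|lebesgue_on \<Omega>. (u x - \<psi> k x)\<^sup>2 + (norm (g x - grad (\<psi> k) x))\<^sup>2) \<longlonglongrightarrow> 0"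
    using assms(1) by (auto simp: approximable_def)
  let ?e = "\<lambda>k x. (u x - \<psi> k x)\<^sup>2 + (norm (g x - grad (\<psi> k) x))\<^sup>2"
  have i1: "integrable (lebesgue_on \<Omega>) (\<lambda>x. (u x - \<psi> k x)\<^sup>2)" for k
    using L2_integrable[OF L2_diff[OF u test_L2[OF \<psi> \<Omega>]]] by simp
  have i2: "integrable (lebesgue_on \<Omega>) (\<lambda>x. (norm (g x - grad (\<psi> k) x))\<^sup>2)" for k
    using L2_integrable[OF L2_diff[OF g grad_L2[OF \<psi> \<Omega>]]] .
  obtain r :: "nat \<Rightarrow> nat" where r: "strict_mono r" and ae: "AE x in lebesgue_on \<Omega>. (\<lambda>k. ?e (r k) x) \<longlonglongrightarrow> 0"
    using tendsto_L1_AE_subseq[of "lebesgue_on \<Omega>" ?e] i1 i2 lim by auto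
  have lim': "(\<lambda>k. LINT x|lebesgue_on \<Omega>. ?e (r k) x) \<longlonglongrightarrow> 0"
    using LIMSEQ_subseq_LIMSEQ[OF lim r] by (simp add: o_def)
  show ?thesis
  proof (rule that[of "\<lambda>k. \<psi> (r k)"])
    have i: "integrable (lebesgue_on \<Omega>) (?e k)" for k
      using i1 i2 by (rule Bochner_Integration.integrable_add)
    show "(\<lambda>k. LINT x|lebesgue_on \<Omega>. (norm (u x - \<psi> (r k) x))\<^sup>2) \<longlonglongrightarrow> 0"
    proof (rule real_tendsto_sandwich[OF _ _ tendsto_const lim'])
      show "\<forall>\<^sub>F k in sequentially. (LINT x|lebesgue_on \<Omega>. (norm (u x - \<psi> (r k) x))\<^sup>2) \<le> (LINT x|lebesgue_on \<Omega>. ?e (r k) x)"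
        by (intro always_eventually allI integral_mono' i) simp_all
    qed simp
    show "(\<lambda>k. LINT x|lebesgue_on \<Omega>. (norm (g x - grad (\<psi> (r k)) x))\<^sup>2) \<longlonglongrightarrow> 0"
    proof (rule real_tendsto_sandwich[OF _ _ tendsto_const lim'])
      show "\<forall>\<^sub>F k in sequentially. (LINT x|lebesgue_on \<Omega>. (norm (g x - grad (\<psi> (r k)) x))\<^sup>2) \<le> (LINT x|lebesgue_on \<Omega>. ?e (r k) x)"
        by (intro always_eventually allI integral_mono' i) simp_all
    qed simp
    have *: "d \<longlonglongrightarrow> c" if "(\<lambda>k. E k) \<longlonglongrightarrow> 0" "\<And>k. (norm (c - d k))\<^sup>2 \<le> E k"
      for d :: "nat \<Rightarrow> 'c::real_normed_vector" and c E
    proof -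
      have "(\<lambda>k. (norm (c - d k))\<^sup>2) \<longlonglongrightarrow> 0"
        using that by (intro real_tendsto_sandwich[OF _ _ tendsto_const that(1)] always_eventually) auto
      from tendsto_real_sqrt[OF this] have "(\<lambda>k. c - d k) \<longlonglongrightarrow> 0"
        by (simp add: tendsto_norm_zero_iff)
      from tendsto_diff[OF tendsto_const[of c] this] show ?thesis by simp
    qed
    show "AE x in lebesgue_on \<Omega>. (\<lambda>k. \<psi> (r k) x) \<longlonglongrightarrow> u x"
      using ae by eventually_elim (rule *, auto)
    show "AE x in lebesgue_on \<Omega>. (\<lambda>k. grad (\<psi> (r k)) x) \<longlonglongrightarrow> g x"
      using ae by eventually_elim (rule *, auto)
  qed (use \<psi> in auto)
qed

lemma approximable_test:
  assumes "\<phi> \<in> test_functions \<Omega>" "\<Omega> \<in> sets lebesgue"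
  shows "approximable \<Omega> \<phi> (grad \<phi>)"
  unfolding approximable_def using assms
  by (intro conjI exI[of _ "\<lambda>k. \<phi>"] test_L2 grad_L2) simp_all

lemma approximable_add:
  assumes u: "approximable \<Omega> u g" and v: "approximable \<Omega> v h" and \<Omega>: "\<Omega> \<in> sets lebesgue"
  shows "approximable \<Omega> (\<lambda>x. u x + v x) (\<lambda>x. g x + h x)"
proof -
  have L: "u \<in> L2 \<Omega>" "g \<in> L2 \<Omega>" "v \<in> L2 \<Omega>" "h \<in> L2 \<Omega>" using u v by (auto simp: approximable_def)
  obtain \<phi> where \<phi>: "\<And>k. \<phi> k \<in> test_functions \<Omega>"
    "(\<lambda>k. LINT x|lebesgue_on \<Omega>. (norm (u x - \<phi> k x))\<^sup>2) \<longlonglongrightarrow> 0"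
    "(\<lambda>k. LINT x|lebesgue_on \<Omega>. (norm (g x - grad (\<phi> k) x))\<^sup>2) \<longlonglongrightarrow> 0"
    by (rule approximable_sequence[OF u \<Omega>]) blast
  obtain \<psi> where \<psi>: "\<And>k. \<psi> k \<in> test_functions \<Omega>"
    "(\<lambda>k. LINT x|lebesgue_on \<Omega>. (norm (v x - \<psi> k x))\<^sup>2) \<longlonglongrightarrow> 0"
    "(\<lambda>k. LINT x|lebesgue_on \<Omega>. (norm (h x - grad (\<psi> k) x))\<^sup>2) \<longlonglongrightarrow> 0"
    by (rule approximable_sequence[OF v \<Omega>]) blast
  note i = L2_integrable[OF L2_diff[OF L(1) test_L2[OF \<phi>(1) \<Omega>]]] L2_integrable[OF L2_diff[OF L(2) grad_L2[OF \<phi>(1) \<Omega>]]]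
    L2_integrable[OF L2_diff[OF L(3) test_L2[OF \<psi>(1) \<Omega>]]] L2_integrable[OF L2_diff[OF L(4) grad_L2[OF \<psi>(1) \<Omega>]]]
  have sq: "(norm (a + b))\<^sup>2 \<le> 2 * (norm a)\<^sup>2 + 2 * (norm b)\<^sup>2" for a b :: "'z::real_normed_vector"
    using power_mono[OF norm_triangle_ineq[of a b] norm_ge_zero, of 2] zero_le_power2[of "norm a - norm b"]
    by (simp add: power2_eq_square algebra_simps)
  have "(\<lambda>k. LINT x|lebesgue_on \<Omega>. (u x + v x - (\<phi> k x + \<psi> k x))\<^sup>2 +
      (norm (g x + h x - grad (\<lambda>x. \<phi> k x + \<psi> k x) x))\<^sup>2) \<longlonglongrightarrow> 0"
  proof (rule real_tendsto_sandwich[OF _ _ tendsto_const])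
    show "\<forall>\<^sub>F k in sequentially. (LINT x|lebesgue_on \<Omega>. (u x + v x - (\<phi> k x + \<psi> k x))\<^sup>2 +
      (norm (g x + h x - grad (\<lambda>x. \<phi> k x + \<psi> k x) x))\<^sup>2) \<le>
      2 * (LINT x|lebesgue_on \<Omega>. (norm (u x - \<phi> k x))\<^sup>2) + 2 * (LINT x|lebesgue_on \<Omega>. (norm (v x - \<psi> k x))\<^sup>2) +
      (2 * (LINT x|lebesgue_on \<Omega>. (norm (g x - grad (\<phi> k) x))\<^sup>2) + 2 * (LINT x|lebesgue_on \<Omega>. (norm (h x - grad (\<psi> k) x))\<^sup>2))"
    proof (rule always_eventually, rule allI)
      fix k
      have "(LINT x|lebesgue_on \<Omega>. (u x + v x - (\<phi> k x + \<psi> k x))\<^sup>2 +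
          (norm (g x + h x - grad (\<lambda>x. \<phi> k x + \<psi> k x) x))\<^sup>2) \<le>
          (LINT x|lebesgue_on \<Omega>. 2 * (norm (u x - \<phi> k x))\<^sup>2 + 2 * (norm (v x - \<psi> k x))\<^sup>2 +
          (2 * (norm (g x - grad (\<phi> k) x))\<^sup>2 + 2 * (norm (h x - grad (\<psi> k) x))\<^sup>2))"
      proof (rule integral_mono')
        show "integrable (lebesgue_on \<Omega>) (\<lambda>x. 2 * (norm (u x - \<phi> k x))\<^sup>2 + 2 * (norm (v x - \<psi> k x))\<^sup>2 +
          (2 * (norm (g x - grad (\<phi> k) x))\<^sup>2 + 2 * (norm (h x - grad (\<psi> k) x))\<^sup>2))"
          by (intro Bochner_Integration.integrable_add integrable_mult_right i)
        fix x
        have e: "u x + v x - (\<phi> k x + \<psi> k x) = (u x - \<phi> k x) + (v x - \<psi> k x)"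
          "g x + h x - grad (\<lambda>x. \<phi> k x + \<psi> k x) x = (g x - grad (\<phi> k) x) + (h x - grad (\<psi> k) x)"
          using grad_add[OF test_smooth[OF \<phi>(1)] test_smooth[OF \<psi>(1)], of k k x] by auto
        show "(u x + v x - (\<phi> k x + \<psi> k x))\<^sup>2 + (norm (g x + h x - grad (\<lambda>x. \<phi> k x + \<psi> k x) x))\<^sup>2 \<le>
          2 * (norm (u x - \<phi> k x))\<^sup>2 + 2 * (norm (v x - \<psi> k x))\<^sup>2 +
          (2 * (norm (g x - grad (\<phi> k) x))\<^sup>2 + 2 * (norm (h x - grad (\<psi> k) x))\<^sup>2)"
          unfolding e
          using add_mono[OF sq[of "u x - \<phi> k x" "v x - \<psi> k x"] sq[of "g x - grad (\<phi> k) x" "h x - grad (\<psi> k) x"]]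
          by (simp only: real_norm_def power2_abs)
      qed auto
      also have "\<dots> = 2 * (LINT x|lebesgue_on \<Omega>. (norm (u x - \<phi> k x))\<^sup>2) + 2 * (LINT x|lebesgue_on \<Omega>. (norm (v x - \<psi> k x))\<^sup>2) +
        (2 * (LINT x|lebesgue_on \<Omega>. (norm (g x - grad (\<phi> k) x))\<^sup>2) + 2 * (LINT x|lebesgue_on \<Omega>. (norm (h x - grad (\<psi> k) x))\<^sup>2))"
        using i[of k] i(3,4)[of k] by (simp del: real_norm_def)
      finally show "(LINT x|lebesgue_on \<Omega>. (u x + v x - (\<phi> k x + \<psi> k x))\<^sup>2 +
        (norm (g x + h x - grad (\<lambda>x. \<phi> k x + \<psi> k x) x))\<^sup>2) \<le>
        2 * (LINT x|lebesgue_on \<Omega>. (norm (u x - \<phi> k x))\<^sup>2) + 2 * (LINT x|lebesgue_on \<Omega>. (norm (v x - \<psi> k x))\<^sup>2) +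
        (2 * (LINT x|lebesgue_on \<Omega>. (norm (g x - grad (\<phi> k) x))\<^sup>2) + 2 * (LINT x|lebesgue_on \<Omega>. (norm (h x - grad (\<psi> k) x))\<^sup>2))" .
    qed
    have "(\<lambda>k. 2 * (LINT x|lebesgue_on \<Omega>. (norm (u x - \<phi> k x))\<^sup>2) + 2 * (LINT x|lebesgue_on \<Omega>. (norm (v x - \<psi> k x))\<^sup>2) +
      (2 * (LINT x|lebesgue_on \<Omega>. (norm (g x - grad (\<phi> k) x))\<^sup>2) + 2 * (LINT x|lebesgue_on \<Omega>. (norm (h x - grad (\<psi> k) x))\<^sup>2)))
      \<longlonglongrightarrow> 2 * 0 + 2 * 0 + (2 * 0 + 2 * 0)"
      by (intro tendsto_add tendsto_mult tendsto_const \<phi>(2,3) \<psi>(2,3))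
    then show "(\<lambda>k. 2 * (LINT x|lebesgue_on \<Omega>. (norm (u x - \<phi> k x))\<^sup>2) + 2 * (LINT x|lebesgue_on \<Omega>. (norm (v x - \<psi> k x))\<^sup>2) +
      (2 * (LINT x|lebesgue_on \<Omega>. (norm (g x - grad (\<phi> k) x))\<^sup>2) + 2 * (LINT x|lebesgue_on \<Omega>. (norm (h x - grad (\<psi> k) x))\<^sup>2)))
      \<longlonglongrightarrow> 0" by simp
  qed auto
  then show ?thesis
    unfolding approximable_def using L \<phi>(1) \<psi>(1)
    by (auto intro!: L2_add exI[of _ "\<lambda>k x. \<phi> k x + \<psi> k x"] test_add)
qed

section \<open>Testing with quotients\<close>

text \<open>Test functions approximating a positive function may change sign, so
  \<open>\<psi> + \<epsilon>\<close> can vanish. The root is a smooth positive substitute for the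
  absolute value.\<close>

lemma grad_regularized_inverse:
  assumes "smooth \<psi>" "c > 0" "\<epsilon> > 0"
  shows "smooth (\<lambda>x. inverse (sqrt ((\<psi> x)\<^sup>2 + c) + \<epsilon>))"
    and "grad (\<lambda>x. inverse (sqrt ((\<psi> x)\<^sup>2 + c) + \<epsilon>)) x =
      - (\<psi> x / sqrt ((\<psi> x)\<^sup>2 + c) * (inverse (sqrt ((\<psi> x)\<^sup>2 + c) + \<epsilon>))\<^sup>2) *\<^sub>R grad \<psi> x"
proof -
  have pos: "(\<psi> x)\<^sup>2 + c > 0" "sqrt ((\<psi> x)\<^sup>2 + c) + \<epsilon> > 0" for x
    using assms by (auto simp: add_nonneg_pos)
  have "smooth (\<lambda>x. (\<psi> x)\<^sup>2 + c)" using assms by (auto simp: power2_eq_square)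
  from smooth_sqrt[OF this pos(1)] have "smooth (\<lambda>x. sqrt ((\<psi> x)\<^sup>2 + c) + \<epsilon>)" by auto
  then show "smooth (\<lambda>x. inverse (sqrt ((\<psi> x)\<^sup>2 + c) + \<epsilon>))"
    by (rule smooth_inverse) (use pos(2) in \<open>auto simp: less_imp_neq[symmetric]\<close>)
  let ?s = "sqrt ((\<psi> x)\<^sup>2 + c)"
  have s: "?s > 0" using pos(1) by simp
  have "((\<lambda>x. (\<psi> x)\<^sup>2 + c) has_derivative (\<lambda>h. 2 * \<psi> x * (grad \<psi> x \<bullet> h))) (at x)"
    by (auto intro!: derivative_eq_intros smooth_has_derivative[OF assms(1)])
  from has_derivative_add[OF has_derivative_real_sqrt[OF pos(1) this] has_derivative_const[of \<epsilon>]]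
  have "((\<lambda>x. sqrt ((\<psi> x)\<^sup>2 + c) + \<epsilon>) has_derivative (\<lambda>h. \<psi> x / ?s * (grad \<psi> x \<bullet> h))) (at x)"
    by (rule has_derivative_eq_rhs) (use s in \<open>auto simp: field_simps\<close>)
  from Deriv.has_derivative_inverse[OF less_imp_neq[OF pos(2)[of x], symmetric] this]
  have "((\<lambda>x. inverse (sqrt ((\<psi> x)\<^sup>2 + c) + \<epsilon>)) has_derivative
      (\<lambda>h. - (inverse (?s + \<epsilon>) * (\<psi> x / ?s * (grad \<psi> x \<bullet> h)) * inverse (?s + \<epsilon>)))) (at x)" .
  also have "(\<lambda>h. - (inverse (?s + \<epsilon>) * (\<psi> x / ?s * (grad \<psi> x \<bullet> h)) * inverse (?s + \<epsilon>))) =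
      (\<lambda>h. (- (\<psi> x / ?s * (inverse (?s + \<epsilon>))\<^sup>2) *\<^sub>R grad \<psi> x) \<bullet> h)"
    by (auto simp: power2_eq_square)
  finally show "grad (\<lambda>x. inverse (sqrt ((\<psi> x)\<^sup>2 + c) + \<epsilon>)) x =
      - (\<psi> x / sqrt ((\<psi> x)\<^sup>2 + c) * (inverse (sqrt ((\<psi> x)\<^sup>2 + c) + \<epsilon>))\<^sup>2) *\<^sub>R grad \<psi> x"
    by (rule grad_eqI)
qed

text \<open>The identity for test functions extends to \<open>\<phi> / (v + \<epsilon>)\<close>, the limit of the test functions
  \<open>\<phi> / (sqrt (\<psi>\<^sub>k\<^sup>2 + c\<^sub>k) + \<epsilon>)\<close> with \<open>\<psi>\<^sub>k\<close> converging to \<open>v\<close> and \<open>c\<^sub>k\<close> to 0.\<close>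

lemma test_with_quotient:
  fixes v w F :: "'a::euclidean_space \<Rightarrow> real" and G g :: "'a \<Rightarrow> 'a"
  assumes \<Omega>: "\<Omega> \<in> sets lebesgue" and v: "approximable \<Omega> v g" and pos: "AE x in lebesgue_on \<Omega>. v x > 0"
    and G: "G \<in> L2 \<Omega>" and w: "w \<in> L2 \<Omega>"
    and F: "\<And>\<eta>. \<eta> \<in> test_functions \<Omega> \<Longrightarrow> integrable (lebesgue_on \<Omega>) (\<lambda>x. F x * \<eta> x)"
    and eq: "\<And>\<eta>. \<eta> \<in> test_functions \<Omega> \<Longrightarrow>
      (LINT x|lebesgue_on \<Omega>. G x \<bullet> grad \<eta> x + w x * \<eta> x) = (LINT x|lebesgue_on \<Omega>. F x * \<eta> x)"
    and \<phi>: "\<phi> \<in> test_functions \<Omega>" and \<epsilon>: "\<epsilon> > 0"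
  shows "(LINT x|lebesgue_on \<Omega>. (G x \<bullet> grad \<phi> x + w x * \<phi> x) * inverse (\<bar>v x\<bar> + \<epsilon>) -
      G x \<bullet> g x * (\<phi> x * (inverse (\<bar>v x\<bar> + \<epsilon>))\<^sup>2)) =
    (LINT x|lebesgue_on \<Omega>. F x * \<phi> x * inverse (\<bar>v x\<bar> + \<epsilon>))"
proof -
  let ?M = "lebesgue_on \<Omega>"
  have vL: "v \<in> L2 \<Omega>" and gL: "g \<in> L2 \<Omega>" using v by (auto simp: approximable_def)
  obtain \<psi> where \<psi>: "\<And>k. \<psi> k \<in> test_functions \<Omega>"
    and lim2: "(\<lambda>k. LINT x|?M. (norm (g x - grad (\<psi> k) x))\<^sup>2) \<longlonglongrightarrow> 0"
    and aev: "AE x in ?M. (\<lambda>k. \<psi> k x) \<longlonglongrightarrow> v x"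
    by (rule approximable_sequence[OF v \<Omega>]) blast
  define c where "c k = inverse (real (Suc k))" for k
  have c: "c k > 0" for k by (simp add: c_def)
  have climit: "c \<longlonglongrightarrow> 0" unfolding c_def by (rule LIMSEQ_inverse_real_of_nat)
  define s where "s k x = sqrt ((\<psi> k x)\<^sup>2 + c k)" for k x
  define a where "a k x = inverse (s k x + \<epsilon>)" for k x
  \<comment> \<open>Up to sign the coefficient of \<open>grad (\<psi> k)\<close> in the gradient of
    \<open>a k\<close>. Since \<open>\<psi> k / s k\<close> tends to the sign of \<open>v\<close>,
    positivity gives the limit \<open>(\<alpha> x)^2\<close>.\<close>
  define t where "t k x = \<psi> k x / s k x * (a k x)\<^sup>2" for k x
  define \<alpha> where "\<alpha> x = inverse (\<bar>v x\<bar> + \<epsilon>)" for x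
  have s: "s k x > 0" "\<bar>\<psi> k x\<bar> \<le> s k x" for k x
    using c[of k] real_sqrt_le_mono[of "(\<psi> k x)\<^sup>2" "(\<psi> k x)\<^sup>2 + c k"] by (auto simp: s_def add_nonneg_pos)
  have a: "\<bar>a k x\<bar> \<le> inverse \<epsilon>" "a k x \<ge> 0" for k x
    using s(1)[of k x] \<epsilon> by (auto simp: a_def intro!: le_imp_inverse_le)
  have t: "\<bar>t k x\<bar> \<le> (inverse \<epsilon>)\<^sup>2" for k x
  proof -
    have "\<bar>\<psi> k x / s k x\<bar> \<le> 1" using s[of k x] by simp
    moreover have "(a k x)\<^sup>2 \<le> (inverse \<epsilon>)\<^sup>2" using a[of k x] by (intro power_mono) auto
    ultimately have "\<bar>\<psi> k x / s k x\<bar> * (a k x)\<^sup>2 \<le> 1 * (inverse \<epsilon>)\<^sup>2" by (intro mult_mono) auto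
    then show ?thesis by (simp add: t_def abs_mult)
  qed
  have lims: "AE x in ?M. (\<lambda>k. a k x) \<longlonglongrightarrow> \<alpha> x \<and> (\<lambda>k. t k x) \<longlonglongrightarrow> (\<alpha> x)\<^sup>2"
    using aev pos
  proof eventually_elim
    case (elim x)
    have "(\<lambda>k. s k x) \<longlonglongrightarrow> sqrt ((v x)\<^sup>2 + 0)"
      unfolding s_def by (intro tendsto_intros elim climit)
    then have sl: "(\<lambda>k. s k x) \<longlonglongrightarrow> \<bar>v x\<bar>" by simp
    have al: "(\<lambda>k. a k x) \<longlonglongrightarrow> \<alpha> x"
      unfolding a_def \<alpha>_def using \<epsilon> by (intro tendsto_intros sl) auto
    have "(\<lambda>k. t k x) \<longlonglongrightarrow> v x / \<bar>v x\<bar> * (\<alpha> x)\<^sup>2"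
      unfolding t_def using elim(2) by (intro tendsto_intros al sl elim(1)) auto
    then show ?case using al elim(2) by simp
  qed
  have [measurable]: "\<phi> \<in> borel_measurable borel" "\<psi> k \<in> borel_measurable borel" for k
    using \<phi> \<psi>[of k] by measurable
  have [measurable]: "grad \<phi> \<in> borel_measurable borel" "grad (\<psi> k) \<in> borel_measurable borel" for k
    using \<phi> \<psi>[of k] by (auto intro!: borel_measurable_continuous_onI continuous_on_grad)
  note [measurable] = L2_measurable[OF vL] L2_measurable[OF gL] L2_measurable[OF G] L2_measurable[OF w]
  have am [measurable]: "a k \<in> borel_measurable borel" for k unfolding a_def s_def by measurable
  have tm [measurable]: "t k \<in> borel_measurable borel" for k unfolding t_def s_def by measurable
  have \<alpha>m [measurable]: "\<alpha> \<in> borel_measurable ?M" unfolding \<alpha>_def by measurable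
  obtain C where C: "C > 0" "\<And>x. \<bar>\<phi> x\<bar> \<le> C" using test_bounded[OF \<phi>] by metis
  define \<eta> where "\<eta> k x = \<phi> x * a k x" for k x
  have smooth_a: "smooth (a k)" for k
    unfolding a_def s_def using \<psi>[of k] c \<epsilon> by (intro grad_regularized_inverse) auto
  have \<eta>: "\<eta> k \<in> test_functions \<Omega>" for k
    unfolding \<eta>_def by (intro test_mult \<phi> smooth_a)
  have grad\<eta>: "grad (\<eta> k) x = a k x *\<^sub>R grad \<phi> x - (\<phi> x * t k x) *\<^sub>R grad (\<psi> k) x" for k x
  proof -
    have "grad (a k) x = - t k x *\<^sub>R grad (\<psi> k) x"
      unfolding a_def s_def t_def using grad_regularized_inverse(2)[of "\<psi> k" "c k" \<epsilon> x] \<psi>[of k] c \<epsilon> by auto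
    then show ?thesis
      using grad_mult[OF test_smooth[OF \<phi>] smooth_a, of k x] by (simp add: \<eta>_def[abs_def])
  qed
  have i1: "integrable ?M (\<lambda>x. G x \<bullet> grad \<phi> x + w x * \<phi> x)"
    using L2_inner_integrable(1)[OF G grad_L2[OF \<phi> \<Omega>]] L2_inner_integrable(1)[OF w test_L2[OF \<phi> \<Omega>]] by simp
  have i2: "integrable ?M (\<lambda>x. G x \<bullet> g x)" by (rule L2_inner_integrable(1)[OF G gL])
  have bt: "\<bar>\<phi> x * t k x\<bar> \<le> C * (inverse \<epsilon>)\<^sup>2" for k x
    using C t[of k x] by (auto simp: abs_mult intro!: mult_mono)
  have i3: "integrable ?M (\<lambda>x. (G x \<bullet> (g x - grad (\<psi> k) x)) * (\<phi> x * t k x))" for k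
    using L2_inner_integrable(1)[OF G L2_diff[OF gL grad_L2[OF \<psi> \<Omega>]]] bt
    by (intro integrable_mult_bounded[where C = "C * (inverse \<epsilon>)\<^sup>2"]) auto
  note T1 = integral_mult_tendsto[OF i1, of a \<alpha> "inverse \<epsilon>", OF _ _ a(1)]
  note T2 = integral_mult_tendsto[OF i2, of "\<lambda>k x. \<phi> x * t k x" "\<lambda>x. \<phi> x * (\<alpha> x)\<^sup>2", OF _ _ bt]
  note T4 = integral_mult_tendsto[OF F[OF \<phi>], of a \<alpha> "inverse \<epsilon>", OF _ _ a(1)]
  have L1: "AE x in ?M. (\<lambda>k. a k x) \<longlonglongrightarrow> \<alpha> x" using lims by eventually_elim auto
  have L2: "AE x in ?M. (\<lambda>k. \<phi> x * t k x) \<longlonglongrightarrow> \<phi> x * (\<alpha> x)\<^sup>2"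
    using lims by eventually_elim (auto intro!: tendsto_intros)
  \<comment> \<open>The gradients of \<open>\<psi> k\<close> have no common dominating function. So
    their \<open>L^2\<close> error is split off and paired with a uniformly bounded factor, and
    dominated convergence is applied only to terms with a fixed integrable factor.\<close>
  have L3: "(\<lambda>k. LINT x|?M. (G x \<bullet> (g x - grad (\<psi> k) x)) * (\<phi> x * t k x)) \<longlonglongrightarrow> 0"
  proof (rule Lim_null_comparison)
    have d: "(\<lambda>x. g x - grad (\<psi> k) x) \<in> L2 \<Omega>" for k by (intro L2_diff gL grad_L2[OF \<psi> \<Omega>])
    have "(\<lambda>k. (LINT x|?M. norm (G x) * norm (g x - grad (\<psi> k) x)) * (C * (inverse \<epsilon>)\<^sup>2)) \<longlonglongrightarrow> 0 * (C * (inverse \<epsilon>)\<^sup>2)"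
      by (intro tendsto_intros L2_pairing_tendsto_0 G d lim2)
    then show "(\<lambda>k. (LINT x|?M. norm (G x) * norm (g x - grad (\<psi> k) x)) * (C * (inverse \<epsilon>)\<^sup>2)) \<longlonglongrightarrow> 0" by simp
    show "\<forall>\<^sub>F k in sequentially. norm (LINT x|?M. (G x \<bullet> (g x - grad (\<psi> k) x)) * (\<phi> x * t k x)) \<le>
        (LINT x|?M. norm (G x) * norm (g x - grad (\<psi> k) x)) * (C * (inverse \<epsilon>)\<^sup>2)"
    proof (rule always_eventually, rule allI)
      fix k
      have "norm (LINT x|?M. (G x \<bullet> (g x - grad (\<psi> k) x)) * (\<phi> x * t k x)) \<le>
          (LINT x|?M. norm (G x) * norm (g x - grad (\<psi> k) x) * (C * (inverse \<epsilon>)\<^sup>2))"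
      proof (rule order_trans[OF integral_norm_bound integral_mono])
        show "norm (G x \<bullet> (g x - grad (\<psi> k) x) * (\<phi> x * t k x)) \<le> norm (G x) * norm (g x - grad (\<psi> k) x) * (C * (inverse \<epsilon>)\<^sup>2)" for x
          unfolding norm_mult real_norm_def abs_mult[of "G x \<bullet> _"]
          using bt[of x k] by (intro mult_mono Cauchy_Schwarz_ineq2) (auto simp: abs_mult)
      qed (use i3 L2_inner_integrable(2)[OF G d] in auto)
      then show "norm (LINT x|?M. (G x \<bullet> (g x - grad (\<psi> k) x)) * (\<phi> x * t k x)) \<le>
        (LINT x|?M. norm (G x) * norm (g x - grad (\<psi> k) x)) * (C * (inverse \<epsilon>)\<^sup>2)" by simp
    qed
  qed
  have eq': "(LINT x|?M. (G x \<bullet> grad \<phi> x + w x * \<phi> x) * a k x) - (LINT x|?M. G x \<bullet> g x * (\<phi> x * t k x)) +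
      (LINT x|?M. (G x \<bullet> (g x - grad (\<psi> k) x)) * (\<phi> x * t k x)) = (LINT x|?M. F x * \<phi> x * a k x)" for k
  proof -
    have "(LINT x|?M. F x * \<phi> x * a k x) = (LINT x|?M. G x \<bullet> grad (\<eta> k) x + w x * \<eta> k x)"
      using eq[OF \<eta>[of k]] by (simp add: \<eta>_def mult.assoc)
    also have "\<dots> = (LINT x|?M. (G x \<bullet> grad \<phi> x + w x * \<phi> x) * a k x - G x \<bullet> g x * (\<phi> x * t k x) +
        (G x \<bullet> (g x - grad (\<psi> k) x)) * (\<phi> x * t k x))"
      by (intro Bochner_Integration.integral_cong refl)
         (simp add: grad\<eta> \<eta>_def inner_diff_right algebra_simps)
    also have "\<dots> = (LINT x|?M. (G x \<bullet> grad \<phi> x + w x * \<phi> x) * a k x) - (LINT x|?M. G x \<bullet> g x * (\<phi> x * t k x)) +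
      (LINT x|?M. (G x \<bullet> (g x - grad (\<psi> k) x)) * (\<phi> x * t k x))"
      using T1(1)[OF _ _ L1, of k] T2(1)[OF _ _ L2, of k] i3[of k] by simp
    finally show ?thesis by simp
  qed
  have "(\<lambda>k. (LINT x|?M. (G x \<bullet> grad \<phi> x + w x * \<phi> x) * a k x) - (LINT x|?M. G x \<bullet> g x * (\<phi> x * t k x)) +
      (LINT x|?M. (G x \<bullet> (g x - grad (\<psi> k) x)) * (\<phi> x * t k x))) \<longlonglongrightarrow>
      (LINT x|?M. (G x \<bullet> grad \<phi> x + w x * \<phi> x) * \<alpha> x) - (LINT x|?M. G x \<bullet> g x * (\<phi> x * (\<alpha> x)\<^sup>2)) + 0"
    by (intro tendsto_intros T1(3) T2(3) L3 L1 L2) measurable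
  moreover have "(\<lambda>k. LINT x|?M. F x * \<phi> x * a k x) \<longlonglongrightarrow> (LINT x|?M. F x * \<phi> x * \<alpha> x)"
    by (intro T4(3) L1) measurable
  ultimately have "(LINT x|?M. (G x \<bullet> grad \<phi> x + w x * \<phi> x) * \<alpha> x) - (LINT x|?M. G x \<bullet> g x * (\<phi> x * (\<alpha> x)\<^sup>2)) =
      (LINT x|?M. F x * \<phi> x * \<alpha> x)"
    unfolding eq' using LIMSEQ_unique by fastforce
  moreover have "(LINT x|?M. (G x \<bullet> grad \<phi> x + w x * \<phi> x) * \<alpha> x - G x \<bullet> g x * (\<phi> x * (\<alpha> x)\<^sup>2)) =
      (LINT x|?M. (G x \<bullet> grad \<phi> x + w x * \<phi> x) * \<alpha> x) - (LINT x|?M. G x \<bullet> g x * (\<phi> x * (\<alpha> x)\<^sup>2))"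
    by (intro Bochner_Integration.integral_diff T1(2) T2(2) L1 L2) measurable
  ultimately show ?thesis by (simp add: \<alpha>_def)
qed

section \<open>Positive solutions\<close>

text \<open>The system is read as uncoupled linear equations with the non-negative potential
  \<open>f\<close>. The same \<open>g\<close> is required to be a limit of gradients of test
  functions and a distributional gradient: limits use the first, integration by parts against
  arbitrary test functions the second.\<close>

definition linear_solution ::
  "'a::euclidean_space set \<Rightarrow> real \<Rightarrow> ('a \<Rightarrow> real) \<Rightarrow> ('a \<Rightarrow> real) \<Rightarrow> ('a \<Rightarrow> 'a) \<Rightarrow> bool" where
  "linear_solution \<Omega> lam f v g \<longleftrightarrow> approximable \<Omega> v g \<and> has_H1_gradient \<Omega> v g \<and>
      (AE x in lebesgue_on \<Omega>. v x > 0) \<and> f \<in> borel_measurable (lebesgue_on \<Omega>) \<and> (\<forall>x. f x \<ge> 0) \<and>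
      (\<forall>\<eta>\<in>test_functions \<Omega>. integrable (lebesgue_on \<Omega>) (\<lambda>x. f x * v x * \<eta> x) \<and>
        (LINT x|lebesgue_on \<Omega>. g x \<bullet> grad \<eta> x + lam * v x * \<eta> x) = (LINT x|lebesgue_on \<Omega>. f x * v x * \<eta> x))"

text \<open>The equation is tested with \<open>\<phi>^2 / (|v| + \<epsilon>)\<close>. The terms that
  this produces are exactly the cross term and the last square in the expansion of
  \<open>|grad \<phi> - \<phi> \<alpha> g|^2\<close>. The absolute value keeps the denominator at
  least \<open>\<epsilon>\<close>, and \<open>E\<close> non-negative, at every point rather than
  almost everywhere.\<close>

lemma Picone_test:
  assumes \<Omega>: "\<Omega> \<in> sets lebesgue" and lam: "lam > 0" and sol: "linear_solution \<Omega> lam f v g"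
    and \<phi>: "\<phi> \<in> test_functions \<Omega>" and \<epsilon>: "\<epsilon> > 0"
  defines "\<alpha> \<equiv> \<lambda>x. inverse (\<bar>v x\<bar> + \<epsilon>)"
  defines "E \<equiv> \<lambda>x. (norm (grad \<phi> x - (\<phi> x * \<alpha> x) *\<^sub>R g x))\<^sup>2 + f x * \<bar>v x\<bar> * \<alpha> x * (\<phi> x)\<^sup>2"
  shows "integrable (lebesgue_on \<Omega>) E"
    and "(LINT x|lebesgue_on \<Omega>. E x) \<le> (LINT x|lebesgue_on \<Omega>. (norm (grad \<phi> x))\<^sup>2) + lam * (LINT x|lebesgue_on \<Omega>. (\<phi> x)\<^sup>2)"
proof -
  let ?M = "lebesgue_on \<Omega>"
  have vg: "approximable \<Omega> v g" and pos: "AE x in ?M. v x > 0" and [measurable]: "f \<in> borel_measurable ?M"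
    and f0: "\<And>x. f x \<ge> 0" and F: "\<And>\<eta>. \<eta> \<in> test_functions \<Omega> \<Longrightarrow> integrable ?M (\<lambda>x. f x * v x * \<eta> x)"
    and eq: "\<And>\<eta>. \<eta> \<in> test_functions \<Omega> \<Longrightarrow> (LINT x|?M. g x \<bullet> grad \<eta> x + lam * v x * \<eta> x) = (LINT x|?M. f x * v x * \<eta> x)"
    using sol by (auto simp: linear_solution_def)
  have vL: "v \<in> L2 \<Omega>" and gL: "g \<in> L2 \<Omega>" using vg by (auto simp: approximable_def)
  have lvL: "(\<lambda>x. lam * v x) \<in> L2 \<Omega>" using L2_scaleR[OF vL, of lam] by simp
  note \<phi>L = test_L2[OF \<phi> \<Omega>] and g\<phi>L = grad_L2[OF \<phi> \<Omega>]
  define \<phi>2 where "\<phi>2 x = \<phi> x * \<phi> x" for x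
  have \<phi>2: "\<phi>2 \<in> test_functions \<Omega>" unfolding \<phi>2_def[abs_def] by (intro test_mult \<phi> test_smooth[OF \<phi>])
  have grad2: "grad \<phi>2 x = (2 * \<phi> x) *\<^sub>R grad \<phi> x" for x
    unfolding \<phi>2_def[abs_def] grad_mult[OF test_smooth[OF \<phi>] test_smooth[OF \<phi>]]
    by (simp add: scaleR_2 scaleR_add_left[symmetric])
  note [measurable] = L2_measurable[OF vL] L2_measurable[OF gL]
  have [measurable]: "\<phi> \<in> borel_measurable borel" using \<phi> by measurable
  have [measurable]: "grad \<phi> \<in> borel_measurable borel"
    using \<phi> by (auto intro!: borel_measurable_continuous_onI continuous_on_grad)
  have \<alpha>: "\<alpha> x > 0" "\<bar>\<alpha> x\<bar> \<le> inverse \<epsilon>" "\<bar>v x\<bar> * \<alpha> x \<le> 1" for x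
    using \<epsilon> by (auto simp: \<alpha>_def field_simps add_nonneg_pos)
  have \<alpha>m [measurable]: "\<alpha> \<in> borel_measurable ?M" unfolding \<alpha>_def by measurable
  obtain C where C: "C > 0" "\<And>x. \<bar>\<phi> x\<bar> \<le> C" using test_bounded[OF \<phi>] by metis
  have ba: "\<bar>\<phi> x * \<alpha> x\<bar> \<le> C * inverse \<epsilon>" for x
    unfolding abs_mult using C \<alpha>(2)[of x] by (intro mult_mono) auto
  have i1: "integrable ?M (\<lambda>x. (g x \<bullet> grad \<phi> x) * (\<phi> x * \<alpha> x))"
    by (rule integrable_mult_bounded[OF L2_inner_integrable(1)[OF gL g\<phi>L] _ ba]) measurable
  have i2: "integrable ?M (\<lambda>x. (norm (g x))\<^sup>2 * (\<phi> x * \<alpha> x)\<^sup>2)"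
  proof (rule integrable_mult_bounded[OF L2_integrable[OF gL]])
    show "\<bar>(\<phi> x * \<alpha> x)\<^sup>2\<bar> \<le> (C * inverse \<epsilon>)\<^sup>2" for x
      using power_mono[OF ba abs_ge_zero, of x 2] by simp
  qed measurable
  have i3: "integrable ?M (\<lambda>x. (v x * \<phi> x) * (\<phi> x * \<alpha> x))"
    by (rule integrable_mult_bounded[OF _ _ ba]) (use L2_inner_integrable(1)[OF vL \<phi>L] in auto)
  have i4: "integrable ?M (\<lambda>x. f x * v x * \<phi>2 x * \<alpha> x)"
    by (rule integrable_mult_bounded[OF F[OF \<phi>2] _ \<alpha>(2)]) measurable
  have i5: "integrable ?M (\<lambda>x. (norm (grad \<phi> x))\<^sup>2)" by (rule L2_integrable[OF g\<phi>L])
  have i6: "integrable ?M (\<lambda>x. (\<phi> x)\<^sup>2)" using L2_integrable[OF \<phi>L] by simp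
  have "(LINT x|?M. (g x \<bullet> grad \<phi>2 x + lam * v x * \<phi>2 x) * \<alpha> x - g x \<bullet> g x * (\<phi>2 x * (\<alpha> x)\<^sup>2)) =
      (LINT x|?M. f x * v x * \<phi>2 x * \<alpha> x)"
    unfolding \<alpha>_def by (rule test_with_quotient[OF \<Omega> vg pos gL lvL F eq \<phi>2 \<epsilon>])
  moreover have "(LINT x|?M. (g x \<bullet> grad \<phi>2 x + lam * v x * \<phi>2 x) * \<alpha> x - g x \<bullet> g x * (\<phi>2 x * (\<alpha> x)\<^sup>2)) =
      (LINT x|?M. 2 * ((g x \<bullet> grad \<phi> x) * (\<phi> x * \<alpha> x)) + lam * ((v x * \<phi> x) * (\<phi> x * \<alpha> x)) - (norm (g x))\<^sup>2 * (\<phi> x * \<alpha> x)\<^sup>2)"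
    by (intro Bochner_Integration.integral_cong refl)
       (simp add: grad2 \<phi>2_def power2_norm_eq_inner power2_eq_square[of "\<alpha> _"] power2_eq_square[of "\<phi> _"]
         power2_eq_square[of "\<phi> _ * \<alpha> _"] algebra_simps)
  ultimately have key: "2 * (LINT x|?M. (g x \<bullet> grad \<phi> x) * (\<phi> x * \<alpha> x)) + lam * (LINT x|?M. (v x * \<phi> x) * (\<phi> x * \<alpha> x))
      - (LINT x|?M. (norm (g x))\<^sup>2 * (\<phi> x * \<alpha> x)\<^sup>2) = (LINT x|?M. f x * v x * \<phi>2 x * \<alpha> x)"
    using i1 i2 i3 by simp
  have ae: "AE x in ?M. E x = (norm (grad \<phi> x))\<^sup>2 - 2 * ((g x \<bullet> grad \<phi> x) * (\<phi> x * \<alpha> x)) +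
      (norm (g x))\<^sup>2 * (\<phi> x * \<alpha> x)\<^sup>2 + f x * v x * \<phi>2 x * \<alpha> x"
    using pos
  proof eventually_elim
    case (elim x)
    have "(norm (grad \<phi> x - (\<phi> x * \<alpha> x) *\<^sub>R g x))\<^sup>2 = (norm (grad \<phi> x))\<^sup>2 - 2 * ((g x \<bullet> grad \<phi> x) * (\<phi> x * \<alpha> x)) +
      (norm (g x))\<^sup>2 * (\<phi> x * \<alpha> x)\<^sup>2"
      by (simp add: power2_norm_eq_inner inner_diff_left inner_diff_right inner_commute power2_eq_square[of "\<phi> x * \<alpha> x"]
          power2_eq_square[of "\<alpha> x"] power2_eq_square[of "\<phi> x"] algebra_simps)
    then show ?case using elim by (simp add: E_def \<phi>2_def power2_eq_square)
  qed
  have Em: "E \<in> borel_measurable ?M" unfolding E_def by measurable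
  have i: "integrable ?M (\<lambda>x. (norm (grad \<phi> x))\<^sup>2 - 2 * ((g x \<bullet> grad \<phi> x) * (\<phi> x * \<alpha> x)) +
      (norm (g x))\<^sup>2 * (\<phi> x * \<alpha> x)\<^sup>2 + f x * v x * \<phi>2 x * \<alpha> x)"
    using i1 i2 i4 i5 by simp
  show "integrable ?M E"
    by (rule integrable_cong_AE_imp[OF i Em]) (use ae in \<open>auto elim: AE_mp\<close>)
  have "(LINT x|?M. E x) = (LINT x|?M. (norm (grad \<phi> x))\<^sup>2 - 2 * ((g x \<bullet> grad \<phi> x) * (\<phi> x * \<alpha> x)) +
      (norm (g x))\<^sup>2 * (\<phi> x * \<alpha> x)\<^sup>2 + f x * v x * \<phi>2 x * \<alpha> x)"
    by (rule integral_cong_AE[OF Em _ ae]) (use i in auto)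
  also have "\<dots> = (LINT x|?M. (norm (grad \<phi> x))\<^sup>2) - 2 * (LINT x|?M. (g x \<bullet> grad \<phi> x) * (\<phi> x * \<alpha> x)) +
      (LINT x|?M. (norm (g x))\<^sup>2 * (\<phi> x * \<alpha> x)\<^sup>2) + (LINT x|?M. f x * v x * \<phi>2 x * \<alpha> x)"
    using i1 i2 i4 i5 by simp
  also have "\<dots> = (LINT x|?M. (norm (grad \<phi> x))\<^sup>2) + lam * (LINT x|?M. (v x * \<phi> x) * (\<phi> x * \<alpha> x))"
    using key by simp
  \<comment> \<open>Here the identity becomes an inequality, from
    \<open>v x * \<alpha> x \<le> 1\<close>.\<close>
  also have "(LINT x|?M. (v x * \<phi> x) * (\<phi> x * \<alpha> x)) \<le> (LINT x|?M. (\<phi> x)\<^sup>2)"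
  proof (rule integral_mono[OF i3 i6])
    fix x
    have "v x * \<alpha> x \<le> \<bar>v x\<bar> * \<alpha> x" using \<alpha>(1)[of x] by (intro mult_right_mono) auto
    then have "v x * \<alpha> x \<le> 1" using \<alpha>(3)[of x] by linarith
    then have "v x * \<alpha> x * (\<phi> x)\<^sup>2 \<le> 1 * (\<phi> x)\<^sup>2" by (intro mult_right_mono) auto
    then show "(v x * \<phi> x) * (\<phi> x * \<alpha> x) \<le> (\<phi> x)\<^sup>2" by (simp add: power2_eq_square algebra_simps)
  qed
  finally show "(LINT x|?M. E x) \<le> (LINT x|?M. (norm (grad \<phi> x))\<^sup>2) + lam * (LINT x|?M. (\<phi> x)\<^sup>2)"
    using lam by simp
qed

text \<open>The regularization and the approximation of \<open>z\<close> by test functions are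
  removed together, with \<open>\<epsilon> = 1 / (k + 1)\<close>. The left-hand integrand is
  non-negative and converges almost everywhere because \<open>v\<close> is positive, so Fatou's
  lemma applies; the right-hand side converges by \<open>L^2\<close> convergence.\<close>

lemma Picone:
  assumes \<Omega>: "\<Omega> \<in> sets lebesgue" and lam: "lam > 0" and sol: "linear_solution \<Omega> lam f v g"
    and z: "approximable \<Omega> z h"
  shows "integrable (lebesgue_on \<Omega>) (\<lambda>x. (norm (h x - (z x / v x) *\<^sub>R g x))\<^sup>2)"
    and "integrable (lebesgue_on \<Omega>) (\<lambda>x. f x * (z x)\<^sup>2)"
    and "(LINT x|lebesgue_on \<Omega>. (norm (h x - (z x / v x) *\<^sub>R g x))\<^sup>2) + (LINT x|lebesgue_on \<Omega>. f x * (z x)\<^sup>2) \<le>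
      (LINT x|lebesgue_on \<Omega>. (norm (h x))\<^sup>2) + lam * (LINT x|lebesgue_on \<Omega>. (z x)\<^sup>2)"
proof -
  let ?M = "lebesgue_on \<Omega>"
  have vg: "approximable \<Omega> v g" and pos: "AE x in ?M. v x > 0" and [measurable]: "f \<in> borel_measurable ?M"
    and f0: "\<And>x. f x \<ge> 0"
    using sol by (auto simp: linear_solution_def)
  have L: "v \<in> L2 \<Omega>" "g \<in> L2 \<Omega>" "z \<in> L2 \<Omega>" "h \<in> L2 \<Omega>" using vg z by (auto simp: approximable_def)
  note [measurable] = L[THEN L2_measurable]
  obtain \<phi> where \<phi>: "\<And>k. \<phi> k \<in> test_functions \<Omega>"
    "(\<lambda>k. LINT x|?M. (norm (z x - \<phi> k x))\<^sup>2) \<longlonglongrightarrow> 0"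
    "(\<lambda>k. LINT x|?M. (norm (h x - grad (\<phi> k) x))\<^sup>2) \<longlonglongrightarrow> 0"
    "AE x in ?M. (\<lambda>k. \<phi> k x) \<longlonglongrightarrow> z x"
    "AE x in ?M. (\<lambda>k. grad (\<phi> k) x) \<longlonglongrightarrow> h x"
    by (rule approximable_sequence[OF z \<Omega>]) blast
  define e where "e k = inverse (real (Suc k))" for k
  have e: "e k > 0" for k by (simp add: e_def)
  have elim0: "e \<longlonglongrightarrow> 0" unfolding e_def by (rule LIMSEQ_inverse_real_of_nat)
  define E where "E k x = (norm (grad (\<phi> k) x - (\<phi> k x * inverse (\<bar>v x\<bar> + e k)) *\<^sub>R g x))\<^sup>2 +
      f x * \<bar>v x\<bar> * inverse (\<bar>v x\<bar> + e k) * (\<phi> k x)\<^sup>2" for k x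
  define U where "U x = (norm (h x - (z x / v x) *\<^sub>R g x))\<^sup>2 + f x * (z x)\<^sup>2" for x
  have Um: "U \<in> borel_measurable ?M" unfolding U_def by measurable
  have E: "integrable ?M (E k)" "(LINT x|?M. E k x) \<le> (LINT x|?M. (norm (grad (\<phi> k) x))\<^sup>2) + lam * (LINT x|?M. (norm (\<phi> k x))\<^sup>2)" for k
    using Picone_test[OF \<Omega> lam sol \<phi>(1) e, of k k] by (simp_all add: E_def[abs_def])
  have Enn: "E k x \<ge> 0" for k x
    unfolding E_def using f0[of x] e[of k] by (intro add_nonneg_nonneg mult_nonneg_nonneg) auto
  have lim: "AE x in ?M. (\<lambda>k. E k x) \<longlonglongrightarrow> U x"
    using pos \<phi>(4,5)
  proof eventually_elim
    case (elim x)
    have a: "(\<lambda>k. inverse (\<bar>v x\<bar> + e k)) \<longlonglongrightarrow> inverse (\<bar>v x\<bar> + 0)"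
      using elim(1) by (intro tendsto_intros elim0) auto
    have "(\<lambda>k. E k x) \<longlonglongrightarrow> (norm (h x - (z x * inverse (\<bar>v x\<bar> + 0)) *\<^sub>R g x))\<^sup>2 +
        f x * \<bar>v x\<bar> * inverse (\<bar>v x\<bar> + 0) * (z x)\<^sup>2"
      unfolding E_def by (intro tendsto_intros a elim(2,3))
    moreover have e: "f x * \<bar>v x\<bar> * inverse (\<bar>v x\<bar> + 0) = f x" using elim(1) by simp
    ultimately show ?case using elim(1) unfolding e by (simp add: U_def divide_inverse)
  qed
  have B: "(\<lambda>k. (LINT x|?M. (norm (grad (\<phi> k) x))\<^sup>2) + lam * (LINT x|?M. (norm (\<phi> k x))\<^sup>2)) \<longlonglongrightarrow>
      (LINT x|?M. (norm (h x))\<^sup>2) + lam * (LINT x|?M. (norm (z x))\<^sup>2)"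
    by (intro tendsto_intros L2_norm_tendsto L \<phi>(2,3) test_L2[OF \<phi>(1) \<Omega>] grad_L2[OF \<phi>(1) \<Omega>])
  note U = Fatou_tendsto[OF E(1) Enn Um lim E(2) B]
  show 1: "integrable ?M (\<lambda>x. (norm (h x - (z x / v x) *\<^sub>R g x))\<^sup>2)"
    by (rule Bochner_Integration.integrable_bound[OF U(1)]) (use f0 in \<open>auto simp: U_def\<close>)
  show 2: "integrable ?M (\<lambda>x. f x * (z x)\<^sup>2)"
    by (rule Bochner_Integration.integrable_bound[OF U(1)]) (use f0 in \<open>auto simp: U_def\<close>)
  show "(LINT x|?M. (norm (h x - (z x / v x) *\<^sub>R g x))\<^sup>2) + (LINT x|?M. f x * (z x)\<^sup>2) \<le>
      (LINT x|?M. (norm (h x))\<^sup>2) + lam * (LINT x|?M. (z x)\<^sup>2)"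
    using U(2) 1 2 by (simp add: U_def)
qed

text \<open>The equation is tested with approximations \<open>\<phi> k\<close> of \<open>v\<close>,
  and \<open>f v \<phi>_k\<close> is bounded by \<open>(f v^2 + f \<phi>_k^2) / 2\<close>. Picone's
  inequality bounds the integral of \<open>f \<phi>_k^2\<close> by the energy of
  \<open>\<phi> k\<close>, so in the limit the energy \<open>E\<close> of \<open>v\<close> satisfies
  \<open>2 E \<le> \<integral>f v^2 + E\<close>. As \<open>E\<close> is finite, it can be
  subtracted.\<close>

lemma energy_le:
  assumes \<Omega>: "\<Omega> \<in> sets lebesgue" and lam: "lam > 0" and sol: "linear_solution \<Omega> lam f v g"
  shows "(LINT x|lebesgue_on \<Omega>. (norm (g x))\<^sup>2) + lam * (LINT x|lebesgue_on \<Omega>. (v x)\<^sup>2) \<le> (LINT x|lebesgue_on \<Omega>. f x * (v x)\<^sup>2)"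
proof -
  let ?M = "lebesgue_on \<Omega>"
  have vg: "approximable \<Omega> v g" and f0: "\<And>x. f x \<ge> 0"
    and F: "\<And>\<eta>. \<eta> \<in> test_functions \<Omega> \<Longrightarrow> integrable ?M (\<lambda>x. f x * v x * \<eta> x)"
    and eq: "\<And>\<eta>. \<eta> \<in> test_functions \<Omega> \<Longrightarrow> (LINT x|?M. g x \<bullet> grad \<eta> x + lam * v x * \<eta> x) = (LINT x|?M. f x * v x * \<eta> x)"
    using sol by (auto simp: linear_solution_def)
  have L: "v \<in> L2 \<Omega>" "g \<in> L2 \<Omega>" using vg by (auto simp: approximable_def)
  obtain \<phi> where \<phi>: "\<And>k. \<phi> k \<in> test_functions \<Omega>"
    "(\<lambda>k. LINT x|?M. (norm (v x - \<phi> k x))\<^sup>2) \<longlonglongrightarrow> 0"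
    "(\<lambda>k. LINT x|?M. (norm (g x - grad (\<phi> k) x))\<^sup>2) \<longlonglongrightarrow> 0"
    by (rule approximable_sequence[OF vg \<Omega>]) blast
  note T = test_L2[OF \<phi>(1) \<Omega>] grad_L2[OF \<phi>(1) \<Omega>]
  have lim1: "(\<lambda>k. (LINT x|?M. g x \<bullet> grad (\<phi> k) x) + lam * (LINT x|?M. v x \<bullet> \<phi> k x)) \<longlonglongrightarrow>
      (LINT x|?M. g x \<bullet> g x) + lam * (LINT x|?M. v x \<bullet> v x)"
    by (intro tendsto_intros L2_inner_tendsto L T \<phi>(2,3))
  have lim2: "(\<lambda>k. ((LINT x|?M. f x * (v x)\<^sup>2) + ((LINT x|?M. (norm (grad (\<phi> k) x))\<^sup>2) + lam * (LINT x|?M. (norm (\<phi> k x))\<^sup>2))) / 2) \<longlonglongrightarrow>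
      ((LINT x|?M. f x * (v x)\<^sup>2) + ((LINT x|?M. (norm (g x))\<^sup>2) + lam * (LINT x|?M. (norm (v x))\<^sup>2))) / 2"
    by (intro tendsto_intros L2_norm_tendsto L T \<phi>(2,3)) simp
  have "(LINT x|?M. g x \<bullet> grad (\<phi> k) x) + lam * (LINT x|?M. v x \<bullet> \<phi> k x) \<le>
      ((LINT x|?M. f x * (v x)\<^sup>2) + ((LINT x|?M. (norm (grad (\<phi> k) x))\<^sup>2) + lam * (LINT x|?M. (norm (\<phi> k x))\<^sup>2))) / 2" for k
  proof -
    note P = Picone[OF \<Omega> lam sol approximable_test[OF \<phi>(1) \<Omega>], of k] and Pv = Picone(2)[OF \<Omega> lam sol vg]
    have "(LINT x|?M. g x \<bullet> grad (\<phi> k) x) + lam * (LINT x|?M. v x \<bullet> \<phi> k x) = (LINT x|?M. g x \<bullet> grad (\<phi> k) x + lam * v x * \<phi> k x)"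
      using L2_inner_integrable(1)[OF L(2) T(2)[of k]] L2_inner_integrable(1)[OF L(1) T(1)[of k]]
      by (simp add: mult.assoc)
    also have "\<dots> = (LINT x|?M. f x * v x * \<phi> k x)" by (rule eq[OF \<phi>(1)])
    also have "\<dots> \<le> (LINT x|?M. (f x * (v x)\<^sup>2 + f x * (\<phi> k x)\<^sup>2) / 2)"
    proof (rule integral_mono)
      show "f x * v x * \<phi> k x \<le> (f x * (v x)\<^sup>2 + f x * (\<phi> k x)\<^sup>2) / 2" for x
        using mult_nonneg_nonneg[OF f0[of x] zero_le_power2[of "v x - \<phi> k x"]]
        by (simp add: power2_eq_square algebra_simps)
    qed (use F[OF \<phi>(1)] P(2) Pv in auto)
    also have "\<dots> = ((LINT x|?M. f x * (v x)\<^sup>2) + (LINT x|?M. f x * (\<phi> k x)\<^sup>2)) / 2"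
      using P(2) Pv by simp
    also have "(LINT x|?M. f x * (\<phi> k x)\<^sup>2) \<le> (LINT x|?M. (norm (grad (\<phi> k) x))\<^sup>2) + lam * (LINT x|?M. (norm (\<phi> k x))\<^sup>2)"
    proof -
      have "(LINT x|?M. (norm (grad (\<phi> k) x - (\<phi> k x / v x) *\<^sub>R g x))\<^sup>2) \<ge> 0" by simp
      then show ?thesis unfolding real_norm_def power2_abs using P(3) by linarith
    qed
    finally show ?thesis by simp
  qed
  then have "(LINT x|?M. g x \<bullet> g x) + lam * (LINT x|?M. v x \<bullet> v x) \<le>
      ((LINT x|?M. f x * (v x)\<^sup>2) + ((LINT x|?M. (norm (g x))\<^sup>2) + lam * (LINT x|?M. (norm (v x))\<^sup>2))) / 2"
    by (intro LIMSEQ_le[OF lim1 lim2]) auto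
  then show ?thesis unfolding power2_norm_eq_inner[symmetric] by simp
qed

text \<open>Picone's inequality with \<open>z = \<phi>\<close> shows that
  \<open>grad \<phi> - (\<phi> / v) g\<close> is square integrable, hence so is
  \<open>(\<phi> / v) g\<close>. Compact support turns this into integrability, by
  \<open>s \<le> 2 s^2 + 1/2\<close>.\<close>

lemma log_gradient_integrable:
  assumes \<Omega>: "\<Omega> \<in> sets lebesgue" and lam: "lam > 0" and sol: "linear_solution \<Omega> lam f v g"
    and \<phi>: "\<phi> \<in> test_functions \<Omega>"
  shows "integrable (lebesgue_on \<Omega>) (\<lambda>x. norm ((\<phi> x / v x) *\<^sub>R g x))"
proof -
  let ?M = "lebesgue_on \<Omega>"
  have vg: "approximable \<Omega> v g" using sol by (auto simp: linear_solution_def)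
  have L: "v \<in> L2 \<Omega>" "g \<in> L2 \<Omega>" using vg by (auto simp: approximable_def)
  note [measurable] = L[THEN L2_measurable]
  have [measurable]: "\<phi> \<in> borel_measurable borel" using \<phi> by measurable
  have [measurable]: "grad \<phi> \<in> borel_measurable borel"
    using \<phi> by (auto intro!: borel_measurable_continuous_onI continuous_on_grad)
  have K: "compact (supp \<phi>)" using \<phi> by (simp add: test_functions_iff)
  then have iK: "integrable ?M (indicator (supp \<phi>) :: 'a \<Rightarrow> real)"
    using emeasure_compact_finite[OF K] by (intro integrable_lebesgue_on \<Omega> integrable_real_indicator) (auto simp: compact_imp_closed)
  have i: "integrable ?M (\<lambda>x. 2 * (norm (grad \<phi> x))\<^sup>2 + 2 * (norm (grad \<phi> x - (\<phi> x / v x) *\<^sub>R g x))\<^sup>2 + indicator (supp \<phi>) x)"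
    using L2_integrable[OF grad_L2[OF \<phi> \<Omega>]] Picone(1)[OF \<Omega> lam sol approximable_test[OF \<phi> \<Omega>]] iK
    by (intro Bochner_Integration.integrable_add integrable_mult_right)
  show ?thesis
  proof (rule Bochner_Integration.integrable_bound[OF i])
    have "norm ((\<phi> x / v x) *\<^sub>R g x) \<le> 2 * (norm (grad \<phi> x))\<^sup>2 + 2 * (norm (grad \<phi> x - (\<phi> x / v x) *\<^sub>R g x))\<^sup>2 + indicator (supp \<phi>) x" for x
    proof (cases "x \<in> supp \<phi>")
      case True
      define a b where "a = norm (grad \<phi> x)" and "b = norm (grad \<phi> x - (\<phi> x / v x) *\<^sub>R g x)"
      have "norm ((\<phi> x / v x) *\<^sub>R g x) \<le> a + b"
        using norm_triangle_ineq4[of "grad \<phi> x" "grad \<phi> x - (\<phi> x / v x) *\<^sub>R g x"] by (simp add: a_def b_def)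
      also have "\<dots> \<le> 2 * a\<^sup>2 + 2 * b\<^sup>2 + 1"
      proof -
        have "s \<le> 2 * s\<^sup>2 + 1/2" for s :: real
          using zero_le_power2[of "2 * s - 1/2"] by (simp add: power2_eq_square algebra_simps)
        from this[of a] this[of b] show ?thesis by linarith
      qed
      finally show ?thesis using True by (simp add: a_def b_def)
    next
      case False
      then have "\<phi> x = 0" by (rule test_zero_outside)
      then show ?thesis by simp
    qed
    then show "AE x in ?M. norm (norm ((\<phi> x / v x) *\<^sub>R g x)) \<le>
        norm (2 * (norm (grad \<phi> x))\<^sup>2 + 2 * (norm (grad \<phi> x - (\<phi> x / v x) *\<^sub>R g x))\<^sup>2 + indicator (supp \<phi>) x)"
      unfolding real_norm_def abs_norm_cancel by (intro AE_I2 order_trans[OF _ abs_ge_self])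
  qed measurable
qed

section \<open>Proportionality from parallel logarithmic gradients\<close>

lemma AE_domain_witness:
  assumes \<Omega>: "domain \<Omega>" and "AE x in lebesgue_on \<Omega>. P x"
  obtains x where "P x"
proof (rule ccontr)
  assume "\<not> thesis"
  then have P: "\<not> P x" for x using that by blast
  have op: "open \<Omega>" "\<Omega> \<noteq> {}" using \<Omega> by (auto simp: domain_def)
  with assms(2) P have "AE x in lebesgue. x \<notin> \<Omega>"
    by (subst (asm) AE_restrict_space_iff) auto
  then have "negligible \<Omega>" using op by (simp add: negligible_iff_null_sets completion.null_sets_iff_AE)
  then show False using open_not_negligible[OF op] by blast
qed

text \<open>Formally the gradient of \<open>z / (z + v)\<close> is
  \<open>(v h - z g) / (z + v)^2\<close>, which vanishes by the hypothesis on the gradients. This is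
  made rigorous by testing the distributional gradient of \<open>z\<close> with
  \<open>\<phi> / (z + v + \<epsilon>)\<close>; integrability of \<open>(\<phi> / z) h\<close>
  provides the dominating function as \<open>\<epsilon>\<close> tends to 0.\<close>

lemma proportional_of_gradients:
  fixes z v :: "'a::euclidean_space \<Rightarrow> real"
  assumes \<Omega>: "domain \<Omega>" and lam: "lam > 0"
    and v: "linear_solution \<Omega> lam f1 v g" and z: "linear_solution \<Omega> lam f2 z h"
    and par: "AE x in lebesgue_on \<Omega>. h x = (z x / v x) *\<^sub>R g x"
  obtains c where "AE x in lebesgue_on \<Omega>. z x = c * v x"
proof -
  let ?M = "lebesgue_on \<Omega>"
  have \<Omega>m: "\<Omega> \<in> sets lebesgue" using \<Omega> by (auto simp: domain_def)
  have va: "approximable \<Omega> v g" and vpos: "AE x in ?M. v x > 0" using v by (auto simp: linear_solution_def)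
  have za: "approximable \<Omega> z h" and zpos: "AE x in ?M. z x > 0" and zH: "has_H1_gradient \<Omega> z h"
    using z by (auto simp: linear_solution_def)
  have L: "v \<in> L2 \<Omega>" "g \<in> L2 \<Omega>" "z \<in> L2 \<Omega>" "h \<in> L2 \<Omega>" using va za by (auto simp: approximable_def)
  note [measurable] = L[THEN L2_measurable]
  define V where "V x = z x + v x" for x
  have Va: "approximable \<Omega> V (\<lambda>x. h x + g x)"
    unfolding V_def[abs_def] by (rule approximable_add[OF za va \<Omega>m])
  have Vpos: "AE x in ?M. V x > 0" using vpos zpos by eventually_elim (simp add: V_def)
  have Vm [measurable]: "V \<in> borel_measurable ?M" unfolding V_def by measurable
  \<comment> \<open>The clamp changes the quotient only on a null set and makes the bound hold at
    every point.\<close>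
  define Q where "Q x = max 0 (min 1 (z x / V x))" for x
  have Qm [measurable]: "Q \<in> borel_measurable ?M" unfolding Q_def by measurable
  have Qae: "AE x in ?M. Q x = z x / V x"
    using vpos zpos by eventually_elim (auto simp: Q_def V_def max_def min_def divide_le_eq)
  have weak: "(LINT x|?M. Q x * (grad \<phi> x \<bullet> b)) = 0" if \<phi>: "\<phi> \<in> test_functions \<Omega>" and b: "b \<in> Basis" for \<phi> b
  proof -
    have [measurable]: "\<phi> \<in> borel_measurable borel" "(\<lambda>x. grad \<phi> x \<bullet> b) \<in> borel_measurable borel"
      using \<phi> test_grad_inner[OF \<phi>, of b] by measurable
    define e where "e k = inverse (real (Suc k))" for k
    have e: "e k > 0" for k by (simp add: e_def)
    have elim0: "e \<longlonglongrightarrow> 0" unfolding e_def by (rule LIMSEQ_inverse_real_of_nat)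
    define \<alpha> where "\<alpha> k x = inverse (\<bar>V x\<bar> + e k)" for k x
    have \<alpha>m [measurable]: "\<alpha> k \<in> borel_measurable ?M" for k unfolding \<alpha>_def by measurable
    \<comment> \<open>Integration by parts in the direction \<open>b\<close>, read as an equation
      with field \<open>z b\<close>, zeroth-order term \<open>h \<bullet> b\<close> and right-hand
      side 0, so that the quotient lemma applies.\<close>
    have zero: "(LINT x|?M. (z x *\<^sub>R b) \<bullet> grad \<eta> x + (h x \<bullet> b) * \<eta> x) = (LINT x|?M. 0 * \<eta> x)"
      if \<eta>: "\<eta> \<in> test_functions \<Omega>" for \<eta>
    proof -
      have "(LINT x|?M. z x * (grad \<eta> x \<bullet> b)) = - (LINT x|?M. (h x \<bullet> b) * \<eta> x)"
        using zH \<eta> b by (auto simp: has_H1_gradient_def)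
      moreover have "integrable ?M (\<lambda>x. z x * (grad \<eta> x \<bullet> b))" "integrable ?M (\<lambda>x. (h x \<bullet> b) * \<eta> x)"
        using L2_inner_integrable(1)[OF L(3) L2_inner_const[OF grad_L2[OF \<eta> \<Omega>m]], of b]
          L2_inner_integrable(1)[OF L2_inner_const[OF L(4)] test_L2[OF \<eta> \<Omega>m], of b] by simp_all
      ultimately show ?thesis by (simp add: inner_commute)
    qed
    define s where "s k x = ((z x *\<^sub>R b) \<bullet> grad \<phi> x + (h x \<bullet> b) * \<phi> x) * \<alpha> k x -
        (z x *\<^sub>R b) \<bullet> (h x + g x) * (\<phi> x * (\<alpha> k x)\<^sup>2)" for k x
    have s0: "(LINT x|?M. s k x) = 0" for k
    proof -
      have "(LINT x|?M. s k x) = (LINT x|?M. 0 * \<phi> x * inverse (\<bar>V x\<bar> + e k))"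
        unfolding s_def \<alpha>_def
        by (rule test_with_quotient[OF \<Omega>m Va Vpos L2_scaleR_const[OF L(3)] L2_inner_const[OF L(4)] _ zero \<phi> e]) auto
      then show ?thesis by simp
    qed
    \<comment> \<open>The relation \<open>v h = z g\<close> cancels the gradient terms except for
      the part proportional to \<open>e k\<close>, which comes from the regularized
      denominator.\<close>
    have seq: "AE x in ?M. \<forall>k. s k x = z x * \<alpha> k x * (grad \<phi> x \<bullet> b) + e k * (\<alpha> k x)\<^sup>2 * (\<phi> x * (h x \<bullet> b))"
      using vpos zpos par
    proof eventually_elim
      case (elim x)
      show ?case
      proof
        fix k
        have "V x > 0" using elim by (simp add: V_def)
        then have A: "\<alpha> k x * (V x + e k) = 1" using e[of k] by (simp add: \<alpha>_def)
        have vh: "v x * (h x \<bullet> b) = z x * (g x \<bullet> b)" using elim by simp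
        have "(h x \<bullet> b) * \<phi> x * \<alpha> k x = (h x \<bullet> b) * \<phi> x * \<alpha> k x * (\<alpha> k x * (V x + e k))"
          unfolding A by simp
        also have "\<dots> = \<phi> x * (\<alpha> k x)\<^sup>2 * (z x * (h x \<bullet> b) + v x * (h x \<bullet> b) + e k * (h x \<bullet> b))"
          by (simp add: V_def power2_eq_square algebra_simps)
        finally have *: "(h x \<bullet> b) * \<phi> x * \<alpha> k x = \<phi> x * (\<alpha> k x)\<^sup>2 * (z x * (h x \<bullet> b) + z x * (g x \<bullet> b) + e k * (h x \<bullet> b))"
          unfolding vh .
        show "s k x = z x * \<alpha> k x * (grad \<phi> x \<bullet> b) + e k * (\<alpha> k x)\<^sup>2 * (\<phi> x * (h x \<bullet> b))"
          unfolding s_def distrib_right[of _ _ "\<alpha> k x"] *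
          by (simp add: inner_add_right inner_commute[of b] algebra_simps)
      qed
    qed
    \<comment> \<open>The second summand dominates the regularization error:
      \<open>e k * \<alpha> k x \<le> 1\<close>, and the remaining factor
      \<open>\<alpha> k x\<close> is at most \<open>1 / z x\<close>.\<close>
    let ?w = "\<lambda>x. \<bar>grad \<phi> x \<bullet> b\<bar> + norm ((\<phi> x / z x) *\<^sub>R h x)"
    have iw: "integrable ?M ?w"
      using integrable_lebesgue_on[OF test_integrable[OF test_grad_inner[OF \<phi>, of b]] \<Omega>m]
        log_gradient_integrable[OF \<Omega>m lam z \<phi>] by simp
    have "(\<lambda>k. LINT x|?M. s k x) \<longlonglongrightarrow> (LINT x|?M. Q x * (grad \<phi> x \<bullet> b))"
    proof (rule integral_dominated_convergence[where w = ?w])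
      have "(\<lambda>x. grad \<phi> x) \<in> borel_measurable borel"
        using \<phi> by (auto intro!: borel_measurable_continuous_onI continuous_on_grad)
      then have [measurable]: "grad \<phi> \<in> borel_measurable ?M" by (intro measurable_lebesgue_on)
      show "s k \<in> borel_measurable ?M" for k unfolding s_def by measurable
      show "(\<lambda>x. Q x * (grad \<phi> x \<bullet> b)) \<in> borel_measurable ?M" by measurable
      show "AE x in ?M. (\<lambda>k. s k x) \<longlonglongrightarrow> Q x * (grad \<phi> x \<bullet> b)"
        using seq Vpos Qae
      proof eventually_elim
        case (elim x)
        have "(\<lambda>k. \<alpha> k x) \<longlonglongrightarrow> inverse (\<bar>V x\<bar> + 0)"
          unfolding \<alpha>_def using elim by (intro tendsto_intros elim0) auto
        then have a: "(\<lambda>k. \<alpha> k x) \<longlonglongrightarrow> inverse (V x)" using elim by simp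
        have "(\<lambda>k. z x * \<alpha> k x * (grad \<phi> x \<bullet> b) + e k * (\<alpha> k x)\<^sup>2 * (\<phi> x * (h x \<bullet> b))) \<longlonglongrightarrow>
            z x * inverse (V x) * (grad \<phi> x \<bullet> b) + 0 * (inverse (V x))\<^sup>2 * (\<phi> x * (h x \<bullet> b))"
          by (intro tendsto_intros a elim0)
        then show ?case using elim by (simp add: divide_inverse)
      qed
      show "AE x in ?M. norm (s k x) \<le> ?w x" for k
        using seq vpos zpos
      proof eventually_elim
        case (elim x)
        have V: "V x > 0" "z x \<le> V x" "z x > 0" using elim by (auto simp: V_def)
        have \<alpha>: "\<alpha> k x > 0" using V e[of k] by (simp add: \<alpha>_def)
        have za1: "z x * \<alpha> k x \<le> 1" using V e[of k] by (simp add: \<alpha>_def field_simps)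
        have ea: "e k * \<alpha> k x \<le> 1" using V e[of k] by (simp add: \<alpha>_def field_simps)
        have az: "\<alpha> k x \<le> 1 / z x" using za1 V by (simp add: field_simps)
        have "\<bar>z x * \<alpha> k x * (grad \<phi> x \<bullet> b)\<bar> \<le> \<bar>grad \<phi> x \<bullet> b\<bar>"
          using za1 V \<alpha> by (simp add: abs_mult mult_left_le_one_le)
        moreover have "\<bar>e k * (\<alpha> k x)\<^sup>2 * (\<phi> x * (h x \<bullet> b))\<bar> \<le> norm ((\<phi> x / z x) *\<^sub>R h x)"
        proof -
          have "\<bar>e k * (\<alpha> k x)\<^sup>2 * (\<phi> x * (h x \<bullet> b))\<bar> = (e k * \<alpha> k x) * \<alpha> k x * (\<bar>\<phi> x\<bar> * \<bar>h x \<bullet> b\<bar>)"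
            using e[of k] \<alpha> by (simp add: abs_mult power2_eq_square mult.assoc)
          also have "\<dots> \<le> 1 * (1 / z x) * (\<bar>\<phi> x\<bar> * norm (h x))"
            using ea az \<alpha> e[of k] Basis_le_norm[OF b, of "h x"] V
            by (intro mult_mono) (auto simp: mult_nonneg_nonneg)
          also have "\<dots> = norm ((\<phi> x / z x) *\<^sub>R h x)" using V by simp
          finally show ?thesis .
        qed
        ultimately have "\<bar>z x * \<alpha> k x * (grad \<phi> x \<bullet> b) + e k * (\<alpha> k x)\<^sup>2 * (\<phi> x * (h x \<bullet> b))\<bar> \<le> ?w x"
          by (rule order_trans[OF abs_triangle_ineq add_mono])
        then show ?case using elim(1) by simp
      qed
    qed (rule iw)
    then show ?thesis unfolding s0 using LIMSEQ_unique tendsto_const by blast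
  qed
  have "\<bar>Q x\<bar> \<le> 1" for x by (simp add: Q_def)
  then obtain c where c: "AE x in ?M. Q x = c"
    using zero_gradient_const[OF Qm \<Omega> _ weak] by blast
  have zc: "AE x in ?M. z x = c * (z x + v x)"
    using c Qae Vpos by eventually_elim (auto simp: V_def)
  \<comment> \<open>The value 1 would force \<open>v = 0\<close> almost everywhere; it has to be
    excluded before solving for \<open>z\<close>.\<close>
  have c1: "c \<noteq> 1"
  proof -
    have "AE x in ?M. z x = c * (z x + v x) \<and> v x > 0" using zc vpos by eventually_elim simp
    then obtain x where "z x = c * (z x + v x)" "v x > 0" by (rule AE_domain_witness[OF \<Omega>]) blast
    then show ?thesis by auto
  qed
  have "AE x in ?M. z x = (c / (1 - c)) * v x"
    using zc by eventually_elim (use c1 in \<open>simp add: field_simps\<close>)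
  then show ?thesis by (rule that)
qed

text \<open>The gradient in the weak equation and the one approximated in \<open>H10\<close> are
  given independently. They need not be compared pointwise: each component of
  \<open>grad \<phi>\<close> is again a test function, so the pairing of either gradient with
  \<open>grad \<phi>\<close> is determined by \<open>u\<close> alone.\<close>

lemma weak_solution_approximable:
  fixes u :: "'a::euclidean_space \<Rightarrow> real"
  assumes \<Omega>: "domain \<Omega>" and sol: "weak_solution \<Omega> lam u F"
  obtains g where "approximable \<Omega> u g" "has_H1_gradient \<Omega> u g"
    "\<And>\<phi>. \<phi> \<in> test_functions \<Omega> \<Longrightarrow>
      (LINT x|lebesgue_on \<Omega>. g x \<bullet> grad \<phi> x + lam * u x * \<phi> x) = (LINT x|lebesgue_on \<Omega>. F x * \<phi> x)"
proof -
  let ?M = "lebesgue_on \<Omega>"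
  have \<Omega>m: "\<Omega> \<in> sets lebesgue" using \<Omega> by (auto simp: domain_def)
  obtain g where g: "has_H1_gradient \<Omega> u g" and eq: "\<And>\<phi>. \<phi> \<in> test_functions \<Omega> \<Longrightarrow>
      (LINT x|?M. g x \<bullet> grad \<phi> x + lam * u x * \<phi> x) = (LINT x|?M. F x * \<phi> x)"
    and H: "u \<in> H_space \<Omega>"
    using sol by (auto simp: weak_solution_def)
  show ?thesis
  proof (cases "\<Omega> = UNIV")
    case True
    then have "approximable \<Omega> u g" using g approximable_whole_space by blast
    then show ?thesis using g eq by (rule that)
  next
    case False
    then have "u \<in> H10 \<Omega>" using H by (simp add: H_space_def)
    then obtain g' where g': "has_H1_gradient \<Omega> u g'" and "\<exists>\<phi>::nat \<Rightarrow> 'a \<Rightarrow> real. (\<forall>k. \<phi> k \<in> test_functions \<Omega>) \<and>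
         (\<lambda>k. LINT x|?M. (u x - \<phi> k x)\<^sup>2 + (norm (g' x - grad (\<phi> k) x))\<^sup>2) \<longlonglongrightarrow> 0"
      unfolding H10_def by blast
    then have "approximable \<Omega> u g'" by (simp add: approximable_def has_H1_gradient_def)
    then show ?thesis
    proof (rule that[OF _ g'])
      fix \<phi> assume \<phi>: "\<phi> \<in> test_functions \<Omega>"
      have uL: "u \<in> L2 \<Omega>" using g by (simp add: has_H1_gradient_def)
      have expand: "(LINT x|?M. k x \<bullet> grad \<phi> x + lam * u x * \<phi> x) =
          (\<Sum>b\<in>Basis. - (LINT x|?M. u x * (grad (\<lambda>x. grad \<phi> x \<bullet> b) x \<bullet> b))) + lam * (LINT x|?M. u x * \<phi> x)"
        if k: "has_H1_gradient \<Omega> u k" for k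
      proof -
        have kL: "k \<in> L2 \<Omega>" using k by (simp add: has_H1_gradient_def)
        have t: "(\<lambda>x. grad \<phi> x \<bullet> b) \<in> test_functions \<Omega>" for b by (rule test_grad_inner[OF \<phi>])
        have ib: "integrable ?M (\<lambda>x. (k x \<bullet> b) * (grad \<phi> x \<bullet> b))" for b
          using L2_inner_integrable(1)[OF L2_inner_const[OF kL] test_L2[OF t \<Omega>m], of b b] by simp
        have iu: "integrable ?M (\<lambda>x. lam * (u x * \<phi> x))"
          using L2_inner_integrable(1)[OF uL test_L2[OF \<phi> \<Omega>m]] by simp
        have "(LINT x|?M. k x \<bullet> grad \<phi> x + lam * u x * \<phi> x) =
            (LINT x|?M. (\<Sum>b\<in>Basis. (k x \<bullet> b) * (grad \<phi> x \<bullet> b)) + lam * (u x * \<phi> x))"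
          by (intro Bochner_Integration.integral_cong refl) (simp add: euclidean_inner[of "k _" "grad \<phi> _"] mult.assoc)
        also have "\<dots> = (\<Sum>b\<in>Basis. (LINT x|?M. (k x \<bullet> b) * (grad \<phi> x \<bullet> b))) + (LINT x|?M. lam * (u x * \<phi> x))"
          using ib iu by (subst Bochner_Integration.integral_add) (auto intro!: Bochner_Integration.integral_sum)
        also have "(\<Sum>b\<in>Basis. (LINT x|?M. (k x \<bullet> b) * (grad \<phi> x \<bullet> b))) =
            (\<Sum>b\<in>Basis. - (LINT x|?M. u x * (grad (\<lambda>x. grad \<phi> x \<bullet> b) x \<bullet> b)))"
          using k t by (intro sum.cong refl) (auto simp: has_H1_gradient_def)
        finally show ?thesis by simp
      qed
      show "(LINT x|?M. g' x \<bullet> grad \<phi> x + lam * u x * \<phi> x) = (LINT x|?M. F x * \<phi> x)"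
        using eq[OF \<phi>] expand[OF g] expand[OF g'] by simp
    qed
  qed
qed

section \<open>From the system to linear equations; scaling in \<open>H\<close>\<close>

lemma locally_integrable_test:
  fixes F :: "'a::euclidean_space \<Rightarrow> real"
  assumes \<Omega>: "\<Omega> \<in> sets lebesgue" and F: "\<And>K. compact K \<and> K \<subseteq> \<Omega> \<Longrightarrow> set_integrable lebesgue K F"
    and \<eta>: "\<eta> \<in> test_functions \<Omega>"
  shows "integrable (lebesgue_on \<Omega>) (\<lambda>x. F x * \<eta> x)"
proof -
  have K: "compact (supp \<eta>)" "supp \<eta> \<subseteq> \<Omega>" using \<eta> by (auto simp: test_functions_iff)
  have i: "integrable lebesgue (\<lambda>x. indicator (supp \<eta>) x * F x)"
    using F[of "supp \<eta>"] K by (simp add: set_integrable_def)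
  obtain C where C: "\<And>x. \<bar>\<eta> x\<bar> \<le> C" using test_bounded[OF \<eta>] by metis
  have "\<eta> \<in> borel_measurable lebesgue" using test_measurable[OF \<eta>] by (intro measurable_completion) simp
  then have "integrable lebesgue (\<lambda>x. indicator (supp \<eta>) x * F x * \<eta> x)"
    using integrable_mult_bounded[OF i] C by blast
  moreover have "indicator (supp \<eta>) x * F x * \<eta> x = indicator \<Omega> x *\<^sub>R (F x * \<eta> x)" for x
  proof (cases "x \<in> supp \<eta>")
    case True
    then have "x \<in> \<Omega>" using K by blast
    then show ?thesis using True by simp
  next
    case False
    then have "\<eta> x = 0" by (rule test_zero_outside)
    then show ?thesis by simp
  qed
  ultimately show ?thesis using \<Omega> by (simp add: integrable_restrict_space)
qed

lemma has_H1_gradient_scale: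
  assumes "has_H1_gradient \<Omega> u g" shows "has_H1_gradient \<Omega> (\<lambda>x. c * u x) (\<lambda>x. c *\<^sub>R g x)"
  using assms L2_scaleR[of u \<Omega> c] L2_scaleR[of g \<Omega> c] by (auto simp: has_H1_gradient_def mult.assoc)

lemma H_space_scale:
  fixes u :: "'a::euclidean_space \<Rightarrow> real"
  assumes \<Omega>: "\<Omega> \<in> sets lebesgue" and "u \<in> H_space \<Omega>" shows "(\<lambda>x. c * u x) \<in> H_space \<Omega>"
proof (cases "\<Omega> = UNIV")
  case True
  then obtain g v where g: "has_H1_gradient UNIV u g" and v: "AE x in lebesgue. u x = v (norm x)"
    using assms by (auto simp: H_space_def H1_def radially_symmetric_def)
  have "AE x in lebesgue. c * u x = c * v (norm x)" using v by eventually_elim simp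
  then have "radially_symmetric (\<lambda>x. c * u x)" unfolding radially_symmetric_def by (rule exI[of _ "\<lambda>r. c * v r"])
  moreover have "(\<lambda>x. c * u x) \<in> H1 UNIV" using has_H1_gradient_scale[OF g] by (auto simp: H1_def)
  ultimately show ?thesis using True by (simp add: H_space_def)
next
  case False
  then obtain g \<phi> where g: "has_H1_gradient \<Omega> u g" and \<phi>: "\<And>k::nat. \<phi> k \<in> test_functions \<Omega>"
    and lim: "(\<lambda>k. LINT x|lebesgue_on \<Omega>. (u x - \<phi> k x)\<^sup>2 + (norm (g x - grad (\<phi> k) x))\<^sup>2) \<longlonglongrightarrow> 0"
    using assms by (auto simp: H_space_def H10_def)
  have "(u x * c - \<phi> k x * c)\<^sup>2 + (norm (c *\<^sub>R g x - grad (\<lambda>x. \<phi> k x * c) x))\<^sup>2 =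
      c\<^sup>2 * ((u x - \<phi> k x)\<^sup>2 + (norm (g x - grad (\<phi> k) x))\<^sup>2)" for k x
  proof -
    have "grad (\<lambda>x. \<phi> k x * c) x = c *\<^sub>R grad (\<phi> k) x"
      using grad_scale[OF test_smooth[OF \<phi>[of k]], of c x] by (simp add: mult.commute)
    then have "c *\<^sub>R g x - grad (\<lambda>x. \<phi> k x * c) x = c *\<^sub>R (g x - grad (\<phi> k) x)" by (simp add: scaleR_diff_right)
    then show ?thesis
      unfolding left_diff_distrib[symmetric] by (simp add: power_mult_distrib distrib_left mult.commute)
  qed
  moreover have "(\<lambda>k. c\<^sup>2 * (LINT x|lebesgue_on \<Omega>. (u x - \<phi> k x)\<^sup>2 + (norm (g x - grad (\<phi> k) x))\<^sup>2)) \<longlonglongrightarrow> c\<^sup>2 * 0"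
    by (intro tendsto_intros lim)
  ultimately have "(\<lambda>k. LINT x|lebesgue_on \<Omega>. (c * u x - \<phi> k x * c)\<^sup>2 + (norm (c *\<^sub>R g x - grad (\<lambda>x. \<phi> k x * c) x))\<^sup>2) \<longlonglongrightarrow> 0"
    by (simp add: mult.commute)
  moreover have "(\<lambda>x. \<phi> k x * c) \<in> test_functions \<Omega>" for k by (intro test_mult \<phi> smooth_const)
  ultimately have "(\<lambda>x. c * u x) \<in> H10 \<Omega>"
    unfolding H10_def using has_H1_gradient_scale[OF g, of c]
    by (intro CollectI exI[of _ "\<lambda>x. c *\<^sub>R g x"] conjI exI[of _ "\<lambda>k x. \<phi> k x * c"]) auto
  then show ?thesis using False by (simp add: H_space_def)
qed

lemma weak_solution_linear:
  fixes u :: "'n::finite \<Rightarrow> 'a::euclidean_space \<Rightarrow> real" and A :: "real^'n^'n"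
  assumes \<Omega>: "domain \<Omega>" and nonneg: "\<And>i j. A $ i $ j \<ge> 0"
    and sol: "positive_vector_solution \<Omega> lam A u"
  obtains g where "\<And>i. linear_solution \<Omega> lam (\<lambda>x. \<Sum>j\<in>UNIV. A $ i $ j * (u j x)\<^sup>2) (u i) (g i)"
proof -
  let ?M = "lebesgue_on \<Omega>"
  have \<Omega>m: "\<Omega> \<in> sets lebesgue" using \<Omega> by (auto simp: domain_def)
  have w: "weak_solution \<Omega> lam (u i) (\<lambda>x. \<Sum>j\<in>UNIV. A $ i $ j * u i x * (u j x)\<^sup>2)"
    and pos: "AE x in ?M. u i x > 0" for i
    using sol by (auto simp: positive_vector_solution_def positive_in_def)
  have F: "(\<Sum>j\<in>UNIV. A $ i $ j * u i x * (u j x)\<^sup>2) = (\<Sum>j\<in>UNIV. A $ i $ j * (u j x)\<^sup>2) * u i x" for i x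
    by (simp add: sum_distrib_left mult_ac)
  have "\<forall>i. \<exists>k. approximable \<Omega> (u i) k \<and> has_H1_gradient \<Omega> (u i) k \<and> (\<forall>\<phi>\<in>test_functions \<Omega>.
      (LINT x|?M. k x \<bullet> grad \<phi> x + lam * u i x * \<phi> x) = (LINT x|?M. (\<Sum>j\<in>UNIV. A $ i $ j * (u j x)\<^sup>2) * u i x * \<phi> x))" (is "\<forall>i. ?P i")
  proof
    fix i show "?P i" by (rule weak_solution_approximable[OF \<Omega> w[of i, unfolded F]]) blast
  qed
  from choice[OF this] obtain g where g: "\<And>i. approximable \<Omega> (u i) (g i)" "\<And>i. has_H1_gradient \<Omega> (u i) (g i)"
    "\<And>i \<phi>. \<phi> \<in> test_functions \<Omega> \<Longrightarrow> (LINT x|?M. g i x \<bullet> grad \<phi> x + lam * u i x * \<phi> x) =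
      (LINT x|?M. (\<Sum>j\<in>UNIV. A $ i $ j * (u j x)\<^sup>2) * u i x * \<phi> x)"
    by blast
  have uL: "u i \<in> L2 \<Omega>" for i using g(1)[of i] by (simp add: approximable_def)
  note [measurable] = L2_measurable[OF uL]
  have "linear_solution \<Omega> lam (\<lambda>x. \<Sum>j\<in>UNIV. A $ i $ j * (u j x)\<^sup>2) (u i) (g i)" for i
    unfolding linear_solution_def
  proof (intro conjI ballI allI)
    show "(\<lambda>x. \<Sum>j\<in>UNIV. A $ i $ j * (u j x)\<^sup>2) \<in> borel_measurable ?M" by measurable
    show "0 \<le> (\<Sum>j\<in>UNIV. A $ i $ j * (u j x)\<^sup>2)" for x using nonneg by (intro sum_nonneg) auto
    fix \<eta> assume \<eta>: "\<eta> \<in> test_functions \<Omega>"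
    have "\<forall>K. compact K \<and> K \<subseteq> \<Omega> \<longrightarrow> set_integrable lebesgue K (\<lambda>x. (\<Sum>j\<in>UNIV. A $ i $ j * (u j x)\<^sup>2) * u i x)"
      using w[of i, unfolded F] by (simp add: weak_solution_def)
    then show "integrable ?M (\<lambda>x. (\<Sum>j\<in>UNIV. A $ i $ j * (u j x)\<^sup>2) * u i x * \<eta> x)"
      by (intro locally_integrable_test[OF \<Omega>m _ \<eta>]) blast
  qed (use g pos in auto)
  then show ?thesis by (rule that)
qed

text \<open>Picone's inequality and the energy estimate give \<open>\<integral>f\<^sub>i u\<^sub>j\<^sup>2 \<le> \<integral>f\<^sub>j u\<^sub>j\<^sup>2\<close>; averaging over \<open>i\<close> with
  the weights \<open>p\<close> and summing over \<open>j\<close>, the matrix inequality forces equality.\<close>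

lemma components_proportional:
  fixes u :: "'n::finite \<Rightarrow> 'a::euclidean_space \<Rightarrow> real" and A :: "real^'n^'n"
  assumes \<Omega>: "domain \<Omega>" and lam: "lam > 0" and sym: "transpose A = A"
    and one: "num_positive_eigenvalues A = 1" and nonneg: "\<And>i j. A $ i $ j \<ge> 0"
    and row: "\<And>i. (\<Sum>j\<in>UNIV. A $ i $ j) > 0" and sol: "positive_vector_solution \<Omega> lam A u"
  obtains i c where "\<And>j. AE x in lebesgue_on \<Omega>. u j x = c j * u i x"
proof -
  let ?M = "lebesgue_on \<Omega>"
  have \<Omega>m: "\<Omega> \<in> sets lebesgue" using \<Omega> by (auto simp: domain_def)
  define f where "f i x = (\<Sum>j\<in>UNIV. A $ i $ j * (u j x)\<^sup>2)" for i x
  obtain g where lin: "\<And>i. linear_solution \<Omega> lam (f i) (u i) (g i)"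
    unfolding f_def[abs_def] by (rule weak_solution_linear[OF \<Omega> nonneg sol]) blast
  have ap: "approximable \<Omega> (u j) (g j)" for j using lin[of j] by (simp add: linear_solution_def)
  note P = Picone[OF \<Omega>m lam lin ap] and E = energy_le[OF \<Omega>m lam lin]
  \<comment> \<open>Picone's inequality for \<open>u i\<close> applied to \<open>u j\<close>,
    combined with the energy bound for \<open>u j\<close>, leaves the remainder below this gap. So a
    vanishing gap makes the gradients parallel.\<close>
  define d where "d i j = (LINT x|?M. f j x * (u j x)\<^sup>2) - (LINT x|?M. f i x * (u j x)\<^sup>2)" for i j
  have gap: "(LINT x|?M. (norm (g j x - (u j x / u i x) *\<^sub>R g i x))\<^sup>2) \<le> d i j" for i j
    using P(3)[of j i] E[of j] by (simp add: d_def)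
  have d0: "d i j \<ge> 0" for i j
    by (rule order_trans[OF _ gap]) simp
  obtain p :: "real^'n" where p: "\<And>i. p $ i \<ge> 0" "(\<Sum>i\<in>UNIV. p $ i) = 1"
    "\<And>w :: real^'n. (\<And>i. w $ i \<ge> 0) \<Longrightarrow> w \<bullet> (A *v w) \<le> (\<Sum>j\<in>UNIV. w $ j) * (p \<bullet> (A *v w))"
    using maximal_weight_exists[OF sym one nonneg row] by blast
  have "(\<Sum>i\<in>UNIV. \<Sum>j\<in>UNIV. p $ i * d i j) \<le> 0"
  proof -
    have "(\<Sum>i\<in>UNIV. \<Sum>j\<in>UNIV. p $ i * d i j) =
        (LINT x|?M. (\<Sum>i\<in>UNIV. \<Sum>j\<in>UNIV. p $ i * (f j x * (u j x)\<^sup>2 - f i x * (u j x)\<^sup>2)))"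
      using P(2) by (simp add: d_def)
    also have "\<dots> \<le> (LINT x|?M. 0)"
    proof (rule integral_mono)
      fix x
      define w :: "real^'n" where "w = (\<chi> j. (u j x)\<^sup>2)"
      have Aw: "(A *v w) $ i = f i x" for i by (simp add: matrix_vector_mult_def w_def f_def)
      \<comment> \<open>Since the weights sum to 1, the first part of the double sum loses its
        dependence on \<open>p\<close> and the matrix inequality for \<open>p\<close> applies
        pointwise.\<close>
      have "(\<Sum>i\<in>UNIV. \<Sum>j\<in>UNIV. p $ i * (f j x * (u j x)\<^sup>2 - f i x * (u j x)\<^sup>2)) =
          (\<Sum>i\<in>UNIV. p $ i) * (\<Sum>j\<in>UNIV. f j x * (u j x)\<^sup>2) - (\<Sum>i\<in>UNIV. p $ i * f i x) * (\<Sum>j\<in>UNIV. (u j x)\<^sup>2)"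
        by (simp add: sum_product sum_subtractf right_diff_distrib mult_ac)
      also have "\<dots> = w \<bullet> (A *v w) - (\<Sum>j\<in>UNIV. w $ j) * (p \<bullet> (A *v w))"
        by (simp add: p(2) inner_vec_def Aw) (simp add: w_def mult.commute)
      also have "\<dots> \<le> 0" using p(3)[of w] by (simp add: w_def)
      finally show "(\<Sum>i\<in>UNIV. \<Sum>j\<in>UNIV. p $ i * (f j x * (u j x)\<^sup>2 - f i x * (u j x)\<^sup>2)) \<le> 0" .
    qed (use P(2) in auto)
    finally show ?thesis by simp
  qed
  moreover have "\<exists>i. p $ i > 0"
  proof (rule ccontr)
    assume "\<nexists>i. p $ i > 0"
    then have "p $ i = 0" for i using p(1)[of i] by (metis order_le_less)
    then show False using p(2) by simp
  qed
  then obtain i where i: "p $ i > 0" by blast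
  ultimately have dz: "d i j = 0" for j
  proof -
    assume s: "(\<Sum>i\<in>UNIV. \<Sum>j\<in>UNIV. p $ i * d i j) \<le> 0"
    have nn: "p $ i * d i j \<ge> 0" for i j using p(1) d0 by simp
    have "p $ i * d i j \<le> (\<Sum>j\<in>UNIV. p $ i * d i j)" using nn by (intro member_le_sum) auto
    also have "\<dots> \<le> (\<Sum>i\<in>UNIV. \<Sum>j\<in>UNIV. p $ i * d i j)"
      using nn by (intro member_le_sum[of i UNIV "\<lambda>i. \<Sum>j\<in>UNIV. p $ i * d i j"] sum_nonneg) auto
    finally have "p $ i * d i j = 0" using s nn[of i j] by linarith
    then show ?thesis using i by simp
  qed
  have "\<exists>c. AE x in ?M. u j x = c * u i x" for j
  proof -
    have "(LINT x|?M. (norm (g j x - (u j x / u i x) *\<^sub>R g i x))\<^sup>2) = 0"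
      using gap[of j i] dz[of j] by (intro antisym) auto
    then have "AE x in ?M. g j x = (u j x / u i x) *\<^sub>R g i x"
      using integral_nonneg_eq_0_iff_AE[OF P(1)[of j i]] by simp
    then show ?thesis using proportional_of_gradients[OF \<Omega> lam lin lin] by metis
  qed
  then obtain c where "\<And>j. AE x in ?M. u j x = c j * u i x" by metis
  then show ?thesis by (rule that)
qed

section \<open>Rescaling one component to a solution of the scalar equation\<close>

theorem theorem5p1:
  fixes \<Omega> :: "(real^'N) set" and lam :: real
    and A :: "real^'n^'n" and u :: "'n \<Rightarrow> real^'N \<Rightarrow> real"
  assumes "CARD('N) \<le> 3" and "domain \<Omega>" and "lam > 0"
    and "transpose A = A"
    and "num_positive_eigenvalues A = 1"
    and "\<And>i j. A $ i $ j \<ge> 0"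
    and "\<And>i. (\<Sum>j\<in>UNIV. A $ i $ j) > 0"
    and "positive_vector_solution \<Omega> lam A u"
  shows "synchronized \<Omega> lam u"
proof -
  let ?M = "lebesgue_on \<Omega>"
  have \<Omega>m: "\<Omega> \<in> sets lebesgue" using assms(2) by (auto simp: domain_def)
  obtain i c where prp: "\<And>j. AE x in ?M. u j x = c j * u i x"
    using components_proportional[OF assms(2-8)] by metis
  have w: "weak_solution \<Omega> lam (u i) (\<lambda>x. \<Sum>j\<in>UNIV. A $ i $ j * u i x * (u j x)\<^sup>2)"
    and pos: "AE x in ?M. u j x > 0" for j
    using assms(8) by (auto simp: positive_vector_solution_def positive_in_def)
  define F where "F x = (\<Sum>j\<in>UNIV. A $ i $ j * u i x * (u j x)\<^sup>2)" for x
  \<comment> \<open>Substituting \<open>u j = c j * u i\<close> turns the right-hand side of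
    equation \<open>i\<close> into \<open>d * (u i)^3\<close>. Positivity of \<open>d\<close> needs
    one positive entry in row \<open>i\<close>, given by the row sum, and nonzero factors
    \<open>c j\<close>.\<close>
  define d where "d = (\<Sum>j\<in>UNIV. A $ i $ j * (c j)\<^sup>2)"
  have "c j \<noteq> 0" for j
  proof -
    have "AE x in ?M. u j x > 0 \<and> u j x = c j * u i x"
      using pos[of j] prp[of j] by eventually_elim simp
    then obtain x where "u j x > 0" "u j x = c j * u i x" by (rule AE_domain_witness[OF assms(2)]) blast
    then show ?thesis by auto
  qed
  moreover obtain j where "A $ i $ j > 0"
    using assms(7)[of i] by (meson not_less sum_nonpos)
  ultimately have d: "d > 0"
    unfolding d_def using assms(6) by (intro sum_pos2[of UNIV j]) auto
  have FU: "AE x in ?M. F x = d * (u i x) ^ 3"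
  proof -
    have "AE x in ?M. \<forall>j\<in>UNIV. u j x = c j * u i x" using prp by (intro AE_finite_allI) auto
    then show ?thesis
    proof eventually_elim
      case (elim x)
      have "F x = (\<Sum>j\<in>UNIV. A $ i $ j * u i x * (c j * u i x)\<^sup>2)"
        unfolding F_def using elim by (intro sum.cong refl) metis
      also have "\<dots> = d * (u i x) ^ 3"
        unfolding d_def sum_distrib_right by (intro sum.cong refl) (simp add: power_mult_distrib power3_eq_cube power2_eq_square)
      finally show ?case .
    qed
  qed
  \<comment> \<open>The factor \<open>sqrt d\<close> normalizes the cubic coefficient:
    \<open>sqrt d * (d * (u i)^3)\<close> is the cube of \<open>sqrt d * u i\<close>.\<close>
  define U where "U x = sqrt d * u i x" for x
  have U3: "AE x in ?M. (U x) ^ 3 = sqrt d * F x"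
    using FU
  proof eventually_elim
    case (elim x)
    have "(sqrt d) ^ 3 = sqrt d * d" using d by (simp add: power3_eq_cube)
    then show ?case by (simp add: U_def elim power_mult_distrib)
  qed
  obtain g where H: "u i \<in> H_space \<Omega>" and loc: "\<And>K. compact K \<Longrightarrow> K \<subseteq> \<Omega> \<Longrightarrow> set_integrable lebesgue K F"
    and g: "has_H1_gradient \<Omega> (u i) g" and eq: "\<And>\<phi>. \<phi> \<in> test_functions \<Omega> \<Longrightarrow>
      (LINT x|?M. g x \<bullet> grad \<phi> x + lam * u i x * \<phi> x) = (LINT x|?M. F x * \<phi> x)"
    using w by (auto simp: weak_solution_def F_def[abs_def])
  have [measurable]: "u i \<in> borel_measurable ?M"
    using g by (auto simp: has_H1_gradient_def dest: L2_measurable)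
  have Um [measurable]: "U \<in> borel_measurable ?M" unfolding U_def by measurable
  have "weak_solution \<Omega> lam U (\<lambda>x. (U x) ^ 3)"
    unfolding weak_solution_def
  proof (intro conjI allI impI exI[of _ "\<lambda>x. sqrt d *\<^sub>R g x"] ballI)
    show "U \<in> H_space \<Omega>" unfolding U_def[abs_def] by (rule H_space_scale[OF \<Omega>m H])
    show "has_H1_gradient \<Omega> U (\<lambda>x. sqrt d *\<^sub>R g x)"
      unfolding U_def[abs_def] by (rule has_H1_gradient_scale[OF g])
  next
    fix K assume K: "compact K \<and> K \<subseteq> \<Omega>"
    \<comment> \<open>Measurability of \<open>U\<close> is known only on \<open>\<Omega>\<close>, so
      it is cut off to \<open>\<Omega>\<close> before being restricted to \<open>K\<close>.\<close>
    have "(\<lambda>x. indicator \<Omega> x *\<^sub>R (U x) ^ 3) \<in> borel_measurable lebesgue"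
      using \<Omega>m by (subst borel_measurable_restrict_space_iff[symmetric]) auto
    then have "(\<lambda>x. indicator K x * (indicator \<Omega> x *\<^sub>R (U x) ^ 3)) \<in> borel_measurable lebesgue"
      using K by (intro borel_measurable_times borel_measurable_indicator) (auto simp: compact_imp_closed)
    moreover have "(\<lambda>x. indicator K x * (indicator \<Omega> x *\<^sub>R (U x) ^ 3)) = (\<lambda>x. indicator K x *\<^sub>R (U x) ^ 3)"
      using K by (auto simp: indicator_def fun_eq_iff)
    ultimately have m: "(\<lambda>x. indicator K x *\<^sub>R (U x) ^ 3) \<in> borel_measurable lebesgue" by simp
    have "AE x in lebesgue. x \<in> \<Omega> \<longrightarrow> (U x) ^ 3 = sqrt d * F x"
      using U3 \<Omega>m by (subst (asm) AE_restrict_space_iff) auto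
    then have ae: "AE x in lebesgue. sqrt d * (indicator K x *\<^sub>R F x) = indicator K x *\<^sub>R (U x) ^ 3"
      by eventually_elim (use K in \<open>auto simp: indicator_def\<close>)
    have "integrable lebesgue (\<lambda>x. sqrt d * (indicator K x *\<^sub>R F x))"
      using loc[of K] K unfolding set_integrable_def by (intro integrable_mult_right) blast
    from integrable_cong_AE_imp[OF this m ae]
    show "set_integrable lebesgue K (\<lambda>x. (U x) ^ 3)"
      unfolding set_integrable_def .
  next
    fix \<phi> assume \<phi>: "\<phi> \<in> test_functions \<Omega>"
    have "(LINT x|?M. (sqrt d *\<^sub>R g x) \<bullet> grad \<phi> x + lam * U x * \<phi> x) =
        (LINT x|?M. sqrt d * (g x \<bullet> grad \<phi> x + lam * u i x * \<phi> x))"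
      by (intro Bochner_Integration.integral_cong refl) (simp add: U_def algebra_simps)
    also have "\<dots> = (LINT x|?M. sqrt d * F x * \<phi> x)"
      using eq[OF \<phi>] by (simp add: mult.assoc)
    also have "\<dots> = (LINT x|?M. (U x) ^ 3 * \<phi> x)"
    proof (rule integral_cong_AE)
      have "integrable ?M (\<lambda>x. F x * \<phi> x)"
        by (rule locally_integrable_test[OF \<Omega>m _ \<phi>]) (use loc in blast)
      then have "(\<lambda>x. F x * \<phi> x) \<in> borel_measurable ?M" by simp
      then have "(\<lambda>x. sqrt d * (F x * \<phi> x)) \<in> borel_measurable ?M" by measurable
      then show "(\<lambda>x. sqrt d * F x * \<phi> x) \<in> borel_measurable ?M" by (simp add: mult.assoc)
      have [measurable]: "\<phi> \<in> borel_measurable ?M" by (intro measurable_lebesgue_on test_measurable[OF \<phi>])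
      show "(\<lambda>x. (U x) ^ 3 * \<phi> x) \<in> borel_measurable ?M" by measurable
      show "AE x in ?M. sqrt d * F x * \<phi> x = (U x) ^ 3 * \<phi> x" using U3 by eventually_elim simp
    qed
    finally show "(LINT x|?M. (sqrt d *\<^sub>R g x) \<bullet> grad \<phi> x + lam * U x * \<phi> x) = (LINT x|?M. (U x) ^ 3 * \<phi> x)" .
  qed
  moreover have "positive_in \<Omega> U"
    unfolding positive_in_def using pos[of i] by eventually_elim (use d in \<open>simp add: U_def\<close>)
  ultimately have "positive_scalar_solution \<Omega> lam U" by (simp add: positive_scalar_solution_def)
  moreover have "AE x in ?M. u j x = (\<chi> j. c j / sqrt d) $ j * U x" for j
    using prp[of j] by eventually_elim (use d in \<open>simp add: U_def\<close>)
  ultimately show ?thesis unfolding synchronized_def by blast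
qed

end
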